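(* Let $\mathcal{C}$ be a path-connected nonsymmetric topological operad with a good basepoint $\{e_k\}_{k\ge0}$. Then for every $l\ge1$, $\pi_l\mathcal{C}=\{\pi_l(\mathcal{C}(k),e_k)\}_{k\ge0}$ is a $\pi_1\mathcal{C}$-operad, with the composition $$\gamma([f];[g_1],\ldots,[g_k])=\delta_*[\gamma(f;g_1,\ldots,g_k)],\qquad [f]\in\pi_l(\mathcal{C}(k),e_k),\ [g_i]\in\pi_l(\mathcal{C}(m_i),e_{m_i}),$$ and with the usual action of $\pi_1(\mathcal{C}(k),e_k)$ on $\pi_l(\mathcal{C}(k),e_k)$ (the conjugation action if $l=1$). Here $\delta$ is the linear path from $e_m$ to $\gamma(e_k;e_{m_1},\ldots,e_{m_k})$, $m=m_1+\cdots+m_k$, and $\delta_*:\pi_l(\mathcal{C}(m),\gamma(e_k;e_{m_1},\ldots,e_{m_k}))\to\pi_l(\mathcal{C}(m),e_m)$ is the change-of-basepoint isomorphism along $\delta$.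
   Context: All spaces are compactly generated Hausdorff. A (nonsymmetric) topological operad $\mathcal{C}$ consists of spaces $\mathcal{C}(n)$, $n\ge 0$, with $\mathcal{C}(0)=*$, continuous maps $\gamma:\mathcal{C}(k)\times\mathcal{C}(m_1)\times\cdots\times\mathcal{C}(m_k)\to\mathcal{C}(m_1+\cdots+m_k)$ ($k\ge1$, $m_i\ge0$) and a unit $1\in\mathcal{C}(1)$, such that $\gamma(\gamma(a;b_1,\ldots,b_k);c_1,\ldots,c_m)=\gamma(a;\gamma(b_1;c_1,\ldots,c_{m_1}),\ldots,\gamma(b_k;c_{m_1+\cdots+m_{k-1}+1},\ldots,c_m))$, $\gamma(1;a)=a$, $\gamma(a;1,\ldots,1)=a$. It is path-connected if each $\mathcal{C}(k)$ is. Morphisms preserve $\gamma$ and the unit. An operad of sets is a discrete topological operad. Good basepoint: $\mathcal{C}_1$ is the little intervals operad: $\mathcal{C}_1(k)$ is the space of $k$-tuples of increasing affine embeddings $[0,1]\to[0,1]$ with images having pairwise disjoint interiors, $\mathcal{C}_1(0)=*$, unit the identity, $\gamma(c;d^1,\ldots,d^k)$ the tuple of all composites $c_i\circ d^i_j$ in lexicographic order. Let $c_0=*$, $c_k=([0,\frac1k],\ldots,[\frac{k-1}k,1])$ and let $\mathcal{C}_1(k)_0$ be the path component of $c_k$; $(\mathcal{C}_1)_0=\{\mathcal{C}_1(k)_0\}$ is a nonsymmetric operad. A good basepoint of $\mathcal{C}$ is $\{e_k=\eta(c_k)\}$ for a chosen morphism of nonsymmetric operads $\eta:(\mathcal{C}_1)_0\to\mathcal{C}$.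 For $u,v\in\mathcal{C}_1(k)_0$ the path $t\mapsto\eta((1-t)u+tv)$ is the linear path from $\eta(u)$ to $\eta(v)$; the linear path $\delta$ from $e_m$ to $\gamma(e_k;e_{m_1},\ldots,e_{m_k})$ uses $u=c_m$, $v=\gamma(c_k;c_{m_1},\ldots,c_{m_k})$. Also $\gamma(f;g_1,\ldots,g_k)(z)=\gamma(f(z);g_1(z),\ldots,g_k(z))$ for $z\in S^l$. A group operad $\mathcal{G}=\{G_n\}$ is an operad of sets with a morphism of operads $\pi$ to the symmetric groups operad such that each $G_n$ is a group and $\pi:G_n\to S_n$ a homomorphism, the identity of $G_1$ is the unit, and $\gamma(aa';b_1b_1',\ldots,b_kb_k')=\gamma(a;b_1,\ldots,b_k)\gamma(a';b'_{a^{-1}(1)},\ldots,b'_{a^{-1}(k)})$ with $a(i)=\pi(a)(i)$; it is non-crossed if all $\pi$ are trivial. For a group operad $\mathcal{G}$, a $\mathcal{G}$-operad is an operad $\mathcal{D}$ with left actions of $G_n$ on $\mathcal{D}(n)$ such that $\gamma(\sigma a;\tau_1b_1,\ldots,\tau_kb_k)=\gamma(\sigma;\tau_1,\ldots,\tau_k)\gamma(a;b_{\sigma^{-1}(1)},\ldots,b_{\sigma^{-1}(k)})$ for $\sigma\in G_k$, $\tau_i\in G_{m_i}$. $\pi_1\mathcal{C}=\{\pi_1(\mathcal{C}(k),e_k)\}$ is regarded as a non-crossed group operad with trivial $\pi$ and composition $\gamma([f];[g_1],\ldots,[g_k])=[\delta][\gamma(f;g_1,\ldots,g_k)][\delta]^{-1}$.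 *)

theory Defs
  imports "HOL-Analysis.Analysis" "HOL-Algebra.Group_Action" "HOL-Combinatorics.Permutations"
begin

section \<open>Topological operads\<close>

text \<open>
  Products are formed in the category of compactly generated Hausdorff spaces, so the
  usual product topology has to be replaced by its compactly generated refinement.
\<close>

definition kification :: "'a topology \<Rightarrow> 'a topology" where
  "kification X = topology (\<lambda>U. U \<subseteq> topspace X \<and>
     (\<forall>K. compactin X K \<longrightarrow> openin (subtopology X K) (K \<inter> U)))"

lemma openin_kification:
  "openin (kification X) U \<longleftrightarrow>
     U \<subseteq> topspace X \<and> (\<forall>K. compactin X K \<longrightarrow> openin (subtopology X K) (K \<inter> U))"
proof -
  have "istopology (\<lambda>U. U \<subseteq> topspace X \<and>
          (\<forall>K. compactin X K \<longrightarrow> openin (subtopology X K) (K \<inter> U)))"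
    unfolding istopology_def
  proof (rule conjI; intro allI impI)
    fix S T
    assume S: "S \<subseteq> topspace X \<and> (\<forall>K. compactin X K \<longrightarrow> openin (subtopology X K) (K \<inter> S))"
      and T: "T \<subseteq> topspace X \<and> (\<forall>K. compactin X K \<longrightarrow> openin (subtopology X K) (K \<inter> T))"
    have "openin (subtopology X K) (K \<inter> (S \<inter> T))" if "compactin X K" for K
    proof -
      have "openin (subtopology X K) ((K \<inter> S) \<inter> (K \<inter> T))"
        by (rule openin_Int) (use S T that in simp_all)
      moreover have "(K \<inter> S) \<inter> (K \<inter> T) = K \<inter> (S \<inter> T)" by blast
      ultimately show ?thesis by (simp only:)
    qed
    then show "S \<inter> T \<subseteq> topspace X \<and>
        (\<forall>K. compactin X K \<longrightarrow> openin (subtopology X K) (K \<inter> (S \<inter> T)))"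
      using S by blast
  next
    fix \<K> :: "'a set set"
    assume *: "\<forall>U\<in>\<K>. U \<subseteq> topspace X \<and>
                 (\<forall>K. compactin X K \<longrightarrow> openin (subtopology X K) (K \<inter> U))"
    have "openin (subtopology X K) (K \<inter> \<Union>\<K>)" if "compactin X K" for K
      unfolding Int_Union by (rule openin_Union) (use * that in auto)
    then show "\<Union>\<K> \<subseteq> topspace X \<and>
        (\<forall>K. compactin X K \<longrightarrow> openin (subtopology X K) (K \<inter> \<Union>\<K>))"
      using * by blast
  qed
  then show ?thesis
    unfolding kification_def by (simp add: topology_inverse')
qed

text \<open>
  All spaces of an operad live on one type but need not be disjoint, so the composition
  takes the list of arities \<open>[m\<^sub>1, \<dots>, m\<^sub>k]\<close> as its first argument:
  \<open>ocomp \<C> ms a bs\<close> is \<open>\<gamma>(a; b\<^sub>1, \<dots>, b\<^sub>k)\<close>.  The arity \<open>k = 0\<close> is allowed; since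
  \<open>\<C>(0)\<close> is a point, \<open>\<gamma>(*; )\<close> can only be \<open>*\<close>.  This value is needed to read the
  associativity law when some \<open>m\<^sub>i\<close> is \<open>0\<close>.
\<close>

record 'a operad_data =
  ospace :: "nat \<Rightarrow> 'a topology"
  ocomp :: "nat list \<Rightarrow> 'a \<Rightarrow> 'a list \<Rightarrow> 'a"
  ounit :: 'a

definition oelem :: "'a operad_data \<Rightarrow> nat \<Rightarrow> 'a \<Rightarrow> bool" where
  "oelem \<C> n x \<longleftrightarrow> x \<in> topspace (ospace \<C> n)"

text \<open>
  In the associativity law the element \<open>c\<close> number \<open>j\<close> of the \<open>i\<close>-th block is \<open>css ! i ! j\<close>,
  its arity is \<open>nss ! i ! j\<close>, and the arity of \<open>bs ! i\<close> is \<open>length (nss ! i)\<close>.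
\<close>

definition topological_operad :: "'a operad_data \<Rightarrow> bool" where
  "topological_operad \<C> \<longleftrightarrow>
     (\<forall>n. Hausdorff_space (ospace \<C> n) \<and> k_space (ospace \<C> n)) \<and>
     (\<exists>x. topspace (ospace \<C> 0) = {x}) \<and>
     (\<forall>ms. continuous_map
        (kification (prod_topology (ospace \<C> (length ms))
           (product_topology (\<lambda>i. ospace \<C> (ms ! i)) {..<length ms})))
        (ospace \<C> (sum_list ms))
        (\<lambda>(a, x). ocomp \<C> ms a (map x [0..<length ms]))) \<and>
     oelem \<C> 1 (ounit \<C>) \<and>
     (\<forall>nss a bs css.
        oelem \<C> (length nss) a \<and>
        list_all2 (\<lambda>ns b. oelem \<C> (length ns) b) nss bs \<and>
        list_all2 (list_all2 (oelem \<C>)) nss css \<longrightarrow>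
        ocomp \<C> (concat nss) (ocomp \<C> (map length nss) a bs) (concat css) =
        ocomp \<C> (map sum_list nss) a
          (map (\<lambda>i. ocomp \<C> (nss ! i) (bs ! i) (css ! i)) [0..<length nss])) \<and>
     (\<forall>n a. oelem \<C> n a \<longrightarrow> ocomp \<C> [n] (ounit \<C>) [a] = a) \<and>
     (\<forall>n a. oelem \<C> n a \<longrightarrow> ocomp \<C> (replicate n 1) a (replicate n (ounit \<C>)) = a)"

definition path_connected_operad :: "'a operad_data \<Rightarrow> bool" where
  "path_connected_operad \<C> \<longleftrightarrow> (\<forall>k. path_connected_space (ospace \<C> k))"

definition operad_morphism ::
    "'a operad_data \<Rightarrow> 'b operad_data \<Rightarrow> (nat \<Rightarrow> 'a \<Rightarrow> 'b) \<Rightarrow> bool" where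
  "operad_morphism \<C> \<D> F \<longleftrightarrow>
     (\<forall>n. continuous_map (ospace \<C> n) (ospace \<D> n) (F n)) \<and>
     F 1 (ounit \<C>) = ounit \<D> \<and>
     (\<forall>ms a bs. oelem \<C> (length ms) a \<and> list_all2 (oelem \<C>) ms bs \<longrightarrow>
        F (sum_list ms) (ocomp \<C> ms a bs) = ocomp \<D> ms (F (length ms) a) (map2 F ms bs))"


section \<open>Little intervals and good basepoints\<close>

text \<open>
  An increasing affine embedding of the unit interval into itself is represented by its
  affine extension to the real line.
\<close>

definition affine_embedding :: "(real \<Rightarrow> real) \<Rightarrow> bool" where
  "affine_embedding f \<longleftrightarrow> (\<exists>a b. b > 0 \<and> f = (\<lambda>x. a + b * x)) \<and> f ` {0..1} \<subseteq> {0..1}"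

definition little_intervals_set :: "nat \<Rightarrow> (real \<Rightarrow> real) list set" where
  "little_intervals_set k = {c. length c = k \<and> (\<forall>f\<in>set c. affine_embedding f) \<and>
     (\<forall>i<k. \<forall>j<k. i \<noteq> j \<longrightarrow>
        interior ((c ! i) ` {0..1}) \<inter> interior ((c ! j) ` {0..1}) = {})}"

text \<open>
  The topology on tuples of affine maps is the one given by the end points of the
  intervals (which agrees with the compact-open topology).
\<close>

definition little_intervals_space :: "nat \<Rightarrow> (real \<Rightarrow> real) list topology" where
  "little_intervals_space k =
     pullback_topology (little_intervals_set k)
       (\<lambda>c. \<lambda>i\<in>{..<k}. ((c ! i) 0, (c ! i) 1))
       (product_topology (\<lambda>_. euclidean :: (real \<times> real) topology) {..<k})"

definition little_intervals_comp ::
    "(real \<Rightarrow> real) list \<Rightarrow> (real \<Rightarrow> real) list list \<Rightarrow> (real \<Rightarrow> real) list" where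
  "little_intervals_comp c ds = concat (map2 (\<lambda>f d. map (\<lambda>g. f \<circ> g) d) c ds)"

definition std_config :: "nat \<Rightarrow> (real \<Rightarrow> real) list" where
  "std_config k = map (\<lambda>i x. (real i + x) / real k) [0..<k]"

definition little_intervals0 :: "(real \<Rightarrow> real) list operad_data" where
  "little_intervals0 =
     \<lparr>ospace = (\<lambda>k. subtopology (little_intervals_space k)
        (path_component_of_set (little_intervals_space k) (std_config k))),
      ocomp = (\<lambda>_. little_intervals_comp),
      ounit = [id]\<rparr>"

text \<open>The good basepoint itself is the family \<open>basept \<eta> k\<close>.\<close>

definition good_basepoint :: "'a operad_data \<Rightarrow> (nat \<Rightarrow> (real \<Rightarrow> real) list \<Rightarrow> 'a) \<Rightarrow> bool" where
  "good_basepoint \<C> \<eta> \<longleftrightarrow> operad_morphism little_intervals0 \<C> \<eta>"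

definition basept :: "(nat \<Rightarrow> (real \<Rightarrow> real) list \<Rightarrow> 'a) \<Rightarrow> nat \<Rightarrow> 'a" where
  "basept \<eta> k = \<eta> k (std_config k)"

definition linear_path ::
    "(nat \<Rightarrow> (real \<Rightarrow> real) list \<Rightarrow> 'a) \<Rightarrow> nat \<Rightarrow>
     (real \<Rightarrow> real) list \<Rightarrow> (real \<Rightarrow> real) list \<Rightarrow> real \<Rightarrow> 'a" where
  "linear_path \<eta> k u v = (\<lambda>t. \<eta> k (map2 (\<lambda>f g x. (1 - t) * f x + t * g x) u v))"

text \<open>The path \<open>\<delta>\<close> from \<open>e\<^sub>m\<close> to \<open>\<gamma>(e\<^sub>k; e\<^bsub>m\<^sub>1\<^esub>, \<dots>, e\<^bsub>m\<^sub>k\<^esub>)\<close>.\<close>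

definition delta_path ::
    "(nat \<Rightarrow> (real \<Rightarrow> real) list \<Rightarrow> 'a) \<Rightarrow> nat list \<Rightarrow> real \<Rightarrow> 'a" where
  "delta_path \<eta> ms = linear_path \<eta> (sum_list ms) (std_config (sum_list ms))
     (little_intervals_comp (std_config (length ms)) (map std_config ms))"


section \<open>Group operads and operads with group operad actions\<close>

text \<open>
  Permutations act on \<open>{..<n}\<close> and are multiplied from left to right,
  \<open>(p q)(i) = q (p i)\<close>.  With the operad composition below this is the convention for which
  the symmetric groups satisfy the compatibility law
  \<open>\<gamma>(a a'; b\<^sub>i b'\<^sub>i) = \<gamma>(a; b\<^sub>i) \<gamma>(a'; b'\<^bsub>a\<^sup>-\<^sup>1(i)\<^esub>)\<close> of group operads.
\<close>

definition perm_group :: "nat \<Rightarrow> (nat \<Rightarrow> nat) monoid" where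
  "perm_group n = \<lparr>carrier = {p. p permutes {..<n}}, mult = (\<lambda>p q. q \<circ> p), one = id\<rparr>"

text \<open>The element \<open>j\<close> of the block \<open>i\<close> becomes the element \<open>bs ! i j\<close> of the block moved to place \<open>a i\<close>.\<close>

definition perm_comp :: "nat list \<Rightarrow> (nat \<Rightarrow> nat) \<Rightarrow> (nat \<Rightarrow> nat) list \<Rightarrow> nat \<Rightarrow> nat" where
  "perm_comp ms a bs x =
     (if x < sum_list ms then
        let i = (LEAST i. x < sum_list (take (Suc i) ms));
            j = x - sum_list (take i ms)
        in (\<Sum>i' | i' < length ms \<and> a i' < a i. ms ! i') + (bs ! i) j
      else x)"

definition symmetric_operad :: "(nat \<Rightarrow> nat) operad_data" where
  "symmetric_operad =
     \<lparr>ospace = (\<lambda>n. discrete_topology (carrier (perm_group n))),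
      ocomp = perm_comp, ounit = id\<rparr>"

record 'g group_operad_data =
  ggroup :: "nat \<Rightarrow> 'g monoid"
  gcomp :: "nat list \<Rightarrow> 'g \<Rightarrow> 'g list \<Rightarrow> 'g"
  gperm :: "nat \<Rightarrow> 'g \<Rightarrow> nat \<Rightarrow> nat"

definition group_operad_operad :: "'g group_operad_data \<Rightarrow> 'g operad_data" where
  "group_operad_operad \<G> =
     \<lparr>ospace = (\<lambda>n. discrete_topology (carrier (ggroup \<G> n))),
      ocomp = gcomp \<G>, ounit = \<one>\<^bsub>ggroup \<G> 1\<^esub>\<rparr>"

text \<open>
  If \<open>p = gperm \<G> k a\<close>, then \<open>permute_list (inv p) bs\<close> is the list of all \<open>b\<^bsub>a\<^sup>-\<^sup>1(i)\<^esub>\<close>.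
\<close>

definition group_operad :: "'g group_operad_data \<Rightarrow> bool" where
  "group_operad \<G> \<longleftrightarrow>
     (\<forall>n. group (ggroup \<G> n)) \<and>
     topological_operad (group_operad_operad \<G>) \<and>
     (\<forall>n. gperm \<G> n \<in> hom (ggroup \<G> n) (perm_group n)) \<and>
     operad_morphism (group_operad_operad \<G>) symmetric_operad (gperm \<G>) \<and>
     (\<forall>ms a a' bs bs'.
        a \<in> carrier (ggroup \<G> (length ms)) \<and> a' \<in> carrier (ggroup \<G> (length ms)) \<and>
        list_all2 (\<lambda>m b. b \<in> carrier (ggroup \<G> m)) ms bs \<and>
        list_all2 (\<lambda>m b. b \<in> carrier (ggroup \<G> m)) ms bs' \<longrightarrow>
        (let p = Hilbert_Choice.inv (gperm \<G> (length ms) a) in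
         gcomp \<G> ms (a \<otimes>\<^bsub>ggroup \<G> (length ms)\<^esub> a')
           (map (\<lambda>i. bs ! i \<otimes>\<^bsub>ggroup \<G> (ms ! i)\<^esub> bs' ! i) [0..<length ms]) =
         gcomp \<G> ms a bs \<otimes>\<^bsub>ggroup \<G> (sum_list ms)\<^esub>
           gcomp \<G> (permute_list p ms) a' (permute_list p bs')))"

definition G_operad ::
    "'g group_operad_data \<Rightarrow> 'd operad_data \<Rightarrow> (nat \<Rightarrow> 'g \<Rightarrow> 'd \<Rightarrow> 'd) \<Rightarrow> bool" where
  "G_operad \<G> \<D> act \<longleftrightarrow>
     group_operad \<G> \<and> topological_operad \<D> \<and>
     (\<forall>n. group_action (ggroup \<G> n) (topspace (ospace \<D> n)) (act n)) \<and>
     (\<forall>n. \<forall>\<sigma>\<in>carrier (ggroup \<G> n). continuous_map (ospace \<D> n) (ospace \<D> n) (act n \<sigma>)) \<and>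
     (\<forall>ms \<sigma> \<tau>s a bs.
        \<sigma> \<in> carrier (ggroup \<G> (length ms)) \<and>
        list_all2 (\<lambda>m \<tau>. \<tau> \<in> carrier (ggroup \<G> m)) ms \<tau>s \<and>
        oelem \<D> (length ms) a \<and> list_all2 (oelem \<D>) ms bs \<longrightarrow>
        (let p = Hilbert_Choice.inv (gperm \<G> (length ms) \<sigma>) in
         ocomp \<D> ms (act (length ms) \<sigma> a)
           (map (\<lambda>i. act (ms ! i) (\<tau>s ! i) (bs ! i)) [0..<length ms]) =
         act (sum_list ms) (gcomp \<G> ms \<sigma> \<tau>s)
           (ocomp \<D> (permute_list p ms) a (permute_list p bs))))"


section \<open>Homotopy groups\<close>

definition sphere_pt :: "nat \<Rightarrow> real" where
  "sphere_pt = (\<lambda>i. if i = 0 then 1 else 0)"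

definition based_maps :: "nat \<Rightarrow> 'a topology \<Rightarrow> 'a \<Rightarrow> ((nat \<Rightarrow> real) \<Rightarrow> 'a) set" where
  "based_maps l X x = {f. continuous_map (nsphere l) X f \<and> f sphere_pt = x}"

definition htpy_class ::
    "nat \<Rightarrow> 'a topology \<Rightarrow> 'a \<Rightarrow> ((nat \<Rightarrow> real) \<Rightarrow> 'a) \<Rightarrow> ((nat \<Rightarrow> real) \<Rightarrow> 'a) set" where
  "htpy_class l X x f = {g. homotopic_with (\<lambda>h. h sphere_pt = x) (nsphere l) X f g}"

definition homotopy_set :: "nat \<Rightarrow> 'a topology \<Rightarrow> 'a \<Rightarrow> ((nat \<Rightarrow> real) \<Rightarrow> 'a) set set" where
  "homotopy_set l X x = htpy_class l X x ` based_maps l X x"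

text \<open>
  Change of basepoint: for a path \<open>\<delta>\<close> from \<open>x\<close> to \<open>y\<close> and \<open>[f] \<in> \<pi>\<^sub>l(X, y)\<close>, the class
  \<open>\<delta>\<^sub>*[f] \<in> \<pi>\<^sub>l(X, x)\<close> is the class \<open>[g]\<close> of any map \<open>g\<close> from which there is a free
  homotopy to \<open>f\<close> that moves the basepoint along \<open>\<delta>\<close>.
\<close>

definition change_basepoint ::
    "nat \<Rightarrow> 'a topology \<Rightarrow> (real \<Rightarrow> 'a) \<Rightarrow>
     ((nat \<Rightarrow> real) \<Rightarrow> 'a) set \<Rightarrow> ((nat \<Rightarrow> real) \<Rightarrow> 'a) set" where
  "change_basepoint l X \<delta> \<alpha> =
     {g'. \<exists>f\<in>\<alpha>. \<exists>g H.
        continuous_map (prod_topology (top_of_set {0..1}) (nsphere l)) X H \<and>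
        (\<forall>z. H (0, z) = g z) \<and> (\<forall>z. H (1, z) = f z) \<and>
        (\<forall>t\<in>{0..1}. H (t, sphere_pt) = \<delta> t) \<and>
        g' \<in> htpy_class l X (\<delta> 0) g}"

text \<open>
  Elements of the fundamental group are represented by maps on the circle \<open>nsphere 1\<close>;
  they are multiplied by composing with the parametrisation \<open>circ\<close> and concatenating loops.
  The operations \<open>+++\<close> and \<open>reversepath\<close> of the library are tied to a type class topology,
  hence the variants for paths in an arbitrary space.
\<close>

definition circ :: "real \<Rightarrow> nat \<Rightarrow> real" where
  "circ t = (\<lambda>i. if i = 0 then cos (2 * pi * t) else if i = 1 then sin (2 * pi * t) else 0)"

definition join_path :: "(real \<Rightarrow> 'a) \<Rightarrow> (real \<Rightarrow> 'a) \<Rightarrow> real \<Rightarrow> 'a" where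
  "join_path p q = (\<lambda>t. if t \<le> 1/2 then p (2 * t) else q (2 * t - 1))"

definition reverse_path :: "(real \<Rightarrow> 'a) \<Rightarrow> real \<Rightarrow> 'a" where
  "reverse_path p = (\<lambda>t. p (1 - t))"

definition path_homotopic :: "'a topology \<Rightarrow> (real \<Rightarrow> 'a) \<Rightarrow> (real \<Rightarrow> 'a) \<Rightarrow> bool" where
  "path_homotopic X p q \<longleftrightarrow>
     homotopic_with (\<lambda>r. r 0 = p 0 \<and> r 1 = p 1) (top_of_set {0..1}) X p q"

text \<open>The element of \<open>homotopy_set 1 X x\<close> given by a loop \<open>p\<close> at \<open>x\<close>.\<close>

definition loop_class :: "'a topology \<Rightarrow> 'a \<Rightarrow> (real \<Rightarrow> 'a) \<Rightarrow> ((nat \<Rightarrow> real) \<Rightarrow> 'a) set" where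
  "loop_class X x p = {h \<in> based_maps 1 X x. path_homotopic X (h \<circ> circ) p}"

definition pi1_group :: "'a topology \<Rightarrow> 'a \<Rightarrow> ((nat \<Rightarrow> real) \<Rightarrow> 'a) set monoid" where
  "pi1_group X x =
     \<lparr>carrier = homotopy_set 1 X x,
      mult = (\<lambda>\<alpha> \<beta>. \<Union>f\<in>\<alpha>. \<Union>g\<in>\<beta>. loop_class X x (join_path (f \<circ> circ) (g \<circ> circ))),
      one = htpy_class 1 X x (\<lambda>_. x)\<rparr>"

definition pi1_action ::
    "nat \<Rightarrow> 'a topology \<Rightarrow> 'a \<Rightarrow> ((nat \<Rightarrow> real) \<Rightarrow> 'a) set \<Rightarrow>
     ((nat \<Rightarrow> real) \<Rightarrow> 'a) set \<Rightarrow> ((nat \<Rightarrow> real) \<Rightarrow> 'a) set" where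
  "pi1_action l X x \<sigma> =
     (\<lambda>\<alpha>\<in>homotopy_set l X x. \<Union>s\<in>\<sigma>. change_basepoint l X (s \<circ> circ) \<alpha>)"


section \<open>Homotopy groups of an operad\<close>

text \<open>\<open>\<gamma>(f; g\<^sub>1, \<dots>, g\<^sub>k)(z) = \<gamma>(f(z); g\<^sub>1(z), \<dots>, g\<^sub>k(z))\<close>\<close>

definition pointwise_comp ::
    "'a operad_data \<Rightarrow> nat list \<Rightarrow> ('z \<Rightarrow> 'a) \<Rightarrow> ('z \<Rightarrow> 'a) list \<Rightarrow> 'z \<Rightarrow> 'a" where
  "pointwise_comp \<C> ms f gs = (\<lambda>z. ocomp \<C> ms (f z) (map (\<lambda>g. g z) gs))"

text \<open>
  The class \<open>\<delta>\<^sub>*[\<gamma>(f; g\<^sub>1, \<dots>, g\<^sub>k)]\<close>.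
\<close>

definition pi_rep_comp ::
    "nat \<Rightarrow> 'a operad_data \<Rightarrow> (nat \<Rightarrow> (real \<Rightarrow> real) list \<Rightarrow> 'a) \<Rightarrow> nat list \<Rightarrow>
     ((nat \<Rightarrow> real) \<Rightarrow> 'a) \<Rightarrow> ((nat \<Rightarrow> real) \<Rightarrow> 'a) list \<Rightarrow> ((nat \<Rightarrow> real) \<Rightarrow> 'a) set" where
  "pi_rep_comp l \<C> \<eta> ms f gs =
     change_basepoint l (ospace \<C> (sum_list ms)) (delta_path \<eta> ms)
       (htpy_class l (ospace \<C> (sum_list ms))
          (ocomp \<C> ms (basept \<eta> (length ms)) (map (basept \<eta>) ms))
          (pointwise_comp \<C> ms f gs))"

text \<open>
  Compositions of classes are unions over all representatives, the usual way to pass to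
  the quotient; the union is a single class once independence of representatives is known.
\<close>

definition pi_operad ::
    "nat \<Rightarrow> 'a operad_data \<Rightarrow> (nat \<Rightarrow> (real \<Rightarrow> real) list \<Rightarrow> 'a) \<Rightarrow>
     ((nat \<Rightarrow> real) \<Rightarrow> 'a) set operad_data" where
  "pi_operad l \<C> \<eta> =
     \<lparr>ospace = (\<lambda>k. discrete_topology (homotopy_set l (ospace \<C> k) (basept \<eta> k))),
      ocomp = (\<lambda>ms \<alpha> \<beta>s.
        \<Union>{pi_rep_comp l \<C> \<eta> ms f gs | f gs. f \<in> \<alpha> \<and> list_all2 (\<in>) gs \<beta>s}),
      ounit = htpy_class l (ospace \<C> 1) (ounit \<C>) (\<lambda>_. ounit \<C>)\<rparr>"

text \<open>
  The non-crossed group operad structure on the fundamental groups; its composition is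
  \<open>[\<delta>][\<gamma>(f; g\<^sub>1, \<dots>, g\<^sub>k)][\<delta>]\<^sup>-\<^sup>1\<close>.
\<close>

definition pi1_group_operad ::
    "'a operad_data \<Rightarrow> (nat \<Rightarrow> (real \<Rightarrow> real) list \<Rightarrow> 'a) \<Rightarrow>
     ((nat \<Rightarrow> real) \<Rightarrow> 'a) set group_operad_data" where
  "pi1_group_operad \<C> \<eta> =
     \<lparr>ggroup = (\<lambda>k. pi1_group (ospace \<C> k) (basept \<eta> k)),
      gcomp = (\<lambda>ms \<alpha> \<beta>s.
        \<Union>{loop_class (ospace \<C> (sum_list ms)) (basept \<eta> (sum_list ms))
             (join_path (delta_path \<eta> ms)
               (join_path (pointwise_comp \<C> ms f gs \<circ> circ) (reverse_path (delta_path \<eta> ms))))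
           | f gs. f \<in> \<alpha> \<and> list_all2 (\<in>) gs \<beta>s}),
      gperm = (\<lambda>_ _. id)\<rparr>"

definition pi_action ::
    "nat \<Rightarrow> 'a operad_data \<Rightarrow> (nat \<Rightarrow> (real \<Rightarrow> real) list \<Rightarrow> 'a) \<Rightarrow> nat \<Rightarrow>
     ((nat \<Rightarrow> real) \<Rightarrow> 'a) set \<Rightarrow> ((nat \<Rightarrow> real) \<Rightarrow> 'a) set \<Rightarrow> ((nat \<Rightarrow> real) \<Rightarrow> 'a) set" where
  "pi_action l \<C> \<eta> k = pi1_action l (ospace \<C> k) (basept \<eta> k)"

end

theory Submission
  imports Defs
begin

text \<open>
  Everything rests on one relation between maps \<open>g\<close>, \<open>f\<close> on the sphere (\<open>transport\<close>): there is a
  free homotopy from \<open>g\<close> to \<open>f\<close> that moves the basepoint along a given path, up to homotopy of that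
  path.  A map \<open>g\<close> exists for each \<open>f\<close> and each path that ends at the value of the basepoint
  under \<open>f\<close> (\<open>transport_exists\<close>), and its based homotopy class depends only on the class of \<open>f\<close>
  and of the path (\<open>transport_unique\<close>).  Hence the changes of basepoint in the composition and in
  the action are well defined, and to compare two classes that come from the same map \<open>f\<close> it is
  enough to compare two paths.

  Homotopies can be composed pointwise in the operad (\<open>transport_pointwise_comp\<close>): the
  compactly generated product causes no trouble as spheres and their cylinders are compact.
  Consequently each law for homotopy classes follows from the law at the points of the operad and a
  homotopy between two paths.

  For the operad laws the paths are images under \<open>\<eta>\<close> of paths of little intervals that stay in the
  configurations listed from left to right.  These form a convex set in the component of the
  standard configuration, so any two such paths with the same ends are homotopic
  (\<open>path_homotopic_ordered_config_space\<close>).  This gives associativity (\<open>pi_comp_assoc\<close>), and in the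
  unit laws the path is constant.

  For maps on the circle, transport along a path is conjugation of loops by that path
  (\<open>transport_circ\<close>).  So the composition of fundamental groups, defined by conjugation with
  \<open>\<delta>\<close>, is the composition of homotopy classes for \<open>l = 1\<close> and inherits the operad laws, and the
  action on the first homotopy group is conjugation.  The group law is compatible with the composition
  since loops are concatenated at each time separately and \<open>\<delta>\<inverse> \<delta>\<close> cancels
  (\<open>pi1_comp_interchange\<close>).  The action is equivariant since the composite of free homotopies along
  loops \<open>s\<close>, \<open>t\<^sub>i\<close> is a free homotopy along their pointwise composite, and transport to the standard
  basepoint conjugates this loop by \<open>\<delta>\<close> (\<open>pi_action_equivariant\<close>).
\<close>

section \<open>Paths in an abstract topological space\<close>

abbreviation unit_int :: "real topology" where
  "unit_int \<equiv> top_of_set {0..1}"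

lemma continuous_map_glue_time:
  assumes H: "continuous_map (prod_topology unit_int Z) X H"
    and K: "continuous_map (prod_topology unit_int Z) X K"
    and eq: "\<And>z. z \<in> topspace Z \<Longrightarrow> H (1, z) = K (0, z)"
  shows "continuous_map (prod_topology unit_int Z) X
           (\<lambda>(t, z). if t \<le> 1/2 then H (2 * t, z) else K (2 * t - 1, z))"
proof -
  let ?P = "prod_topology unit_int Z"
  have 1: "continuous_map (subtopology ?P {x \<in> topspace ?P. fst x \<le> 1/2}) X (H \<circ> (\<lambda>x. (2 * fst x, snd x)))"
    by (rule continuous_map_compose[OF _ H])
      (auto simp: continuous_map_paired continuous_map_in_subtopology
        intro!: continuous_intros continuous_map_from_subtopology continuous_map_fst_of continuous_map_into_fulltopology[OF continuous_map_fst])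
  have 2: "continuous_map (subtopology ?P {x \<in> topspace ?P. 1/2 \<le> fst x}) X (K \<circ> (\<lambda>x. (2 * fst x - 1, snd x)))"
    by (rule continuous_map_compose[OF _ K])
      (auto simp: continuous_map_paired continuous_map_in_subtopology
        intro!: continuous_intros continuous_map_from_subtopology continuous_map_into_fulltopology[OF continuous_map_fst])
  have "continuous_map ?P X (\<lambda>x. if fst x \<le> 1/2 then (H \<circ> (\<lambda>x. (2 * fst x, snd x))) x else (K \<circ> (\<lambda>x. (2 * fst x - 1, snd x))) x)"
  proof (rule continuous_map_cases_le[OF _ _ 1 2])
    fix x assume x: "x \<in> topspace ?P" "fst x = 1/2"
    then show "(H \<circ> (\<lambda>x. (2 * fst x, snd x))) x = (K \<circ> (\<lambda>x. (2 * fst x - 1, snd x))) x"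
      using eq[of "snd x"] unfolding o_def x(2) by auto
  qed (auto intro!: continuous_map_into_fulltopology[OF continuous_map_fst])
  then show ?thesis
    by (simp only: case_prod_unfold o_def)
qed

lemma pathin_join_path:
  assumes p: "pathin X p" and q: "pathin X q" and eq: "p 1 = q 0"
  shows "pathin X (join_path p q)"
proof -
  let ?Z = "discrete_topology {()}"
  have "continuous_map (prod_topology unit_int ?Z) X
           (\<lambda>(t, z). if t \<le> 1/2 then (p \<circ> fst) (2 * t, z) else (q \<circ> fst) (2 * t - 1, z))"
    by (rule continuous_map_glue_time)
      (use p q eq in \<open>auto simp: pathin_def continuous_map_of_fst[unfolded o_def]\<close>)

  then have "continuous_map unit_int X
      ((\<lambda>(t, z). if t \<le> 1/2 then (p \<circ> fst) (2 * t, z) else (q \<circ> fst) (2 * t - 1, z)) \<circ> (\<lambda>t. (t, ())))"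
    by (rule continuous_map_compose[rotated]) (auto intro!: continuous_intros)
  then show ?thesis
    by (simp only: pathin_def join_path_def o_def case_prod_beta fst_conv)
qed

lemma pathin_reparam:
  assumes "pathin X p" "continuous_on {0..1} \<phi>" "\<phi> \<in> {0..1} \<rightarrow> {0..1}"
  shows "pathin X (p \<circ> \<phi>)"
  using assms unfolding pathin_def
  by (intro continuous_map_compose[where X' = unit_int])
    (auto simp: continuous_map_in_subtopology)

lemma pathin_reverse_path: "pathin X p \<Longrightarrow> pathin X (reverse_path p)"
  using pathin_reparam[of X p "\<lambda>t. 1 - t", OF _ continuous_on_diff[OF continuous_on_const continuous_on_id]]
  by (auto simp: reverse_path_def o_def)

lemma join_path_ends [simp]: "join_path p q 0 = p 0" "join_path p q 1 = q 1"
  by (simp_all add: join_path_def)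

lemma reverse_path_ends [simp]: "reverse_path p 0 = p 1" "reverse_path p 1 = p 0"
  by (simp_all add: reverse_path_def)

lemma path_homotopicI:
  assumes "continuous_map (prod_topology unit_int unit_int) X H"
    and "\<And>s. s \<in> {0..1} \<Longrightarrow> H (0, s) = p s" "\<And>s. s \<in> {0..1} \<Longrightarrow> H (1, s) = q s"
    and "\<And>t. t \<in> {0..1} \<Longrightarrow> H (t, 0) = p 0" "\<And>t. t \<in> {0..1} \<Longrightarrow> H (t, 1) = p 1"
  shows "path_homotopic X p q"
  unfolding path_homotopic_def
  by (subst homotopic_with) (use assms in \<open>auto intro!: exI[of _ H]\<close>)

lemma path_homotopicE:
  assumes "path_homotopic X p q"
  obtains H where "continuous_map (prod_topology unit_int unit_int) X H"
    "\<And>s. H (0, s) = p s" "\<And>s. H (1, s) = q s"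
    "\<And>t. t \<in> {0..1} \<Longrightarrow> H (t, 0) = p 0" "\<And>t. t \<in> {0..1} \<Longrightarrow> H (t, 1) = p 1"
  using assms unfolding path_homotopic_def homotopic_with_def by auto

lemma path_homotopic_imp:
  assumes "path_homotopic X p q"
  shows "pathin X p" "pathin X q" "p 0 = q 0" "p 1 = q 1"
  using homotopic_with_imp_continuous_maps[OF assms[unfolded path_homotopic_def]]
    homotopic_with_imp_property[OF assms[unfolded path_homotopic_def]]
  by (auto simp: pathin_def)

lemma path_homotopic_refl: "pathin X p \<Longrightarrow> path_homotopic X p p"
  by (simp add: path_homotopic_def pathin_def)

lemma path_homotopic_eq:
  assumes "pathin X p" "\<And>t. t \<in> {0..1} \<Longrightarrow> p t = q t"
  shows "path_homotopic X p q"
  using assms unfolding path_homotopic_def pathin_def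
  by (intro homotopic_with_equal) auto

lemma path_homotopic_sym:
  assumes "path_homotopic X p q"
  shows "path_homotopic X q p"
  using homotopic_with_symD[OF assms[unfolded path_homotopic_def]] path_homotopic_imp(3,4)[OF assms]
  by (simp add: path_homotopic_def)

lemma path_homotopic_trans [trans]:
  assumes "path_homotopic X p q" "path_homotopic X q r"
  shows "path_homotopic X p r"
  using homotopic_with_trans[of _ _ X p q r] assms path_homotopic_imp(3,4)[OF assms(1)]
  by (simp add: path_homotopic_def)

lemma path_homotopic_cong_left:
  assumes "path_homotopic X p r" "\<And>t. t \<in> {0..1} \<Longrightarrow> p t = q t"
  shows "path_homotopic X q r"
  using path_homotopic_trans[OF path_homotopic_sym[OF path_homotopic_eq[of X p q]] assms(1)]
    path_homotopic_imp(1)[OF assms(1)] assms(2) by blast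

lemma path_homotopic_image:
  assumes "path_homotopic X p q" "continuous_map X Y f"
  shows "path_homotopic Y (\<lambda>t. f (p t)) (\<lambda>t. f (q t))"
  using homotopic_with_compose_continuous_map_left[OF assms(1)[unfolded path_homotopic_def] assms(2),
      where q = "\<lambda>r. r 0 = f (p 0) \<and> r 1 = f (p 1)"]
  by (simp add: path_homotopic_def o_def)

lemma path_homotopic_join:
  assumes p: "path_homotopic X p p'" and q: "path_homotopic X q q'" and eq: "p 1 = q 0"
  shows "path_homotopic X (join_path p q) (join_path p' q')"
proof -
  obtain H where H: "continuous_map (prod_topology unit_int unit_int) X H"
    "\<And>s. H (0, s) = p s" "\<And>s. H (1, s) = p' s"
    "\<And>t. t \<in> {0..1} \<Longrightarrow> H (t, 0) = p 0" "\<And>t. t \<in> {0..1} \<Longrightarrow> H (t, 1) = p 1"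
    using p by (rule path_homotopicE) blast
  obtain K where K: "continuous_map (prod_topology unit_int unit_int) X K"
    "\<And>s. K (0, s) = q s" "\<And>s. K (1, s) = q' s"
    "\<And>t. t \<in> {0..1} \<Longrightarrow> K (t, 0) = q 0" "\<And>t. t \<in> {0..1} \<Longrightarrow> K (t, 1) = q 1"
    using q by (rule path_homotopicE) blast
  have sw: "continuous_map (prod_topology unit_int unit_int) X (F \<circ> (\<lambda>x. (snd x, fst x)))"
    if "continuous_map (prod_topology unit_int unit_int) X F" for F
    by (rule continuous_map_compose[OF _ that]) (auto intro!: continuous_intros continuous_map_fst continuous_map_snd)
  have 1: "continuous_map (prod_topology unit_int unit_int) X
      (\<lambda>(s, t). if s \<le> 1/2 then (H \<circ> (\<lambda>x. (snd x, fst x))) (2 * s, t) else (K \<circ> (\<lambda>x. (snd x, fst x))) (2 * s - 1, t))"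
    by (rule continuous_map_glue_time) (use sw[OF H(1)] sw[OF K(1)] H K eq in \<open>auto simp: o_def\<close>)
  show ?thesis
    by (rule path_homotopicI[OF sw[OF 1]]) (auto simp: join_path_def H K eq)
qed

text \<open>
  Every elementary homotopy between reparametrised or concatenated paths is of this kind:
  both paths are traced in a convex domain, where the straight-line homotopy is available.
\<close>

lemma path_homotopic_convex_domain:
  fixes D :: "'b::real_normed_vector set"
  assumes D: "convex D" and F: "continuous_map (top_of_set D) X F"
    and \<phi>: "continuous_on {0..1} \<phi>" "\<phi> \<in> {0..1} \<rightarrow> D"
    and \<psi>: "continuous_on {0..1} \<psi>" "\<psi> \<in> {0..1} \<rightarrow> D"
    and ends: "\<phi> 0 = \<psi> 0" "\<phi> 1 = \<psi> 1"
  shows "path_homotopic X (\<lambda>t. F (\<phi> t)) (\<lambda>t. F (\<psi> t))"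
proof -
  have I: "prod_topology unit_int unit_int = top_of_set ({0..1} \<times> {0..1})"
    by simp
  have "continuous_map (prod_topology unit_int unit_int) (top_of_set D)
      (\<lambda>x. (1 - fst x) *\<^sub>R \<phi> (snd x) + fst x *\<^sub>R \<psi> (snd x))"
    unfolding I using \<phi> \<psi> D
    by (auto simp: continuous_map_in_subtopology convex_alt Pi_iff
        intro!: continuous_intros continuous_on_compose2[OF \<phi>(1)] continuous_on_compose2[OF \<psi>(1)])
  then have "continuous_map (prod_topology unit_int unit_int) X
      (F \<circ> (\<lambda>x. (1 - fst x) *\<^sub>R \<phi> (snd x) + fst x *\<^sub>R \<psi> (snd x)))"
    using F by (rule continuous_map_compose)
  then show ?thesis
    by (rule path_homotopicI) (auto simp: ends algebra_simps simp flip: scaleR_left.add scaleR_add_left)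
qed

lemma path_homotopic_reparam:
  assumes "pathin X p"
    and "continuous_on {0..1} \<phi>" "\<phi> \<in> {0..1} \<rightarrow> {0..1}"
    and "continuous_on {0..1} \<psi>" "\<psi> \<in> {0..1} \<rightarrow> {0..1}"
    and "\<phi> 0 = \<psi> 0" "\<phi> 1 = \<psi> 1"
  shows "path_homotopic X (\<lambda>t. p (\<phi> t)) (\<lambda>t. p (\<psi> t))"
  by (rule path_homotopic_convex_domain[of "{0..1}"]) (use assms in \<open>auto simp: pathin_def\<close>)

lemma path_homotopic_assoc:
  assumes "pathin X p" "pathin X q" "pathin X r" "p 1 = q 0" "q 1 = r 0"
  shows "path_homotopic X (join_path (join_path p q) r) (join_path p (join_path q r))"
proof -
  \<comment> \<open>The change of parameter has the slopes 2, 1, 1/2; it is concave, hence a minimum of linear functions.\<close>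
  have cont: "continuous_on {0..1} (\<lambda>t::real. min (2 * t) (min (t + 1/4) ((t + 1) / 2)))"
    by (intro continuous_intros) auto
  have "path_homotopic X (\<lambda>t. join_path p (join_path q r) (min (2 * t) (min (t + 1/4) ((t + 1) / 2))))
          (\<lambda>t. join_path p (join_path q r) t)"
    by (rule path_homotopic_reparam[OF _ cont])
      (use assms in \<open>auto intro!: pathin_join_path continuous_intros simp: min_def\<close>)
  then show ?thesis
    by (rule path_homotopic_cong_left)
      (use assms in \<open>auto simp: join_path_def min_def
        intro!: arg_cong[where f = p] arg_cong[where f = q] arg_cong[where f = r]\<close>)
qed

lemma path_homotopic_const_left:
  assumes "pathin X p" "x = p 0"
  shows "path_homotopic X (join_path (\<lambda>_. x) p) p"
proof -
  have cont: "continuous_on {0..1} (\<lambda>t::real. max 0 (2 * t - 1))"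
    by (intro continuous_intros)
  have "path_homotopic X (\<lambda>t. p (max 0 (2 * t - 1))) (\<lambda>t. p t)"
    by (rule path_homotopic_reparam[OF _ cont]) (use assms in \<open>auto simp: max_def\<close>)
  then show ?thesis
    by (rule path_homotopic_cong_left) (use assms in \<open>auto simp: join_path_def max_def intro!: arg_cong[where f = p]\<close>)
qed

lemma path_homotopic_const_right:
  assumes "pathin X p" "x = p 1"
  shows "path_homotopic X (join_path p (\<lambda>_. x)) p"
proof -
  have cont: "continuous_on {0..1} (\<lambda>t::real. min 1 (2 * t))"
    by (intro continuous_intros)
  have "path_homotopic X (\<lambda>t. p (min 1 (2 * t))) (\<lambda>t. p t)"
    by (rule path_homotopic_reparam[OF _ cont]) (use assms in \<open>auto simp: min_def\<close>)
  then show ?thesis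
    by (rule path_homotopic_cong_left) (use assms in \<open>auto simp: join_path_def min_def intro!: arg_cong[where f = p]\<close>)
qed

lemma path_homotopic_inverse_right:
  assumes "pathin X p" "x = p 0"
  shows "path_homotopic X (join_path p (reverse_path p)) (\<lambda>_. x)"
proof -
  have cont: "continuous_on {0..1} (\<lambda>t::real. min (2 * t) (2 - 2 * t))"
    by (intro continuous_intros)
  have "path_homotopic X (\<lambda>t. p (min (2 * t) (2 - 2 * t))) (\<lambda>t. p ((\<lambda>_. 0) t))"
    by (rule path_homotopic_reparam[OF _ cont]) (use assms in \<open>auto simp: min_def\<close>)
  then have "path_homotopic X (join_path p (reverse_path p)) (\<lambda>t. p ((\<lambda>_. 0) t))"
    by (rule path_homotopic_cong_left)
      (auto simp: join_path_def reverse_path_def min_def algebra_simps)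
  then show ?thesis
    using assms by simp
qed

lemma reverse_reverse_path [simp]: "reverse_path (reverse_path p) = p"
  by (simp add: reverse_path_def)

lemma path_homotopic_inverse_left:
  assumes "pathin X p" "x = p 1"
  shows "path_homotopic X (join_path (reverse_path p) p) (\<lambda>_. x)"
  using path_homotopic_inverse_right[of X "reverse_path p"] assms by (simp add: pathin_reverse_path)

lemma path_homotopic_reverse:
  assumes "path_homotopic X p q"
  shows "path_homotopic X (reverse_path p) (reverse_path q)"
proof -
  have "continuous_map unit_int unit_int (\<lambda>t. 1 - t)"
    by (auto simp: continuous_map_in_subtopology intro!: continuous_intros)
  from homotopic_with_compose_continuous_map_right[OF assms[unfolded path_homotopic_def] this,
      where q = "\<lambda>r. r 0 = p 1 \<and> r 1 = p 0"]
  show ?thesis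
    by (auto simp: path_homotopic_def reverse_path_def o_def)
qed

lemma path_homotopic_cancel_left:
  assumes "pathin X p" "pathin X q" "p 1 = q 0"
  shows "path_homotopic X (join_path (reverse_path p) (join_path p q)) q"
proof -
  have "path_homotopic X (join_path (reverse_path p) (join_path p q))
          (join_path (join_path (reverse_path p) p) q)"
    by (rule path_homotopic_sym, rule path_homotopic_assoc)
      (use assms in \<open>auto intro: pathin_reverse_path\<close>)
  also have "path_homotopic X \<dots> (join_path (\<lambda>_. p 1) q)"
    by (rule path_homotopic_join)
      (use assms in \<open>auto intro: path_homotopic_inverse_left path_homotopic_refl\<close>)
  also have "path_homotopic X \<dots> q"
    by (rule path_homotopic_const_left) (use assms in auto)
  finally show ?thesis .
qed

text \<open>
  Conjugation by a path is multiplicative, as \<open>d\<inverse> d\<close> cancels in the middle of the product.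
  This is the homotopy behind the interchange law for fundamental groups.
\<close>

lemma path_homotopic_conjugate_join:
  assumes d: "pathin X d" and a: "pathin X a" "a 0 = d 1" "a 1 = d 1"
    and b: "pathin X b" "b 0 = d 1" "b 1 = d 1"
  shows "path_homotopic X
    (join_path (join_path d (join_path a (reverse_path d))) (join_path d (join_path b (reverse_path d))))
    (join_path d (join_path (join_path a b) (reverse_path d)))"
proof -
  let ?r = "reverse_path d"
  have r: "pathin X ?r"
    using d by (rule pathin_reverse_path)
  have br: "pathin X (join_path b ?r)" and ar: "pathin X (join_path a ?r)"
    using a b r by (auto intro: pathin_join_path)
  have dbr: "pathin X (join_path d (join_path b ?r))"
    using d b br by (auto intro: pathin_join_path)
  have "path_homotopic X (join_path (join_path d (join_path a ?r)) (join_path d (join_path b ?r)))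
      (join_path d (join_path (join_path a ?r) (join_path d (join_path b ?r))))"
    by (rule path_homotopic_assoc) (use d ar dbr a in auto)
  also have "path_homotopic X \<dots> (join_path d (join_path (join_path a b) ?r))"
  proof (rule path_homotopic_join[OF path_homotopic_refl[OF d]])
    have "path_homotopic X (join_path (join_path a ?r) (join_path d (join_path b ?r)))
        (join_path a (join_path ?r (join_path d (join_path b ?r))))"
      by (rule path_homotopic_assoc) (use a r dbr in auto)
    also have "path_homotopic X \<dots> (join_path a (join_path b ?r))"
      by (rule path_homotopic_join[OF path_homotopic_refl[OF a(1)] path_homotopic_cancel_left])
        (use a b d br in auto)
    also have "path_homotopic X \<dots> (join_path (join_path a b) ?r)"
      by (rule path_homotopic_sym, rule path_homotopic_assoc) (use a b r in auto)
    finally show "path_homotopic X (join_path (join_path a ?r) (join_path d (join_path b ?r)))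
        (join_path (join_path a b) ?r)" .
  qed (use a in auto)
  finally show ?thesis .
qed

section \<open>Spheres\<close>

lemma topspace_nsphere:
  "topspace (nsphere l) = {x. (\<Sum>i\<le>l. x i ^ 2) = 1 \<and> (\<forall>i>l. x i = 0)}"
  by (simp add: nsphere)

lemma sphere_pt_in_nsphere [simp]: "sphere_pt \<in> topspace (nsphere l)"
  using in_topspace_nsphere by (simp add: sphere_pt_def)

lemma continuous_map_into_nsphere:
  assumes "\<And>i. continuous_map Z euclideanreal (\<lambda>z. f z i)"
    and "\<And>z. z \<in> topspace Z \<Longrightarrow> f z \<in> topspace (nsphere l)"
  shows "continuous_map Z (nsphere l) f"
  using assms unfolding topspace_nsphere
  by (auto simp: nsphere continuous_map_in_subtopology continuous_map_componentwise_UNIV)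

lemma nsphere_first_coordinate_le_1:
  assumes "x \<in> topspace (nsphere l)"
  shows "x 0 \<le> 1"
proof -
  have "(x 0)\<^sup>2 \<le> (\<Sum>i\<le>l. x i ^ 2)"
    by (rule member_le_sum) auto
  then have "\<bar>x 0\<bar> \<le> 1"
    using assms by (simp add: topspace_nsphere abs_square_le_1)
  then show ?thesis
    by simp
qed

lemma compact_space_nsphere: "compact_space (nsphere l)"
proof -
  let ?S = "{x::nat \<Rightarrow> real. (\<Sum>i\<le>l. x i ^ 2) = 1 \<and> (\<forall>i>l. x i = 0)}"
  have "closed {x::nat \<Rightarrow> real. (\<Sum>i\<le>l. x i ^ 2) = 1}"
    by (intro closed_Collect_eq continuous_intros continuous_on_product_coordinates)
  moreover have "closed {x::nat \<Rightarrow> real. \<forall>i>l. x i = 0}"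
    by (intro closed_Collect_all closed_Collect_imp closed_Collect_eq continuous_intros
        continuous_on_product_coordinates) auto
  ultimately have "closed ?S"
    using closed_Collect_conj by blast
  then have S: "closedin (powertop_real UNIV) ?S"
    by (simp add: euclidean_product_topology)
  have "compactin (powertop_real UNIV) (Pi\<^sub>E UNIV (\<lambda>_. {-1..1}))"
    by (subst compactin_PiE) auto
  moreover have "?S \<subseteq> Pi\<^sub>E UNIV (\<lambda>_. {-1..1})"
  proof
    fix x assume x: "x \<in> ?S"
    have "x i \<in> {-1..1}" for i
    proof (cases "i \<le> l")
      case True
      then have "(x i)\<^sup>2 \<le> (\<Sum>i\<le>l. x i ^ 2)"
        by (intro member_le_sum) auto
      then have "(x i)\<^sup>2 \<le> 1\<^sup>2"
        using x by simp
      then have "\<bar>x i\<bar> \<le> 1"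
        by (simp add: abs_square_le_1)
      then show ?thesis
        by auto
    qed (use x in auto)
    then show "x \<in> Pi\<^sub>E UNIV (\<lambda>_. {-1..1})"
      by auto
  qed
  ultimately have "compactin (powertop_real UNIV) ?S"
    using S closed_compactin by blast
  then show ?thesis
    by (simp add: nsphere compact_space_subtopology)
qed

lemma Hausdorff_space_nsphere: "Hausdorff_space (nsphere l)"
  unfolding nsphere
  by (intro Hausdorff_space_subtopology) (simp add: Hausdorff_space_product_topology)

text \<open>
  Squeezing all coordinates but the zeroth to 0 on the upper hemisphere, and normalising, deforms
  the identity to a map that is constant on the hemisphere around the basepoint.  A map
  precomposed with it is constant there as well, so that the hemisphere can be filled with a
  whisker: going up from the equator to the basepoint, it may be sent along any path that starts at
  the value of the constant.  This does the work of the homotopy extension property of the sphere and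
  its basepoint.
\<close>

lemma hemisphere_collapse:
  obtains \<rho> where "homotopic_with (\<lambda>h. h sphere_pt = sphere_pt) (nsphere l) (nsphere l) (\<lambda>z. z) \<rho>"
    and "\<And>z. z \<in> topspace (nsphere l) \<Longrightarrow> z 0 \<ge> 0 \<Longrightarrow> \<rho> z = sphere_pt"
proof -
  (* Along the segment from x to its squeezed image, all coordinates but the zeroth vanish only at the
     poles and, for s = 1, on the closed upper hemisphere.  There the zeroth coordinate is nonzero,
     because 1 + 2 x0 is positive for x0 >= 0 and negative for x0 = -1. *)
  define v :: "real \<Rightarrow> (nat \<Rightarrow> real) \<Rightarrow> nat \<Rightarrow> real" where
    "v s x i = (if i = 0 then (1 - s) * x 0 + s * (1 + 2 * x 0)
                else ((1 - s) + s * max 0 (- x 0)) * x i)" for s x i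
  define N where "N s x = sqrt (\<Sum>i\<le>l. (v s x i)\<^sup>2)" for s x
  have only0: "(\<Sum>i\<le>l. (y i)\<^sup>2) = (y 0)\<^sup>2" if "\<And>i. 0 < i \<Longrightarrow> i \<le> l \<Longrightarrow> y i = 0" for y :: "nat \<Rightarrow> real"
  proof -
    have "(\<Sum>i\<le>l. (y i)\<^sup>2) = (\<Sum>i\<in>{0}. (y i)\<^sup>2)"
      by (rule sum.mono_neutral_right) (use that in auto)
    then show ?thesis by simp
  qed
  have N_pos: "N s x > 0" if s: "s \<in> {0..1}" and x: "x \<in> topspace (nsphere l)" for s x
  proof (rule ccontr)
    assume "\<not> N s x > 0"
    then have "(\<Sum>i\<le>l. (v s x i)\<^sup>2) = 0"
      using sum_nonneg[of "{..l}" "\<lambda>i. (v s x i)\<^sup>2"] by (auto simp: N_def)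
    then have v0: "v s x i = 0" if "i \<le> l" for i
      using that by (subst (asm) sum_nonneg_eq_0_iff) auto
    show False
    proof (cases "(1 - s) + s * max 0 (- x 0) = 0")
      case True
      moreover have "1 - s \<ge> 0" "s * max 0 (- x 0) \<ge> 0"
        using s by auto
      ultimately have "s = 1" "max 0 (- x 0) = 0"
        by (smt (verit) mult_cancel_right1)+
      then show False
        using v0[of 0] by (auto simp: v_def max_def split: if_splits)
    next
      case False
      then have "x i = 0" if "0 < i" "i \<le> l" for i
        using v0[of i] that by (auto simp: v_def)
      then have "(x 0)\<^sup>2 = 1"
        using x only0[of x] by (auto simp: topspace_nsphere)
      then have "x 0 = 1 \<or> x 0 = -1"
        by (simp add: power2_eq_1_iff)
      then show False
        using v0[of 0] s by (auto simp: v_def algebra_simps)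
    qed
  qed
  define R where "R = (\<lambda>(s, x) i. v s x i / N s x)"
  let ?P = "prod_topology unit_int (nsphere l)"
  have proj: "continuous_map ?P euclideanreal (\<lambda>z. snd z i)" for i
    using continuous_map_compose[OF continuous_map_snd continuous_map_nsphere_projection, of unit_int l i]
    by (simp add: o_def)
  have time: "continuous_map ?P euclideanreal fst"
    by (rule continuous_map_into_fulltopology[OF continuous_map_fst])
  have v_cont: "continuous_map ?P euclideanreal (\<lambda>z. v (fst z) (snd z) i)" for i
    unfolding v_def by (cases "i = 0") (auto intro!: continuous_intros proj time)
  have R_in: "R z \<in> topspace (nsphere l)" if z: "z \<in> topspace ?P" for z
  proof -
    obtain s x where z': "z = (s, x)" "s \<in> {0..1}" "x \<in> topspace (nsphere l)"
      using z by (cases z) auto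
    have "(\<Sum>i\<le>l. (R z i)\<^sup>2) = (\<Sum>i\<le>l. (v s x i)\<^sup>2) / (N s x)\<^sup>2"
      by (simp add: R_def z' power_divide sum_divide_distrib)
    also have "(N s x)\<^sup>2 = (\<Sum>i\<le>l. (v s x i)\<^sup>2)"
      by (simp add: N_def sum_nonneg)
    also have "\<dots> / \<dots> = 1"
      using N_pos[OF z'(2,3)] by (auto simp: N_def)
    finally have "(\<Sum>i\<le>l. (R z i)\<^sup>2) = 1" .
    moreover have "\<forall>i>l. R z i = 0"
      using z' by (auto simp: R_def v_def topspace_nsphere)
    ultimately show ?thesis
      by (simp add: topspace_nsphere)
  qed
  have R_cont: "continuous_map ?P (nsphere l) R"
  proof (rule continuous_map_into_nsphere[OF _ R_in])
    fix i
    show "continuous_map ?P euclideanreal (\<lambda>z. R z i)"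
      unfolding R_def case_prod_unfold N_def
    proof (intro continuous_map_real_divide continuous_map_sqrt continuous_map_sum continuous_map_real_pow v_cont)
      fix z assume "z \<in> topspace ?P"
      then show "sqrt (\<Sum>i\<le>l. (v (fst z) (snd z) i)\<^sup>2) \<noteq> 0"
        using N_pos[of "fst z" "snd z"] by (auto simp: N_def)
    qed auto
  qed
  have R_pt: "R (s, x) = sphere_pt" if "x \<in> topspace (nsphere l)" "s \<in> {0..1}" 
    "\<And>i. 0 < i \<Longrightarrow> v s x i = 0" "v s x 0 > 0" for s x
  proof -
    have "N s x = v s x 0"
      using only0[of "v s x"] that by (simp add: N_def)
    then show ?thesis
      using that by (auto simp: R_def sphere_pt_def fun_eq_iff)
  qed
  show thesis
  proof (rule that)
    show "homotopic_with (\<lambda>h. h sphere_pt = sphere_pt) (nsphere l) (nsphere l) (\<lambda>z. z) (\<lambda>z. R (1, z))"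
    proof (subst homotopic_with, simp, intro exI conjI ballI)
      show "continuous_map ?P (nsphere l) R" by (rule R_cont)
      show "R (0, x) = x" if x: "x \<in> topspace (nsphere l)" for x
      proof -
        have "v 0 x = x" by (auto simp: v_def fun_eq_iff)
        moreover have "N 0 x = 1"
          using x by (simp add: N_def calculation topspace_nsphere)
        ultimately show ?thesis by (simp add: R_def)
      qed
      show "R (t, sphere_pt) = sphere_pt" if "t \<in> {0..1}" for t
        by (rule R_pt[OF sphere_pt_in_nsphere])
          (use that in \<open>auto simp: v_def sphere_pt_def algebra_simps add_pos_nonneg\<close>)
    qed auto
    show "R (1, z) = sphere_pt" if "z \<in> topspace (nsphere l)" "z 0 \<ge> 0" for z
      by (rule R_pt) (use that in \<open>auto simp: v_def\<close>)
  qed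
qed

section \<open>Maps transported along a path of basepoints\<close>

text \<open>
  A free homotopy from \<open>g\<close> to \<open>f\<close> whose basepoint runs along \<open>p\<close>.  The track of the basepoint
  is prescribed up to homotopy only; in this form the relation composes, inverts and is compatible
  with operad compositions, and each operad law for homotopy classes comes down to a homotopy
  between two tracks.
\<close>

definition transport ::
    "nat \<Rightarrow> 'a topology \<Rightarrow> (real \<Rightarrow> 'a) \<Rightarrow> ((nat \<Rightarrow> real) \<Rightarrow> 'a) \<Rightarrow> ((nat \<Rightarrow> real) \<Rightarrow> 'a) \<Rightarrow> bool" where
  "transport l X p g f \<longleftrightarrow> (\<exists>H.
     continuous_map (prod_topology unit_int (nsphere l)) X H \<and>
     (\<forall>z\<in>topspace (nsphere l). H (0, z) = g z \<and> H (1, z) = f z) \<and>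
     path_homotopic X p (\<lambda>t. H (t, sphere_pt)))"

lemma transportI:
  assumes "continuous_map (prod_topology unit_int (nsphere l)) X H"
    and "\<And>z. z \<in> topspace (nsphere l) \<Longrightarrow> H (0, z) = g z"
    and "\<And>z. z \<in> topspace (nsphere l) \<Longrightarrow> H (1, z) = f z"
    and "path_homotopic X p (\<lambda>t. H (t, sphere_pt))"
  shows "transport l X p g f"
  using assms unfolding transport_def by blast

lemma transportE:
  assumes "transport l X p g f"
  obtains H where "continuous_map (prod_topology unit_int (nsphere l)) X H"
    and "\<And>z. z \<in> topspace (nsphere l) \<Longrightarrow> H (0, z) = g z"
    and "\<And>z. z \<in> topspace (nsphere l) \<Longrightarrow> H (1, z) = f z"
    and "path_homotopic X p (\<lambda>t. H (t, sphere_pt))"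
  using assms unfolding transport_def by blast

lemma continuous_map_slice:
  assumes "continuous_map (prod_topology X Y) Z H" "x \<in> topspace X"
  shows "continuous_map Y Z (\<lambda>y. H (x, y))"
  using continuous_map_o_Pair[OF assms] by (simp add: o_def)

lemma transport_imp:
  assumes "transport l X p g f"
  shows "continuous_map (nsphere l) X g" "continuous_map (nsphere l) X f"
    "pathin X p" "g sphere_pt = p 0" "f sphere_pt = p 1"
proof -
  obtain H where H: "continuous_map (prod_topology unit_int (nsphere l)) X H"
    "\<And>z. z \<in> topspace (nsphere l) \<Longrightarrow> H (0, z) = g z"
    "\<And>z. z \<in> topspace (nsphere l) \<Longrightarrow> H (1, z) = f z"
    "path_homotopic X p (\<lambda>t. H (t, sphere_pt))"
    using assms by (rule transportE) blast
  show "continuous_map (nsphere l) X g" "continuous_map (nsphere l) X f"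
    using continuous_map_slice[OF H(1), of 0] continuous_map_slice[OF H(1), of 1] H(2,3)
    by (auto elim: continuous_map_eq)
  show "pathin X p" "g sphere_pt = p 0" "f sphere_pt = p 1"
    using path_homotopic_imp[OF H(4)] H(2,3) by auto
qed

lemma transport_path_cong:
  "path_homotopic X p q \<Longrightarrow> transport l X p g f \<Longrightarrow> transport l X q g f"
  unfolding transport_def using path_homotopic_sym path_homotopic_trans by blast

lemma transport_join:
  assumes "transport l X p g f" "transport l X q f h"
  shows "transport l X (join_path p q) g h"
proof -
  obtain H where H: "continuous_map (prod_topology unit_int (nsphere l)) X H"
    "\<And>z. z \<in> topspace (nsphere l) \<Longrightarrow> H (0, z) = g z"
    "\<And>z. z \<in> topspace (nsphere l) \<Longrightarrow> H (1, z) = f z"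
    "path_homotopic X p (\<lambda>t. H (t, sphere_pt))"
    using assms(1) by (rule transportE) blast
  obtain K where K: "continuous_map (prod_topology unit_int (nsphere l)) X K"
    "\<And>z. z \<in> topspace (nsphere l) \<Longrightarrow> K (0, z) = f z"
    "\<And>z. z \<in> topspace (nsphere l) \<Longrightarrow> K (1, z) = h z"
    "path_homotopic X q (\<lambda>t. K (t, sphere_pt))"
    using assms(2) by (rule transportE) blast
  have "path_homotopic X (join_path p q) (join_path (\<lambda>t. H (t, sphere_pt)) (\<lambda>t. K (t, sphere_pt)))"
    using H(4) K(4) transport_imp(5)[OF assms(1)] transport_imp(4)[OF assms(2)]
    by (intro path_homotopic_join) auto
  then show ?thesis
    by (intro transportI[OF continuous_map_glue_time[OF H(1) K(1)]]) (auto simp: H K join_path_def)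
qed

lemma transport_reverse:
  assumes "transport l X p g f"
  shows "transport l X (reverse_path p) f g"
proof -
  obtain H where H: "continuous_map (prod_topology unit_int (nsphere l)) X H"
    "\<And>z. z \<in> topspace (nsphere l) \<Longrightarrow> H (0, z) = g z"
    "\<And>z. z \<in> topspace (nsphere l) \<Longrightarrow> H (1, z) = f z"
    "path_homotopic X p (\<lambda>t. H (t, sphere_pt))"
    using assms by (rule transportE) blast
  have "continuous_map (prod_topology unit_int (nsphere l)) X (H \<circ> (\<lambda>x. (1 - fst x, snd x)))"
    by (rule continuous_map_compose[OF _ H(1)])
      (auto simp: continuous_map_paired continuous_map_in_subtopology
        intro!: continuous_intros continuous_map_into_fulltopology[OF continuous_map_fst] continuous_map_snd)
  then show ?thesis
    by (rule transportI) (use path_homotopic_reverse[OF H(4)] in \<open>auto simp: H reverse_path_def\<close>)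
qed

lemma based_homotopicI:
  assumes "continuous_map (prod_topology unit_int (nsphere l)) X H"
    and "\<And>z. z \<in> topspace (nsphere l) \<Longrightarrow> H (0, z) = f z"
    and "\<And>z. z \<in> topspace (nsphere l) \<Longrightarrow> H (1, z) = g z"
    and "\<And>t. t \<in> {0..1} \<Longrightarrow> H (t, sphere_pt) = x"
  shows "homotopic_with (\<lambda>h. h sphere_pt = x) (nsphere l) X f g"
  by (subst homotopic_with) (use assms in \<open>auto intro!: exI[of _ H]\<close>)

text \<open>
  If the track of the basepoint is null-homotopic, the homotopy can be made a based one.  After the
  collapse of the upper hemisphere, this hemisphere is mapped by the null-homotopy \<open>K\<close> of the track:
  at height 0 by the track itself, which fits the homotopy on the lower hemisphere, and at the
  basepoint by the constant path.
\<close>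

lemma transport_const_iff:
  "transport l X (\<lambda>_. x) g f \<longleftrightarrow> homotopic_with (\<lambda>h. h sphere_pt = x) (nsphere l) X g f"
proof
  assume "homotopic_with (\<lambda>h. h sphere_pt = x) (nsphere l) X g f"
  then obtain H where H: "continuous_map (prod_topology unit_int (nsphere l)) X H"
    "\<forall>z. H (0, z) = g z" "\<forall>z. H (1, z) = f z" "\<forall>t\<in>{0..1}. H (t, sphere_pt) = x"
    unfolding homotopic_with_def by blast
  have "x \<in> topspace X"
    using continuous_map_image_subset_topspace[OF H(1)] H(4)
    by (auto simp: image_subset_iff) (metis atLeastAtMost_iff order_refl zero_le_one sphere_pt_in_nsphere)
  then have "path_homotopic X (\<lambda>_. x) (\<lambda>t. H (t, sphere_pt))"
    by (intro path_homotopic_eq) (use H in auto)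
  then show "transport l X (\<lambda>_. x) g f"
    by (intro transportI[OF H(1)]) (use H in auto)
next
  assume tr: "transport l X (\<lambda>_. x) g f"
  obtain H where H: "continuous_map (prod_topology unit_int (nsphere l)) X H"
    "\<And>z. z \<in> topspace (nsphere l) \<Longrightarrow> H (0, z) = g z"
    "\<And>z. z \<in> topspace (nsphere l) \<Longrightarrow> H (1, z) = f z"
    "path_homotopic X (\<lambda>_. x) (\<lambda>t. H (t, sphere_pt))"
    using tr by (rule transportE) blast
  obtain K where K: "continuous_map (prod_topology unit_int unit_int) X K"
    "\<And>s. K (0, s) = x" "\<And>s. K (1, s) = H (s, sphere_pt)"
    "\<And>t. t \<in> {0..1} \<Longrightarrow> K (t, 0) = x" "\<And>t. t \<in> {0..1} \<Longrightarrow> K (t, 1) = x"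
    using H(4) by (rule path_homotopicE) blast
  obtain \<rho> where \<rho>: "homotopic_with (\<lambda>h. h sphere_pt = sphere_pt) (nsphere l) (nsphere l) (\<lambda>z. z) \<rho>"
    "\<And>z. z \<in> topspace (nsphere l) \<Longrightarrow> z 0 \<ge> 0 \<Longrightarrow> \<rho> z = sphere_pt"
    using hemisphere_collapse by blast
  have \<rho>_cont: "continuous_map (nsphere l) (nsphere l) \<rho>"
    using homotopic_with_imp_continuous_maps[OF \<rho>(1)] by blast
  have collapse: "homotopic_with (\<lambda>h. h sphere_pt = x) (nsphere l) X h (h \<circ> \<rho>)"
    if "continuous_map (nsphere l) X h" "h sphere_pt = x" for h
    using homotopic_with_compose_continuous_map_left[OF \<rho>(1) that(1), where q = "\<lambda>h. h sphere_pt = x"] that(2)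
    by (simp add: o_def)
  let ?P = "prod_topology unit_int (nsphere l)"
  have time: "continuous_map ?P euclideanreal fst"
    by (rule continuous_map_into_fulltopology[OF continuous_map_fst])
  have height: "continuous_map ?P euclideanreal (\<lambda>z. snd z 0)"
    using continuous_map_compose[OF continuous_map_snd continuous_map_nsphere_projection, of unit_int l 0]
    by (simp add: o_def)
  have 1: "continuous_map (subtopology ?P {z \<in> topspace ?P. 0 \<le> snd z 0}) X
      (K \<circ> (\<lambda>z. (1 - snd z 0, fst z)))"
    by (rule continuous_map_compose[OF continuous_map_pairedI K(1)])
      (auto simp: continuous_map_in_subtopology nsphere_first_coordinate_le_1
        intro!: continuous_intros continuous_map_from_subtopology time height)
  have 2: "continuous_map (subtopology ?P {z \<in> topspace ?P. snd z 0 \<le> 0}) X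
      (H \<circ> (\<lambda>z. (fst z, \<rho> (snd z))))"
    by (intro continuous_map_from_subtopology continuous_map_compose[OF _ H(1)])
      (auto simp: continuous_map_paired continuous_map_fst
        intro!: continuous_map_compose[OF continuous_map_snd \<rho>_cont, unfolded o_def])
  have "continuous_map ?P X
      (\<lambda>z. if 0 \<le> snd z 0 then (K \<circ> (\<lambda>z. (1 - snd z 0, fst z))) z else (H \<circ> (\<lambda>z. (fst z, \<rho> (snd z)))) z)"
    by (rule continuous_map_cases_le[OF _ height 1 2]) (auto simp: K \<rho>)
  then have "homotopic_with (\<lambda>h. h sphere_pt = x) (nsphere l) X (g \<circ> \<rho>) (f \<circ> \<rho>)"
  proof (rule based_homotopicI)
    note \<rho>_in = funcset_mem[OF continuous_map_funspace[OF \<rho>_cont]]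
    note pt = transport_imp(4,5)[OF tr]
    show "(if 0 \<le> snd (0, z) 0 then (K \<circ> (\<lambda>z. (1 - snd z 0, fst z))) (0, z)
        else (H \<circ> (\<lambda>z. (fst z, \<rho> (snd z)))) (0, z)) = (g \<circ> \<rho>) z"
      if "z \<in> topspace (nsphere l)" for z
      using that nsphere_first_coordinate_le_1[OF that] pt \<rho>_in by (auto simp: K H \<rho>)
    show "(if 0 \<le> snd (1, z) 0 then (K \<circ> (\<lambda>z. (1 - snd z 0, fst z))) (1, z)
        else (H \<circ> (\<lambda>z. (fst z, \<rho> (snd z)))) (1, z)) = (f \<circ> \<rho>) z"
      if "z \<in> topspace (nsphere l)" for z
      using that nsphere_first_coordinate_le_1[OF that] pt \<rho>_in by (auto simp: K H \<rho>)
  qed (auto simp: K sphere_pt_def)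
  moreover have "homotopic_with (\<lambda>h. h sphere_pt = x) (nsphere l) X g (g \<circ> \<rho>)"
    "homotopic_with (\<lambda>h. h sphere_pt = x) (nsphere l) X f (f \<circ> \<rho>)"
    using collapse transport_imp[OF tr] by auto
  ultimately show "homotopic_with (\<lambda>h. h sphere_pt = x) (nsphere l) X g f"
    by (meson homotopic_with_trans homotopic_with_symD)
qed

lemma transport_refl:
  assumes "f \<in> based_maps l X x"
  shows "transport l X (\<lambda>_. x) f f"
  using assms by (simp add: transport_const_iff based_maps_def)

lemma transport_const_right:
  "transport l X p g f \<Longrightarrow> transport l X (\<lambda>_. x) f h \<Longrightarrow> transport l X p g h"
  using transport_path_cong[OF path_homotopic_const_right transport_join] transport_imp
  by metis

text \<open>
  Following one homotopy forwards and the other one backwards gives a track of the form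
  \<open>p p\<inverse>\<close>, which is null-homotopic.
\<close>

lemma transport_unique:
  assumes p: "transport l X p g f" and q: "transport l X q g' f" and pq: "path_homotopic X p q"
  shows "homotopic_with (\<lambda>h. h sphere_pt = p 0) (nsphere l) X g g'"
proof -
  have "transport l X p g' f"
    using q pq transport_path_cong path_homotopic_sym by blast
  then have "transport l X (join_path p (reverse_path p)) g g'"
    using p transport_join transport_reverse by blast
  then have "transport l X (\<lambda>_. p 0) g g'"
    by (rule transport_path_cong[rotated])
      (use transport_imp(3)[OF p] in \<open>auto intro: path_homotopic_inverse_right\<close>)
  then show ?thesis
    by (simp add: transport_const_iff)
qed

text \<open>
  A change of basepoint asks for a homotopy with the track \<open>p\<close> itself.  It exists for the
  representative \<open>f' = f \<circ> \<rho>\<close>, where \<open>\<rho>\<close> collapses the upper hemisphere: at time \<open>t\<close> the part of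
  \<open>p\<close> that is still ahead, from \<open>p t\<close> to \<open>p 1\<close>, is laid out on the hemisphere from the basepoint
  down to the equator.
\<close>

lemma exact_transport_exists:
  assumes f: "continuous_map (nsphere l) X f" and p: "pathin X p" "f sphere_pt = p 1"
  obtains f' H where "homotopic_with (\<lambda>h. h sphere_pt = p 1) (nsphere l) X f f'"
    and "continuous_map (prod_topology unit_int (nsphere l)) X H"
    and "\<And>z. z \<in> topspace (nsphere l) \<Longrightarrow> H (1, z) = f' z"
    and "\<And>t. t \<in> {0..1} \<Longrightarrow> H (t, sphere_pt) = p t"
proof -
  obtain \<rho> where \<rho>: "homotopic_with (\<lambda>h. h sphere_pt = sphere_pt) (nsphere l) (nsphere l) (\<lambda>z. z) \<rho>"
    "\<And>z. z \<in> topspace (nsphere l) \<Longrightarrow> z 0 \<ge> 0 \<Longrightarrow> \<rho> z = sphere_pt"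
    using hemisphere_collapse by blast
  have \<rho>_cont: "continuous_map (nsphere l) (nsphere l) \<rho>"
    using homotopic_with_imp_continuous_maps[OF \<rho>(1)] by blast
  have collapse: "homotopic_with (\<lambda>h. h sphere_pt = p 1) (nsphere l) X f (f \<circ> \<rho>)"
    using homotopic_with_compose_continuous_map_left[OF \<rho>(1) f, where q = "\<lambda>h. h sphere_pt = p 1"] p(2)
    by (simp add: o_def)
  let ?P = "prod_topology unit_int (nsphere l)"
  have time: "continuous_map ?P euclideanreal fst"
    by (rule continuous_map_into_fulltopology[OF continuous_map_fst])
  have height: "continuous_map ?P euclideanreal (\<lambda>z. snd z 0)"
    using continuous_map_compose[OF continuous_map_snd continuous_map_nsphere_projection, of unit_int l 0]
    by (simp add: o_def)
  have 1: "continuous_map (subtopology ?P {z \<in> topspace ?P. 0 \<le> snd z 0}) X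
      (p \<circ> (\<lambda>z. 1 - (1 - fst z) * snd z 0))"
    by (rule continuous_map_compose[OF _ p(1)[unfolded pathin_def]])
      (auto simp: continuous_map_in_subtopology nsphere_first_coordinate_le_1 mult_le_one
        intro!: continuous_intros continuous_map_from_subtopology time height)
  have 2: "continuous_map (subtopology ?P {z \<in> topspace ?P. snd z 0 \<le> 0}) X
      (f \<circ> \<rho> \<circ> snd)"
    by (intro continuous_map_from_subtopology continuous_map_compose[OF continuous_map_snd]
        continuous_map_compose[OF \<rho>_cont f])
  define H where "H = (\<lambda>z. if 0 \<le> snd z 0 then (p \<circ> (\<lambda>z. 1 - (1 - fst z) * snd z 0)) z
                          else (f \<circ> \<rho> \<circ> snd) (z :: real \<times> (nat \<Rightarrow> real)))"
  have "continuous_map ?P X H"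
    unfolding H_def by (rule continuous_map_cases_le[OF _ height 1 2]) (auto simp: \<rho> p)
  moreover have "H (1, z) = (f \<circ> \<rho>) z" if "z \<in> topspace (nsphere l)" for z
    using that by (auto simp: H_def \<rho> p)
  moreover have "H (t, sphere_pt) = p t" if "t \<in> {0..1}" for t
    by (simp add: H_def sphere_pt_def)
  ultimately show thesis
    using that[OF collapse] by blast
qed

lemma transport_exists:
  assumes f: "continuous_map (nsphere l) X f" and p: "pathin X p" "f sphere_pt = p 1"
  obtains g where "transport l X p g f"
proof -
  obtain f' H where H: "homotopic_with (\<lambda>h. h sphere_pt = p 1) (nsphere l) X f f'"
    "continuous_map (prod_topology unit_int (nsphere l)) X H"
    "\<And>z. z \<in> topspace (nsphere l) \<Longrightarrow> H (1, z) = f' z"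
    "\<And>t. t \<in> {0..1} \<Longrightarrow> H (t, sphere_pt) = p t"
    using exact_transport_exists[OF assms] by blast
  have "transport l X p (\<lambda>z. H (0, z)) f'"
    by (rule transportI[OF H(2)]) (use H p in \<open>auto intro: path_homotopic_eq\<close>)
  then have "transport l X p (\<lambda>z. H (0, z)) f"
    using H(1) by (auto intro: transport_const_right simp: transport_const_iff homotopic_with_sym)
  then show thesis
    by (rule that)
qed

section \<open>Homotopy classes and change of basepoint\<close>

lemma mem_htpy_class: "g \<in> htpy_class l X x f \<longleftrightarrow> transport l X (\<lambda>_. x) f g"
  by (simp add: htpy_class_def transport_const_iff)

lemma htpy_class_eq:
  assumes "transport l X (\<lambda>_. x) f g"
  shows "htpy_class l X x f = htpy_class l X x g"
  using assms unfolding transport_const_iff htpy_class_def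
  by (auto intro: homotopic_with_trans homotopic_with_symD)

lemma based_maps_transport:
  assumes "transport l X p g f"
  shows "g \<in> based_maps l X (p 0)" "f \<in> based_maps l X (p 1)"
  using transport_imp[OF assms] by (auto simp: based_maps_def)

text \<open>
  All representatives and all homotopies that enter a change of basepoint give the same class,
  because two maps joined to the same map along homotopic tracks are homotopic as based maps.
\<close>

lemma change_basepoint_eq:
  assumes tr: "transport l X p g f" and y: "y = p 1"
  shows "change_basepoint l X p (htpy_class l X y f) = htpy_class l X (p 0) g"
proof (rule Set.set_eqI, rule iffI)
  fix g' assume "g' \<in> change_basepoint l X p (htpy_class l X y f)"
  then obtain f2 g2 H where H: "f2 \<in> htpy_class l X y f"
    "continuous_map (prod_topology unit_int (nsphere l)) X H"
    "\<forall>z. H (0, z) = g2 z" "\<forall>z. H (1, z) = f2 z"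
    "\<forall>t\<in>{0..1}. H (t, sphere_pt) = p t" "g' \<in> htpy_class l X (p 0) g2"
    unfolding change_basepoint_def by blast
  have "transport l X p g2 f2"
    by (rule transportI[OF H(2)])
      (use H transport_imp(3)[OF tr] in \<open>auto intro!: path_homotopic_eq\<close>)
  moreover have "transport l X p g f2"
    using transport_const_right[OF tr] H(1) by (auto simp: mem_htpy_class)
  ultimately have "transport l X (\<lambda>_. p 0) g g2"
    using transport_unique[of l X p g f2 p g2] transport_imp(3)[OF tr]
    by (simp add: transport_const_iff path_homotopic_refl)
  then show "g' \<in> htpy_class l X (p 0) g"
    using H(6) htpy_class_eq[of l X "p 0" g g2] by simp
next
  fix g' assume g': "g' \<in> htpy_class l X (p 0) g"
  obtain f' H where H: "homotopic_with (\<lambda>h. h sphere_pt = p 1) (nsphere l) X f f'"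
    "continuous_map (prod_topology unit_int (nsphere l)) X H"
    "\<And>z. z \<in> topspace (nsphere l) \<Longrightarrow> H (1, z) = f' z"
    "\<And>t. t \<in> {0..1} \<Longrightarrow> H (t, sphere_pt) = p t"
    using exact_transport_exists[of l X f p] transport_imp[OF tr] by blast
  have f': "transport l X (\<lambda>_. p 1) f f'"
    using H(1) by (simp add: transport_const_iff)
  let ?f' = "\<lambda>z. H (1, z)" and ?g' = "\<lambda>z. H (0, z)"
  have "path_homotopic X p (\<lambda>t. H (t, sphere_pt))"
    by (rule path_homotopic_eq) (use H transport_imp(3)[OF tr] in auto)
  then have trH: "transport l X p ?g' ?f'"
    by (intro transportI[OF H(2)]) auto
  have "transport l X p ?g' f'"
    by (rule transportI[OF H(2)])
      (use H \<open>path_homotopic X p (\<lambda>t. H (t, sphere_pt))\<close> in auto)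
  moreover have "transport l X p g f'"
    using transport_const_right[OF tr f'] .
  ultimately have "transport l X (\<lambda>_. p 0) ?g' g"
    using transport_unique[of l X p ?g' f' p g] transport_imp(3)[OF tr]
    by (simp add: transport_const_iff path_homotopic_refl)
  then have "g' \<in> htpy_class l X (p 0) ?g'"
    using g' htpy_class_eq[of l X "p 0" ?g' g] by simp
  moreover have "?f' \<in> htpy_class l X y f"
  proof -
    have "transport l X (\<lambda>_. p 1) ?f' ?f'"
      by (rule transport_refl[OF based_maps_transport(2)[OF trH]])
    then have "transport l X (\<lambda>_. p 1) f' ?f'"
      unfolding transport_def by (metis H(3))
    then show ?thesis
      using transport_const_right[OF f'] by (simp add: mem_htpy_class y)
  qed
  ultimately show "g' \<in> change_basepoint l X p (htpy_class l X y f)"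
    unfolding change_basepoint_def mem_Collect_eq using H(2,4)
    by (intro bexI[of _ ?f'] exI[of _ ?g'] exI[of _ H]) simp_all
qed

section \<open>The fundamental group in terms of maps on the circle\<close>

(* The circle and the first space of an operad are written nsphere 1 and ospace C 1 throughout. *)
declare One_nat_def [simp del]

lemma circ_ends [simp]: "circ 0 = sphere_pt" "circ 1 = sphere_pt"
  by (auto simp: circ_def sphere_pt_def)

lemma circ_in_nsphere [simp]: "circ t \<in> topspace (nsphere 1)"
  by (auto simp: topspace_nsphere circ_def One_nat_def)

lemma continuous_map_circ: "continuous_map unit_int (nsphere 1) circ"
proof (rule continuous_map_into_nsphere)
  show "continuous_map unit_int euclideanreal (\<lambda>t. circ t i)" for i
    by (cases "i = 0"; cases "i = 1") (auto simp: circ_def intro!: continuous_intros)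
qed simp

lemma circ_eq_circ:
  assumes "circ s = circ t" "s \<in> {0..1}" "t \<in> {0..1}"
  shows "s = t \<or> {s, t} = {0, 1}"
proof -
  have "cos (2 * pi * s) = cos (2 * pi * t)" "sin (2 * pi * s) = sin (2 * pi * t)"
    using fun_cong[OF assms(1), of 0] fun_cong[OF assms(1), of 1] by (auto simp: circ_def)
  then have "cos (2 * pi * s - 2 * pi * t) = 1"
    by (simp add: cos_diff flip: power2_eq_square)
  then obtain n :: int where "2 * pi * s - 2 * pi * t = of_int n * 2 * pi"
    using cos_one_2pi_int by blast
  then have "2 * pi * (s - t) = 2 * pi * of_int n"
    by (simp add: algebra_simps)
  then have n: "s - t = of_int n"
    by simp
  then have "\<bar>real_of_int n\<bar> \<le> 1"
    using assms(2,3) by auto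
  then have "n = 0 \<or> n = 1 \<or> n = -1"
    by linarith
  then show ?thesis
    using n assms(2,3) by auto
qed

lemma circ_surj: "circ ` {0..1} = topspace (nsphere 1)"
proof (intro equalityI subsetI)
  fix z assume z: "z \<in> topspace (nsphere 1)"
  then have "(z 0)\<^sup>2 + (z 1)\<^sup>2 = 1"
    by (simp add: topspace_nsphere One_nat_def)
  then obtain t where t: "0 \<le> t" "t < 2 * pi" "z 0 = cos t" "z 1 = sin t"
    using sincos_total_2pi by blast
  have "z i = circ (t / (2 * pi)) i" for i
    using t z by (auto simp: circ_def topspace_nsphere)
  then show "z \<in> circ ` {0..1}"
    using t by (intro image_eqI[of _ _ "t / (2 * pi)"]) (auto simp: field_simps)
qed auto

lemma quotient_map_compact_Hausdorff:
  assumes "compact_space X" "Hausdorff_space Y" "continuous_map X Y f" "f ` topspace X = topspace Y"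
  shows "quotient_map X Y f"
  using assms continuous_imp_closed_map_gen Hausdorff_imp_kc_space
  by (metis continuous_closed_imp_quotient_map)

lemma quotient_map_circ: "quotient_map unit_int (nsphere 1) circ"
  by (rule quotient_map_compact_Hausdorff)
    (auto simp: Hausdorff_space_nsphere continuous_map_circ circ_surj compact_space_subtopology)

lemma quotient_map_id_circ:
  "quotient_map (prod_topology unit_int unit_int) (prod_topology unit_int (nsphere 1))
     (\<lambda>x. (fst x, circ (snd x)))"
proof (rule quotient_map_compact_Hausdorff)
  show "compact_space (prod_topology unit_int unit_int)"
    by (auto simp: compact_Times compact_space_subtopology)
  show "Hausdorff_space (prod_topology unit_int (nsphere 1))"
    by (simp add: Hausdorff_space_prod_topology Hausdorff_space_nsphere Hausdorff_space_subtopology)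
  show "continuous_map (prod_topology unit_int unit_int) (prod_topology unit_int (nsphere 1))
     (\<lambda>x. (fst x, circ (snd x)))"
    by (intro continuous_map_pairedI continuous_map_fst
        continuous_map_compose[OF continuous_map_snd continuous_map_circ, unfolded o_def])
  show "(\<lambda>x. (fst x, circ (snd x))) ` topspace (prod_topology unit_int unit_int) =
      topspace (prod_topology unit_int (nsphere 1))"
    using circ_surj by (force simp: image_iff)
qed

lemma based_map_of_loop:
  assumes p: "pathin X p" "p 0 = x" "p 1 = x"
  obtains f where "f \<in> based_maps 1 X x" "\<And>t. t \<in> {0..1} \<Longrightarrow> f (circ t) = p t"
proof -
  have eq: "p s = p t" if "s \<in> topspace unit_int" "t \<in> topspace unit_int" "circ s = circ t" for s t
    using circ_eq_circ[of s t] that p by (auto simp: doubleton_eq_iff)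
  obtain f where f: "continuous_map (nsphere 1) X f" "\<And>t. t \<in> topspace unit_int \<Longrightarrow> f (circ t) = p t"
    by (rule quotient_map_lift_exists[OF quotient_map_circ p(1)[unfolded pathin_def]])
      (rule eq, assumption+, rule that)
  have "f sphere_pt = x"
    using f(2)[of 0] p(2) by simp
  then show thesis
    using that[of f] f by (simp add: based_maps_def)
qed

lemma pathin_circ:
  assumes "f \<in> based_maps 1 X x"
  shows "pathin X (f \<circ> circ)" "(f \<circ> circ) 0 = x" "(f \<circ> circ) 1 = x"
  using assms continuous_map_compose[OF continuous_map_circ, of X f]
  by (auto simp: based_maps_def pathin_def)

text \<open>
  A homotopy of loops is constant on the two edges of the square that \<open>circ\<close> identifies, so it
  descends to the product of the interval and the circle.
\<close>

lemma path_homotopic_circ_iff: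
  assumes f: "f \<in> based_maps 1 X x" and g: "g \<in> based_maps 1 X x"
  shows "path_homotopic X (f \<circ> circ) (g \<circ> circ) \<longleftrightarrow> transport 1 X (\<lambda>_. x) f g"
proof
  assume "transport 1 X (\<lambda>_. x) f g"
  then obtain H where H: "continuous_map (prod_topology unit_int (nsphere 1)) X H"
    "\<forall>z. H (0, z) = f z" "\<forall>z. H (1, z) = g z" "\<forall>t\<in>{0..1}. H (t, sphere_pt) = x"
    unfolding transport_const_iff homotopic_with_def by blast
  have "continuous_map (prod_topology unit_int unit_int) X (H \<circ> (\<lambda>x. (fst x, circ (snd x))))"
    using H(1) quotient_imp_continuous_map[OF quotient_map_id_circ]
    by (rule continuous_map_compose[rotated])
  then show "path_homotopic X (f \<circ> circ) (g \<circ> circ)"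
    by (rule path_homotopicI) (use H pathin_circ(2,3)[OF f] in auto)
next
  assume "path_homotopic X (f \<circ> circ) (g \<circ> circ)"
  then obtain K where K: "continuous_map (prod_topology unit_int unit_int) X K"
    "\<And>s. K (0, s) = (f \<circ> circ) s" "\<And>s. K (1, s) = (g \<circ> circ) s"
    "\<And>t. t \<in> {0..1} \<Longrightarrow> K (t, 0) = (f \<circ> circ) 0" "\<And>t. t \<in> {0..1} \<Longrightarrow> K (t, 1) = (f \<circ> circ) 1"
    by (rule path_homotopicE) blast
  have eq: "K a = K b" if "a \<in> topspace (prod_topology unit_int unit_int)"
      "b \<in> topspace (prod_topology unit_int unit_int)"
      "(fst a, circ (snd a)) = (fst b, circ (snd b))" for a b
    using that circ_eq_circ[of "snd a" "snd b"] K(4,5)[of "fst a"] pathin_circ(2,3)[OF f]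
    by (cases a; cases b) (auto simp: doubleton_eq_iff)
  obtain H where H: "continuous_map (prod_topology unit_int (nsphere 1)) X H"
    "\<And>a. a \<in> topspace (prod_topology unit_int unit_int) \<Longrightarrow> H (fst a, circ (snd a)) = K a"
    by (rule quotient_map_lift_exists[OF quotient_map_id_circ K(1)])
      (rule eq, assumption+, rule that)
  have H': "H (t, circ s) = K (t, s)" if "t \<in> {0..1}" "s \<in> {0..1}" for s t
    using H(2)[of "(t, s)"] that by simp
  have "homotopic_with (\<lambda>h. h sphere_pt = x) (nsphere 1) X f g"
  proof (rule based_homotopicI[OF H(1)])
    fix z assume "z \<in> topspace (nsphere 1)"
    then obtain s where "s \<in> {0..1}" "z = circ s"
      using circ_surj by blast
    then show "H (0, z) = f z" "H (1, z) = g z"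
      using H' K(2,3) by auto
  next
    fix t :: real assume "t \<in> {0..1}"
    then show "H (t, sphere_pt) = x"
      using H'[of t 0] K(4)[of t] pathin_circ(2)[OF f] by simp
  qed
  then show "transport 1 X (\<lambda>_. x) f g"
    by (simp add: transport_const_iff)
qed

text \<open>
  Composed with \<open>circ\<close>, the homotopy is a square with opposite edges \<open>g\<close> and \<open>f\<close>, whose other two
  edges are both the track \<open>p\<close>.  The edge \<open>g\<close> and the way around the other three edges are
  homotopic, since the square is convex.
\<close>

lemma transport_circ:
  assumes "transport 1 X p g f"
  shows "path_homotopic X (g \<circ> circ) (join_path p (join_path (f \<circ> circ) (reverse_path p)))"
proof -
  obtain H where H: "continuous_map (prod_topology unit_int (nsphere 1)) X H"
    "\<And>z. z \<in> topspace (nsphere 1) \<Longrightarrow> H (0, z) = g z"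
    "\<And>z. z \<in> topspace (nsphere 1) \<Longrightarrow> H (1, z) = f z"
    "path_homotopic X p (\<lambda>t. H (t, sphere_pt))"
    using assms by (rule transportE) blast
  let ?q = "\<lambda>t. H (t, sphere_pt)"
  let ?F = "H \<circ> (\<lambda>x. (fst x, circ (snd x)))"
  have F: "continuous_map (top_of_set ({0..1} \<times> {0..1})) X ?F"
    using continuous_map_compose[OF quotient_imp_continuous_map[OF quotient_map_id_circ] H(1)]
    by simp
  let ?\<psi> = "join_path (\<lambda>t::real. (t, 0::real)) (join_path (\<lambda>s. (1, s)) (\<lambda>t. (1 - t, 1)))"
  have pin: "pathin (top_of_set ({0..1} \<times> {0..1})) ?\<psi>"
    by (intro pathin_join_path)
      (auto simp: pathin_def continuous_map_in_subtopology intro!: continuous_intros)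
  have "path_homotopic X (\<lambda>s. ?F (0, s)) (\<lambda>s. ?F (?\<psi> s))"
    by (rule path_homotopic_convex_domain[OF _ F])
      (use pin in \<open>auto simp: pathin_def continuous_map_in_subtopology image_subset_iff
        intro!: convex_Times continuous_intros\<close>)
  then have "path_homotopic X (g \<circ> circ) (\<lambda>s. ?F (?\<psi> s))"
    by (rule path_homotopic_cong_left) (auto simp: H)
  moreover have "(\<lambda>s. ?F (?\<psi> s)) = join_path ?q (join_path (f \<circ> circ) (reverse_path ?q))"
    by (auto simp: join_path_def fun_eq_iff H reverse_path_def)
  moreover have "path_homotopic X (join_path ?q (join_path (f \<circ> circ) (reverse_path ?q)))
     (join_path p (join_path (f \<circ> circ) (reverse_path p)))"
  proof (intro path_homotopic_join)
    show "path_homotopic X ?q p" "path_homotopic X (reverse_path ?q) (reverse_path p)"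
      using path_homotopic_sym[OF H(4)] path_homotopic_reverse[OF path_homotopic_sym[OF H(4)]] by simp_all
    show "path_homotopic X (f \<circ> circ) (f \<circ> circ)"
      using path_homotopic_refl[OF pathin_circ(1)[OF based_maps_transport(2)[OF assms]]] transport_imp(5)[OF assms] by simp
  qed (auto simp: H)
  ultimately show ?thesis
    using path_homotopic_trans[of X "g \<circ> circ" "\<lambda>s. ?F (?\<psi> s)"] by (simp only:)
qed

lemma loop_class_eq:
  assumes f: "f \<in> based_maps 1 X x" and p: "path_homotopic X (f \<circ> circ) p"
  shows "loop_class X x p = htpy_class 1 X x f"
proof (rule Set.set_eqI)
  fix h
  have "h \<in> loop_class X x p \<longleftrightarrow> h \<in> based_maps 1 X x \<and> path_homotopic X (f \<circ> circ) (h \<circ> circ)"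
    using path_homotopic_trans[OF p] path_homotopic_trans[OF _ p] path_homotopic_sym
    unfolding loop_class_def by blast
  also have "\<dots> \<longleftrightarrow> transport 1 X (\<lambda>_. x) f h"
    using path_homotopic_circ_iff[OF f] based_maps_transport(2)[of 1 X "\<lambda>_. x" f h] by blast
  finally show "h \<in> loop_class X x p \<longleftrightarrow> h \<in> htpy_class 1 X x f"
    by (simp add: mem_htpy_class)
qed

lemma loop_representative:
  assumes "pathin X p" "p 0 = x" "p 1 = x"
  obtains f where "f \<in> based_maps 1 X x" "path_homotopic X (f \<circ> circ) p"
  using based_map_of_loop[OF assms] pathin_circ(1) path_homotopic_eq[of X _ p]
  by (metis comp_apply)

lemma homotopy_setE:
  assumes "\<alpha> \<in> homotopy_set l X x"
  obtains f where "f \<in> based_maps l X x" "\<alpha> = htpy_class l X x f"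
  using assms unfolding homotopy_set_def by blast

lemma htpy_class_in_homotopy_set [intro]:
  "f \<in> based_maps l X x \<Longrightarrow> htpy_class l X x f \<in> homotopy_set l X x"
  unfolding homotopy_set_def by blast

lemma mem_htpy_class_self: "f \<in> based_maps l X x \<Longrightarrow> f \<in> htpy_class l X x f"
  by (simp add: mem_htpy_class transport_refl)

lemma htpy_class_mem:
  assumes "g \<in> htpy_class l X x f"
  shows "g \<in> based_maps l X x" "htpy_class l X x g = htpy_class l X x f"
  using assms based_maps_transport(2)[of l X "\<lambda>_. x" f g] htpy_class_eq[of l X x f g]
  by (auto simp: mem_htpy_class)

lemma const_in_based_maps [intro]: "x \<in> topspace X \<Longrightarrow> (\<lambda>_. x) \<in> based_maps l X x"
  by (simp add: based_maps_def)

lemma pi1_mult_eq: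
  assumes f: "f \<in> based_maps 1 X x" and g: "g \<in> based_maps 1 X x" and h: "h \<in> based_maps 1 X x"
    and fg: "path_homotopic X (h \<circ> circ) (join_path (f \<circ> circ) (g \<circ> circ))"
  shows "htpy_class 1 X x f \<otimes>\<^bsub>pi1_group X x\<^esub> htpy_class 1 X x g = htpy_class 1 X x h"
proof -
  have "loop_class X x (join_path (f' \<circ> circ) (g' \<circ> circ)) = htpy_class 1 X x h"
    if f': "f' \<in> htpy_class 1 X x f" and g': "g' \<in> htpy_class 1 X x g" for f' g'
  proof (rule loop_class_eq[OF h])
    have "path_homotopic X (f \<circ> circ) (f' \<circ> circ)" "path_homotopic X (g \<circ> circ) (g' \<circ> circ)"
      using path_homotopic_circ_iff[OF f htpy_class_mem(1)[OF f']]
        path_homotopic_circ_iff[OF g htpy_class_mem(1)[OF g']] f' g'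
      by (auto simp: mem_htpy_class)
    then have "path_homotopic X (join_path (f \<circ> circ) (g \<circ> circ)) (join_path (f' \<circ> circ) (g' \<circ> circ))"
      by (rule path_homotopic_join) (use pathin_circ(2,3)[OF f] pathin_circ(2,3)[OF g] in auto)
    with fg show "path_homotopic X (h \<circ> circ) (join_path (f' \<circ> circ) (g' \<circ> circ))"
      by (rule path_homotopic_trans)
  qed
  then show ?thesis
    using mem_htpy_class_self[OF f] mem_htpy_class_self[OF g] by (auto simp: pi1_group_def)
qed

lemma pi1_mult_representative:
  assumes f: "f \<in> based_maps 1 X x" and g: "g \<in> based_maps 1 X x"
  obtains h where "h \<in> based_maps 1 X x"
    "path_homotopic X (h \<circ> circ) (join_path (f \<circ> circ) (g \<circ> circ))"
    "htpy_class 1 X x f \<otimes>\<^bsub>pi1_group X x\<^esub> htpy_class 1 X x g = htpy_class 1 X x h"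
proof -
  have "pathin X (join_path (f \<circ> circ) (g \<circ> circ))"
    by (rule pathin_join_path) (use pathin_circ[OF f] pathin_circ[OF g] in auto)
  then obtain h where "h \<in> based_maps 1 X x" "path_homotopic X (h \<circ> circ) (join_path (f \<circ> circ) (g \<circ> circ))"
    using loop_representative[of X "join_path (f \<circ> circ) (g \<circ> circ)" x] pathin_circ[OF f] pathin_circ[OF g]
    by auto
  then show thesis
    using that pi1_mult_eq[OF f g] by blast
qed

lemma pi1_carrier [simp]: "carrier (pi1_group X x) = homotopy_set 1 X x"
  and pi1_one: "\<one>\<^bsub>pi1_group X x\<^esub> = htpy_class 1 X x (\<lambda>_. x)"
  by (simp_all add: pi1_group_def)

lemma pi1_group_is_group:
  assumes x: "x \<in> topspace X"
  shows "group (pi1_group X x)"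
proof (rule groupI)
  fix \<alpha> \<beta> assume "\<alpha> \<in> carrier (pi1_group X x)" "\<beta> \<in> carrier (pi1_group X x)"
  then show "\<alpha> \<otimes>\<^bsub>pi1_group X x\<^esub> \<beta> \<in> carrier (pi1_group X x)"
    by (auto elim!: homotopy_setE) (metis pi1_mult_representative htpy_class_in_homotopy_set)
next
  show "\<one>\<^bsub>pi1_group X x\<^esub> \<in> carrier (pi1_group X x)"
    using x by (auto simp: pi1_one)
next
  fix \<alpha> \<beta> \<gamma>
  assume "\<alpha> \<in> carrier (pi1_group X x)" "\<beta> \<in> carrier (pi1_group X x)" "\<gamma> \<in> carrier (pi1_group X x)"
  then obtain f g h where f: "f \<in> based_maps 1 X x" "\<alpha> = htpy_class 1 X x f"
    and g: "g \<in> based_maps 1 X x" "\<beta> = htpy_class 1 X x g"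
    and h: "h \<in> based_maps 1 X x" "\<gamma> = htpy_class 1 X x h"
    by (auto elim!: homotopy_setE)
  note ends = pathin_circ[OF f(1)] pathin_circ[OF g(1)] pathin_circ[OF h(1)]
  obtain u where u: "u \<in> based_maps 1 X x"
    "path_homotopic X (u \<circ> circ) (join_path (f \<circ> circ) (g \<circ> circ))"
    "\<alpha> \<otimes>\<^bsub>pi1_group X x\<^esub> \<beta> = htpy_class 1 X x u"
    using pi1_mult_representative[OF f(1) g(1)] f g by metis
  obtain v where v: "v \<in> based_maps 1 X x"
    "path_homotopic X (v \<circ> circ) (join_path (g \<circ> circ) (h \<circ> circ))"
    "\<beta> \<otimes>\<^bsub>pi1_group X x\<^esub> \<gamma> = htpy_class 1 X x v"
    using pi1_mult_representative[OF g(1) h(1)] g h by metis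
  obtain w where w: "w \<in> based_maps 1 X x"
    "path_homotopic X (w \<circ> circ) (join_path (u \<circ> circ) (h \<circ> circ))"
    "htpy_class 1 X x u \<otimes>\<^bsub>pi1_group X x\<^esub> \<gamma> = htpy_class 1 X x w"
    using pi1_mult_representative[OF u(1) h(1)] h by metis
  note w(2)
  also have "path_homotopic X (join_path (u \<circ> circ) (h \<circ> circ))
      (join_path (join_path (f \<circ> circ) (g \<circ> circ)) (h \<circ> circ))"
    by (rule path_homotopic_join[OF u(2)]) (use ends pathin_circ[OF u(1)] in \<open>auto intro: path_homotopic_refl\<close>)
  also have "path_homotopic X \<dots> (join_path (f \<circ> circ) (join_path (g \<circ> circ) (h \<circ> circ)))"
    by (rule path_homotopic_assoc) (use ends in auto)
  also have "path_homotopic X \<dots> (join_path (f \<circ> circ) (v \<circ> circ))"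
    by (rule path_homotopic_join[OF _ path_homotopic_sym[OF v(2)]])
      (use ends in \<open>auto intro: path_homotopic_refl\<close>)
  finally have "\<alpha> \<otimes>\<^bsub>pi1_group X x\<^esub> htpy_class 1 X x v = htpy_class 1 X x w"
    using pi1_mult_eq[OF f(1) v(1) w(1)] f by simp
  then show "\<alpha> \<otimes>\<^bsub>pi1_group X x\<^esub> \<beta> \<otimes>\<^bsub>pi1_group X x\<^esub> \<gamma> =
      \<alpha> \<otimes>\<^bsub>pi1_group X x\<^esub> (\<beta> \<otimes>\<^bsub>pi1_group X x\<^esub> \<gamma>)"
    using u(3) v(3) w(3) by simp
next
  fix \<alpha> assume "\<alpha> \<in> carrier (pi1_group X x)"
  then obtain f where f: "f \<in> based_maps 1 X x" "\<alpha> = htpy_class 1 X x f"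
    by (auto elim!: homotopy_setE)
  have "path_homotopic X (join_path ((\<lambda>_. x) \<circ> circ) (f \<circ> circ)) (f \<circ> circ)"
    using path_homotopic_const_left[of X "f \<circ> circ" x] pathin_circ[OF f(1)] by (simp add: o_def)
  then show "\<one>\<^bsub>pi1_group X x\<^esub> \<otimes>\<^bsub>pi1_group X x\<^esub> \<alpha> = \<alpha>"
    using pi1_mult_eq[of "\<lambda>_. x" X x f f] x f by (simp add: pi1_one path_homotopic_sym const_in_based_maps)
  obtain g where g: "g \<in> based_maps 1 X x" "path_homotopic X (g \<circ> circ) (reverse_path (f \<circ> circ))"
    using loop_representative[of X "reverse_path (f \<circ> circ)" x] pathin_circ[OF f(1)] pathin_reverse_path
    by auto
  have "path_homotopic X (join_path (g \<circ> circ) (f \<circ> circ)) (join_path (reverse_path (f \<circ> circ)) (f \<circ> circ))"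
    by (rule path_homotopic_join[OF g(2)])
      (use pathin_circ[OF f(1)] pathin_circ[OF g(1)] in \<open>auto intro: path_homotopic_refl\<close>)
  also have "path_homotopic X \<dots> (\<lambda>_. x)"
    by (rule path_homotopic_inverse_left) (use pathin_circ[OF f(1)] in auto)
  finally have "htpy_class 1 X x g \<otimes>\<^bsub>pi1_group X x\<^esub> \<alpha> = \<one>\<^bsub>pi1_group X x\<^esub>"
    using pi1_mult_eq[OF g(1) f(1), of "\<lambda>_. x"] x f by (simp add: pi1_one path_homotopic_sym const_in_based_maps o_def)
  then show "\<exists>\<beta>\<in>carrier (pi1_group X x). \<beta> \<otimes>\<^bsub>pi1_group X x\<^esub> \<alpha> = \<one>\<^bsub>pi1_group X x\<^esub>"
    using g(1) by auto
qed

section \<open>The action of the fundamental group\<close>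

lemma pi1_action_eq:
  assumes s: "s \<in> based_maps 1 X x" and tr: "transport l X (s \<circ> circ) g f"
  shows "pi1_action l X x (htpy_class 1 X x s) (htpy_class l X x f) = htpy_class l X x g"
proof -
  have f: "f \<in> based_maps l X x"
    using based_maps_transport(2)[OF tr] pathin_circ[OF s] by simp
  have "change_basepoint l X (s' \<circ> circ) (htpy_class l X x f) = htpy_class l X x g"
    if s': "s' \<in> htpy_class 1 X x s" for s'
  proof -
    have "path_homotopic X (s \<circ> circ) (s' \<circ> circ)"
      using path_homotopic_circ_iff[OF s htpy_class_mem(1)[OF s']] s' by (simp add: mem_htpy_class)
    then have "transport l X (s' \<circ> circ) g f"
      using tr by (rule transport_path_cong)
    from change_basepoint_eq[OF this, of x] show ?thesis
      using pathin_circ[OF htpy_class_mem(1)[OF s']] by simp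
  qed
  then show ?thesis
    using mem_htpy_class_self[OF s] htpy_class_in_homotopy_set[OF f]
    by (auto simp: pi1_action_def)
qed

lemma pi1_action_representative:
  assumes s: "s \<in> based_maps 1 X x" and f: "f \<in> based_maps l X x"
  obtains g where "g \<in> based_maps l X x" "transport l X (s \<circ> circ) g f"
    "pi1_action l X x (htpy_class 1 X x s) (htpy_class l X x f) = htpy_class l X x g"
proof -
  obtain g where g: "transport l X (s \<circ> circ) g f"
    using transport_exists[of l X f "s \<circ> circ"] f pathin_circ[OF s] by (auto simp: based_maps_def)
  then show thesis
    using that pi1_action_eq[OF s g] based_maps_transport(1)[OF g] pathin_circ[OF s] by simp
qed

lemma pi1_action_group_action:
  assumes x: "x \<in> topspace X"
  shows "group_action (pi1_group X x) (homotopy_set l X x) (pi1_action l X x)"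
proof -
  let ?G = "pi1_group X x" and ?E = "homotopy_set l X x" and ?a = "pi1_action l X x"
  interpret G: group ?G
    using x by (rule pi1_group_is_group)
  have closed: "?a \<sigma> \<alpha> \<in> ?E" if "\<sigma> \<in> carrier ?G" "\<alpha> \<in> ?E" for \<sigma> \<alpha>
    using that by (auto elim!: homotopy_setE) (metis pi1_action_representative htpy_class_in_homotopy_set)
  have one: "?a \<one>\<^bsub>?G\<^esub> \<alpha> = \<alpha>" if "\<alpha> \<in> ?E" for \<alpha>
    using that x
    by (auto elim!: homotopy_setE simp: pi1_one o_def intro!: pi1_action_eq transport_refl)
  have mult: "?a (\<sigma> \<otimes>\<^bsub>?G\<^esub> \<tau>) \<alpha> = ?a \<sigma> (?a \<tau> \<alpha>)"
    if "\<sigma> \<in> carrier ?G" "\<tau> \<in> carrier ?G" "\<alpha> \<in> ?E" for \<sigma> \<tau> \<alpha>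
  proof -
    obtain s t f where s: "s \<in> based_maps 1 X x" "\<sigma> = htpy_class 1 X x s"
      and t: "t \<in> based_maps 1 X x" "\<tau> = htpy_class 1 X x t"
      and f: "f \<in> based_maps l X x" "\<alpha> = htpy_class l X x f"
      using \<open>\<sigma> \<in> carrier ?G\<close> \<open>\<tau> \<in> carrier ?G\<close> \<open>\<alpha> \<in> ?E\<close> by (auto elim!: homotopy_setE)
    obtain u where u: "u \<in> based_maps 1 X x"
      "path_homotopic X (u \<circ> circ) (join_path (s \<circ> circ) (t \<circ> circ))"
      "\<sigma> \<otimes>\<^bsub>?G\<^esub> \<tau> = htpy_class 1 X x u"
      using pi1_mult_representative[OF s(1) t(1)] s t by metis
    obtain g where g: "g \<in> based_maps l X x" "transport l X (t \<circ> circ) g f" "?a \<tau> \<alpha> = htpy_class l X x g"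
      using pi1_action_representative[OF t(1) f(1)] t f by metis
    obtain h where h: "h \<in> based_maps l X x" "transport l X (s \<circ> circ) h g"
      "?a \<sigma> (htpy_class l X x g) = htpy_class l X x h"
      using pi1_action_representative[OF s(1) g(1)] s by metis
    have "transport l X (u \<circ> circ) h f"
      by (rule transport_path_cong[OF path_homotopic_sym[OF u(2)] transport_join[OF h(2) g(2)]])
    then show ?thesis
      using pi1_action_eq[OF u(1), of l h f] u(3) g(3) h(3) f(2) by simp
  qed
  have bij: "?a \<sigma> \<in> Bij ?E" if \<sigma>: "\<sigma> \<in> carrier ?G" for \<sigma>
  proof -
    have "bij_betw (?a \<sigma>) ?E ?E"
      by (rule bij_betw_byWitness[where f' = "?a (inv\<^bsub>?G\<^esub> \<sigma>)"])
        (use \<sigma> closed in \<open>auto simp: mult[symmetric] one simp del: pi1_carrier\<close>)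
    then show ?thesis
      by (simp add: Bij_def pi1_action_def)
  qed
  have "?a (\<sigma> \<otimes>\<^bsub>?G\<^esub> \<tau>) = compose ?E (?a \<sigma>) (?a \<tau>)"
    if "\<sigma> \<in> carrier ?G" "\<tau> \<in> carrier ?G" for \<sigma> \<tau>
    by (rule extensionalityI[of _ ?E])
      (use mult[OF that] in \<open>auto simp: compose_def pi1_action_def[of _ _ _ "_ \<otimes>\<^bsub>_\<^esub> _"]\<close>)
  then have "?a \<in> hom ?G (BijGroup ?E)"
    by (auto simp: hom_def BijGroup_def bij simp del: pi1_carrier)
  then show ?thesis
    unfolding group_action_def group_hom_def group_hom_axioms_def
    using G.is_group group_BijGroup by blast
qed

lemma pi1_action_conj:
  assumes x: "x \<in> topspace X" and "\<sigma> \<in> carrier (pi1_group X x)" "\<alpha> \<in> homotopy_set 1 X x"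
  shows "pi1_action 1 X x \<sigma> \<alpha> =
     \<sigma> \<otimes>\<^bsub>pi1_group X x\<^esub> \<alpha> \<otimes>\<^bsub>pi1_group X x\<^esub> inv\<^bsub>pi1_group X x\<^esub> \<sigma>"
proof -
  interpret G: group "pi1_group X x"
    using x by (rule pi1_group_is_group)
  obtain s f where s: "s \<in> based_maps 1 X x" "\<sigma> = htpy_class 1 X x s"
    and f: "f \<in> based_maps 1 X x" "\<alpha> = htpy_class 1 X x f"
    using assms by (auto elim!: homotopy_setE)
  note ends = pathin_circ[OF s(1)] pathin_circ[OF f(1)]
  obtain g where g: "g \<in> based_maps 1 X x" "transport 1 X (s \<circ> circ) g f"
    "pi1_action 1 X x \<sigma> \<alpha> = htpy_class 1 X x g"
    using pi1_action_representative[OF s(1) f(1)] s f by metis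
  \<comment> \<open>It suffices to show \<open>g s = s f\<close> in the group; no representative of the inverse enters.\<close>
  have "path_homotopic X (join_path (g \<circ> circ) (s \<circ> circ))
     (join_path (join_path (s \<circ> circ) (join_path (f \<circ> circ) (reverse_path (s \<circ> circ)))) (s \<circ> circ))"
    by (rule path_homotopic_join[OF transport_circ[OF g(2)]])
      (use ends pathin_circ[OF g(1)] in \<open>auto intro: path_homotopic_refl\<close>)
  also have "path_homotopic X \<dots>
     (join_path (s \<circ> circ) (join_path (join_path (f \<circ> circ) (reverse_path (s \<circ> circ))) (s \<circ> circ)))"
    by (rule path_homotopic_assoc) (use ends in \<open>auto intro!: pathin_join_path pathin_reverse_path\<close>)
  also have "path_homotopic X \<dots>
     (join_path (s \<circ> circ) (f \<circ> circ))"
  proof (rule path_homotopic_join)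
    have "path_homotopic X (join_path (join_path (f \<circ> circ) (reverse_path (s \<circ> circ))) (s \<circ> circ))
        (join_path (f \<circ> circ) (join_path (reverse_path (s \<circ> circ)) (s \<circ> circ)))"
      by (rule path_homotopic_assoc) (use ends in \<open>auto intro!: pathin_reverse_path\<close>)
    also have "path_homotopic X \<dots> (join_path (f \<circ> circ) (\<lambda>_. x))"
      by (rule path_homotopic_join)
        (use ends in \<open>auto intro!: path_homotopic_refl path_homotopic_inverse_left\<close>)
    also have "path_homotopic X \<dots> (f \<circ> circ)"
      by (rule path_homotopic_const_right) (use ends in auto)
    finally show "path_homotopic X (join_path (join_path (f \<circ> circ) (reverse_path (s \<circ> circ))) (s \<circ> circ)) (f \<circ> circ)" .
  qed (use ends in \<open>auto intro: path_homotopic_refl\<close>)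
  finally have gs: "path_homotopic X (join_path (g \<circ> circ) (s \<circ> circ)) (join_path (s \<circ> circ) (f \<circ> circ))" .
  obtain u where u: "u \<in> based_maps 1 X x"
    "path_homotopic X (u \<circ> circ) (join_path (g \<circ> circ) (s \<circ> circ))"
    "htpy_class 1 X x g \<otimes>\<^bsub>pi1_group X x\<^esub> \<sigma> = htpy_class 1 X x u"
    using pi1_mult_representative[OF g(1) s(1)] s by metis
  have "\<sigma> \<otimes>\<^bsub>pi1_group X x\<^esub> \<alpha> = htpy_class 1 X x g \<otimes>\<^bsub>pi1_group X x\<^esub> \<sigma>"
    using pi1_mult_eq[OF s(1) f(1) u(1) path_homotopic_trans[OF u(2) gs]] s f u by simp
  moreover have "htpy_class 1 X x g \<in> carrier (pi1_group X x)"
    using g(1) by auto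
  ultimately show ?thesis
    using assms(2) g(3) by (simp add: G.m_assoc del: pi1_carrier)
qed

section \<open>Ordered configurations of little intervals\<close>

lemma affine_embedding_iff:
  "affine_embedding f \<longleftrightarrow>
     (\<forall>x. f x = f 0 + (f 1 - f 0) * x) \<and> 0 \<le> f 0 \<and> f 0 < f 1 \<and> f 1 \<le> 1"
proof
  assume "affine_embedding f"
  then obtain a b where ab: "b > 0" "f = (\<lambda>x. a + b * x)" and im: "f ` {0..1} \<subseteq> {0..1}"
    unfolding affine_embedding_def by blast
  have "0 \<in> {0..1::real}" "1 \<in> {0..1::real}"
    by auto
  then have "f 0 \<in> {0..1}" "f 1 \<in> {0..1}"
    using im by blast+
  then show "(\<forall>x. f x = f 0 + (f 1 - f 0) * x) \<and> 0 \<le> f 0 \<and> f 0 < f 1 \<and> f 1 \<le> 1"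
    using ab by auto
next
  assume R: "(\<forall>x. f x = f 0 + (f 1 - f 0) * x) \<and> 0 \<le> f 0 \<and> f 0 < f 1 \<and> f 1 \<le> 1"
  then have b: "0 \<le> f 0" "f 0 < f 1" "f 1 \<le> 1"
    by blast+
  have "f x \<in> {0..1}" if "x \<in> {0..1}" for x
  proof -
    have "f x = f 0 + (f 1 - f 0) * x"
      using R by blast
    moreover have "0 \<le> (f 1 - f 0) * x"
      using b that by auto
    moreover have "(f 1 - f 0) * x \<le> f 1 - f 0"
      using b that by (intro mult_left_le) auto
    ultimately have "0 \<le> f x \<and> f x \<le> 1"
      using b by linarith
    then show ?thesis
      by simp
  qed
  moreover have "f 1 - f 0 > 0"
    using b by simp
  moreover have "f = (\<lambda>x. f 0 + (f 1 - f 0) * x)"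
    by (rule ext) (use R in blast)
  ultimately show "affine_embedding f"
    unfolding affine_embedding_def by blast
qed

lemma affine_embedding_bounds:
  assumes "affine_embedding f" "0 \<le> x" "x \<le> 1"
  shows "f 0 \<le> f x" "f x \<le> f 1"
proof -
  have f: "f x = f 0 + (f 1 - f 0) * x" "f 0 < f 1"
    using assms(1) unfolding affine_embedding_iff by blast+
  have "0 \<le> (f 1 - f 0) * x"
    using f assms by auto
  then show "f 0 \<le> f x"
    using f(1) by linarith
  have "(f 1 - f 0) * x \<le> f 1 - f 0"
    using f(2) assms(3) by (intro mult_left_le) auto
  then show "f x \<le> f 1"
    using f(1) by linarith
qed

lemma affine_embedding_compose:
  assumes f: "affine_embedding f" and g: "affine_embedding g"
  shows "affine_embedding (f \<circ> g)"
proof -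
  have f': "f x = f 0 + (f 1 - f 0) * x" for x
    using f unfolding affine_embedding_iff by blast
  have g': "g x = g 0 + (g 1 - g 0) * x" for x
    using g unfolding affine_embedding_iff by blast
  have b: "0 \<le> f 0" "f 0 < f 1" "f 1 \<le> 1" "0 \<le> g 0" "g 0 < g 1" "g 1 \<le> 1"
    using f g unfolding affine_embedding_iff by blast+
  have "f (g x) = f (g 0) + (f (g 1) - f (g 0)) * x" for x
  proof -
    have "f (g x) = f 0 + (f 1 - f 0) * (g 0 + (g 1 - g 0) * x)"
      by (subst f'[of "g x"], subst g'[of x]) (rule refl)
    then show ?thesis
      unfolding f'[of "g 0"] f'[of "g 1"] by (simp add: algebra_simps)
  qed
  moreover have "0 \<le> f (g 0)" "f (g 1) \<le> 1"
    using affine_embedding_bounds[OF f, of "g 0"] affine_embedding_bounds[OF f, of "g 1"] b by auto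
  moreover have "f (g 0) < f (g 1)"
    using f'[of "g 0"] f'[of "g 1"] b by simp
  ultimately show ?thesis
    unfolding affine_embedding_iff o_apply by blast
qed

text \<open>
  The intervals are listed from left to right.  Such configurations form a convex set around the
  standard configuration, which is closed under composition.
\<close>

definition ordered_configs :: "nat \<Rightarrow> (real \<Rightarrow> real) list set" where
  "ordered_configs k = {c. length c = k \<and> (\<forall>f\<in>set c. affine_embedding f) \<and>
     sorted_wrt (\<lambda>f g. f 1 \<le> g 0) c}"

lemma ordered_configs_length: "c \<in> ordered_configs k \<Longrightarrow> length c = k"
  by (simp add: ordered_configs_def)

lemma ordered_configs_affine: "c \<in> ordered_configs k \<Longrightarrow> i < k \<Longrightarrow> affine_embedding (c ! i)"
  by (auto simp: ordered_configs_def)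

lemma ordered_configs_subset: "ordered_configs k \<subseteq> little_intervals_set k"
proof
  fix c assume c: "c \<in> ordered_configs k"
  have im: "(c ! i) ` {0..1} \<subseteq> {(c ! i) 0..(c ! i) 1}" if "i < k" for i
    using affine_embedding_bounds[OF ordered_configs_affine[OF c that]] by auto
  have disj: "interior ((c ! i) ` {0..1}) \<inter> interior ((c ! j) ` {0..1}) = {}" if "i < j" "j < k" for i j
  proof -
    have "interior ((c ! i) ` {0..1}) \<subseteq> {(c ! i) 0<..<(c ! i) 1}"
      "interior ((c ! j) ` {0..1}) \<subseteq> {(c ! j) 0<..<(c ! j) 1}"
      using interior_mono[OF im] that by auto
    moreover have "(c ! i) 1 \<le> (c ! j) 0"
      using c that by (auto simp: ordered_configs_def sorted_wrt_iff_nth_less)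
    ultimately show ?thesis
      by fastforce
  qed
  show "c \<in> little_intervals_set k"
    unfolding little_intervals_set_def
    using c disj by (auto simp: ordered_configs_def) (metis Int_commute disjoint_iff nat_neq_iff)
qed

lemma std_config_ordered: "std_config k \<in> ordered_configs k"
proof -
  have "affine_embedding (\<lambda>x. (real i + x) / real k)" if "i < k" for i
    unfolding affine_embedding_iff using that by (auto simp: field_simps)
  moreover have "sorted_wrt (\<lambda>f g. f 1 \<le> g 0) (std_config k)"
    by (auto simp: std_config_def sorted_wrt_iff_nth_less intro!: divide_right_mono)
  ultimately show ?thesis
    by (auto simp: ordered_configs_def std_config_def)
qed

lemma length_std_config [simp]: "length (std_config k) = k"
  by (simp add: std_config_def)

lemma std_config_1: "std_config 1 = [id]"
  by (simp add: std_config_def id_def One_nat_def fun_eq_iff)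

lemma little_intervals_comp_Nil [simp]: "little_intervals_comp [] ds = []"
  by (simp add: little_intervals_comp_def)

lemma little_intervals_comp_Cons [simp]:
  "little_intervals_comp (f # c) (d # ds) = map ((\<circ>) f) d @ little_intervals_comp c ds"
  by (simp add: little_intervals_comp_def)

lemma little_intervals_comp_mem:
  assumes "h \<in> set (little_intervals_comp c ds)"
  shows "\<exists>f\<in>set c. \<exists>d\<in>set ds. \<exists>g\<in>set d. h = f \<circ> g"
proof -
  obtain f d g where "(f, d) \<in> set (zip c ds)" "g \<in> set d" "h = (\<lambda>x. f (g x))"
    using assms by (auto simp: little_intervals_comp_def o_def)
  then show ?thesis
    unfolding o_def using set_zip_leftD set_zip_rightD by fastforce
qed

lemma ordered_configs_comp:
  assumes "c \<in> ordered_configs (length ms)"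
    and "list_all2 (\<lambda>m d. d \<in> ordered_configs m) ms ds"
  shows "little_intervals_comp c ds \<in> ordered_configs (sum_list ms)"
  using assms(2,1)
proof (induction arbitrary: c rule: list_all2_induct)
  case Nil
  then show ?case
    by (simp add: ordered_configs_def)
next
  case (Cons m ms d ds)
  obtain f c' where c: "c = f # c'"
    using Cons.prems by (cases c) (auto simp: ordered_configs_def)
  have c': "c' \<in> ordered_configs (length ms)" and f: "affine_embedding f"
    and fc: "\<And>f'. f' \<in> set c' \<Longrightarrow> f 1 \<le> f' 0" "\<And>f'. f' \<in> set c' \<Longrightarrow> affine_embedding f'"
    using Cons.prems by (auto simp: c ordered_configs_def)
  have ds: "\<And>d' g. d' \<in> set ds \<Longrightarrow> g \<in> set d' \<Longrightarrow> affine_embedding g"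
    using Cons.hyps(2) unfolding list_all2_conv_all_nth ordered_configs_def
    by (metis (mono_tags, lifting) in_set_conv_nth[of _ ds] mem_Collect_eq)
  note IH = Cons.IH[OF c']
  have d: "length d = m" "\<And>g. g \<in> set d \<Longrightarrow> affine_embedding g" "sorted_wrt (\<lambda>f g. f 1 \<le> g 0) d"
    using Cons.hyps(1) by (auto simp: ordered_configs_def)
  have f_mono: "f x \<le> f y" if "x \<le> y" for x y
  proof -
    have "f x = f 0 + (f 1 - f 0) * x" "f y = f 0 + (f 1 - f 0) * y" "f 0 < f 1"
      using f unfolding affine_embedding_iff by blast+
    then show ?thesis
      using that by (simp add: mult_left_mono)
  qed
  have "sorted_wrt (\<lambda>g h. g 1 \<le> h 0) (map ((\<circ>) f) d)"
    using d(3) by (auto simp: sorted_wrt_map intro: f_mono elim!: sorted_wrt_mono_rel[rotated])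
  moreover have "g 1 \<le> h 0" if gh: "g \<in> set (map ((\<circ>) f) d)" "h \<in> set (little_intervals_comp c' ds)" for g h
  proof -
    obtain g' where g': "g = f \<circ> g'" "affine_embedding g'"
      using gh(1) d(2) by auto
    obtain f' h' where h': "h = f' \<circ> h'" "f' \<in> set c'" "affine_embedding h'"
      using little_intervals_comp_mem[OF gh(2)] ds by blast
    have "0 \<le> g' 0" "g' 0 < g' 1" "g' 1 \<le> 1" "0 \<le> h' 0" "h' 0 < h' 1" "h' 1 \<le> 1"
      using g'(2) h'(3) unfolding affine_embedding_iff by blast+
    then have "f (g' 1) \<le> f 1" "f' 0 \<le> f' (h' 0)"
      using f_mono affine_embedding_bounds(1)[OF fc(2)[OF h'(2)]] by auto
    then show ?thesis
      using fc(1)[OF h'(2)] by (simp add: g' h')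
  qed
  ultimately show ?case
    using IH d f by (auto simp: c ordered_configs_def sorted_wrt_append intro: affine_embedding_compose)
qed

definition config_segment ::
    "(real \<Rightarrow> real) list \<Rightarrow> (real \<Rightarrow> real) list \<Rightarrow> real \<Rightarrow> (real \<Rightarrow> real) list" where
  "config_segment u v t = map2 (\<lambda>f g x. (1 - t) * f x + t * g x) u v"

lemma config_segment_nth:
  "i < length u \<Longrightarrow> length v = length u \<Longrightarrow> (config_segment u v t ! i) x = (1 - t) * (u ! i) x + t * (v ! i) x"
  by (simp add: config_segment_def)

lemma ordered_configs_convex:
  assumes u: "u \<in> ordered_configs k" and v: "v \<in> ordered_configs k" and t: "t \<in> {0..1}"
  shows "config_segment u v t \<in> ordered_configs k"
proof -
  have len: "length u = k" "length v = k"
    using u v by (auto simp: ordered_configs_def)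
  note nth = config_segment_nth[of _ u v t, unfolded len, OF _ refl]
  have "affine_embedding (config_segment u v t ! i)" if i: "i < k" for i
  proof -
    have f: "(u ! i) x = (u ! i) 0 + ((u ! i) 1 - (u ! i) 0) * x"
      "0 \<le> (u ! i) 0" "(u ! i) 0 < (u ! i) 1" "(u ! i) 1 \<le> 1" for x
      using ordered_configs_affine[OF u i] unfolding affine_embedding_iff by blast+
    have g: "(v ! i) x = (v ! i) 0 + ((v ! i) 1 - (v ! i) 0) * x"
      "0 \<le> (v ! i) 0" "(v ! i) 0 < (v ! i) 1" "(v ! i) 1 \<le> 1" for x
      using ordered_configs_affine[OF v i] unfolding affine_embedding_iff by blast+
    show ?thesis
      unfolding affine_embedding_iff nth[OF i]
    proof (intro conjI allI)
      fix x
      show "(1 - t) * (u ! i) x + t * (v ! i) x = (1 - t) * (u ! i) 0 + t * (v ! i) 0 +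
          ((1 - t) * (u ! i) 1 + t * (v ! i) 1 - ((1 - t) * (u ! i) 0 + t * (v ! i) 0)) * x"
        by (subst f(1)[of x], subst g(1)[of x]) (simp add: algebra_simps)
      show "0 \<le> (1 - t) * (u ! i) 0 + t * (v ! i) 0"
        using t f(2-4) g(2-4) by auto
      show "(1 - t) * (u ! i) 1 + t * (v ! i) 1 \<le> 1"
        by (rule convex_bound_le) (use t f(2-4) g(2-4) in auto)
      show "(1 - t) * (u ! i) 0 + t * (v ! i) 0 < (1 - t) * (u ! i) 1 + t * (v ! i) 1"
      proof (cases "t = 0")
        case False
        then show ?thesis
          using t f(3) g(3) by (intro add_le_less_mono mult_left_mono mult_strict_left_mono) auto
      qed (use f(2-4) in auto)
    qed
  qed
  moreover have "(config_segment u v t ! i) 1 \<le> (config_segment u v t ! j) 0" if "i < j" "j < k" for i j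
  proof -
    have "(u ! i) 1 \<le> (u ! j) 0" "(v ! i) 1 \<le> (v ! j) 0"
      using u v that by (auto simp: ordered_configs_def sorted_wrt_iff_nth_less)
    then show ?thesis
      using that t by (auto simp: nth intro!: add_mono mult_left_mono)
  qed
  moreover have "length (config_segment u v t) = k"
    by (simp add: config_segment_def len)
  ultimately show ?thesis
    by (auto simp: ordered_configs_def sorted_wrt_iff_nth_less in_set_conv_nth)
qed

definition ordered_config_space :: "nat \<Rightarrow> (real \<Rightarrow> real) list topology" where
  "ordered_config_space k = subtopology (little_intervals_space k) (ordered_configs k)"

lemma topspace_little_intervals_space: "topspace (little_intervals_space k) = little_intervals_set k"
  by (auto simp: little_intervals_space_def topspace_pullback_topology)

lemma topspace_ordered_config_space: "topspace (ordered_config_space k) = ordered_configs k"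
  using ordered_configs_subset by (auto simp: ordered_config_space_def topspace_little_intervals_space)

lemma continuous_map_into_ordered_config_space:
  assumes u: "\<And>z. z \<in> topspace Z \<Longrightarrow> u z \<in> ordered_configs k"
    and "\<And>i. i < k \<Longrightarrow> continuous_map Z euclideanreal (\<lambda>z. (u z ! i) 0)"
    and "\<And>i. i < k \<Longrightarrow> continuous_map Z euclideanreal (\<lambda>z. (u z ! i) 1)"
  shows "continuous_map Z (ordered_config_space k) u"
  unfolding ordered_config_space_def little_intervals_space_def
proof (intro continuous_map_into_subtopology continuous_map_pullback')
  show "continuous_map Z (product_topology (\<lambda>_. euclidean) {..<k})
     ((\<lambda>c. \<lambda>i\<in>{..<k}. ((c ! i) 0, (c ! i) 1)) \<circ> u)"
    using assms(2,3)
    by (auto simp: continuous_map_componentwise o_def simp flip: prod_topology_euclidean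
        intro!: continuous_map_pairedI)
  show "topspace Z \<subseteq> u -` little_intervals_set k"
    using u ordered_configs_subset by blast
qed (use u in auto)

lemma continuous_map_config_endpoint:
  assumes i: "i < k"
  shows "continuous_map (ordered_config_space k) euclideanreal (\<lambda>c. (c ! i) 0)"
    and "continuous_map (ordered_config_space k) euclideanreal (\<lambda>c. (c ! i) 1)"
proof -
  have "continuous_map (ordered_config_space k) (prod_topology euclidean euclidean)
      ((\<lambda>x. x i) \<circ> (\<lambda>c. \<lambda>i\<in>{..<k}. ((c ! i) 0, (c ! i) 1)))"
    unfolding ordered_config_space_def little_intervals_space_def prod_topology_euclidean
    by (intro continuous_map_from_subtopology continuous_map_pullback continuous_map_product_projection)
      (use i in auto)
  then have "continuous_map (ordered_config_space k) (prod_topology euclidean euclidean)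
      (\<lambda>c. ((c ! i) 0, (c ! i) 1))"
    using i by (simp add: o_def)
  then show "continuous_map (ordered_config_space k) euclideanreal (\<lambda>c. (c ! i) 0)"
    "continuous_map (ordered_config_space k) euclideanreal (\<lambda>c. (c ! i) 1)"
    unfolding continuous_map_paired by auto
qed

lemma config_family_endpoint:
  assumes "continuous_map Z (ordered_config_space k) u" "i < k"
  shows "continuous_map Z euclideanreal (\<lambda>z. (u z ! i) 0)"
    and "continuous_map Z euclideanreal (\<lambda>z. (u z ! i) 1)"
  using continuous_map_compose[OF assms(1) continuous_map_config_endpoint(1)[OF assms(2)]]
    continuous_map_compose[OF assms(1) continuous_map_config_endpoint(2)[OF assms(2)]]
  by (auto simp: o_def)

lemma continuous_map_config_segment:
  assumes u: "continuous_map Z (ordered_config_space k) u"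
    and v: "continuous_map Z (ordered_config_space k) v"
    and t: "continuous_map Z unit_int t"
  shows "continuous_map Z (ordered_config_space k) (\<lambda>z. config_segment (u z) (v z) (t z))"
proof -
  have uv: "u z \<in> ordered_configs k" "v z \<in> ordered_configs k" "t z \<in> {0..1}" if "z \<in> topspace Z" for z
    using continuous_map_funspace[OF u] continuous_map_funspace[OF v] continuous_map_funspace[OF t] that
    by (auto simp: topspace_ordered_config_space)
  have t': "continuous_map Z euclideanreal t"
    using t by (rule continuous_map_into_fulltopology)
  have seg: "(config_segment (u z) (v z) (t z) ! i) x = (1 - t z) * (u z ! i) x + t z * (v z ! i) x"
    if "z \<in> topspace Z" "i < k" for z i x
    using uv(1,2)[OF that(1)] that(2) by (simp add: config_segment_nth ordered_configs_length)
  show ?thesis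
  proof (rule continuous_map_into_ordered_config_space)
    fix i assume i: "i < k"
    have "continuous_map Z euclideanreal (\<lambda>z. (1 - t z) * (u z ! i) 0 + t z * (v z ! i) 0)"
      by (intro continuous_intros t' config_family_endpoint[OF u i] config_family_endpoint[OF v i])
    then show "continuous_map Z euclideanreal (\<lambda>z. (config_segment (u z) (v z) (t z) ! i) 0)"
      by (rule continuous_map_eq) (simp add: seg i)
    have "continuous_map Z euclideanreal (\<lambda>z. (1 - t z) * (u z ! i) 1 + t z * (v z ! i) 1)"
      by (intro continuous_intros t' config_family_endpoint[OF u i] config_family_endpoint[OF v i])
    then show "continuous_map Z euclideanreal (\<lambda>z. (config_segment (u z) (v z) (t z) ! i) 1)"
      by (rule continuous_map_eq) (simp add: seg i)
  qed (use uv ordered_configs_convex in auto)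
qed

lemma config_segment_ends:
  assumes "length u = length v"
  shows "config_segment u v 0 = u" "config_segment u v 1 = v"
  using assms by (auto simp: config_segment_def intro!: nth_equalityI)

lemma config_segment_same: "config_segment u u t = u"
  by (auto simp: config_segment_def algebra_simps intro!: nth_equalityI)

lemma pathin_config_segment:
  assumes "u \<in> ordered_configs k" "v \<in> ordered_configs k"
  shows "pathin (ordered_config_space k) (config_segment u v)"
  unfolding pathin_def
  using continuous_map_config_segment[of unit_int k "\<lambda>_. u" "\<lambda>_. v" "\<lambda>t. t"] assms
  by (simp add: topspace_ordered_config_space)

text \<open>The space of ordered configurations is convex, so two paths in it with the same ends are homotopic.\<close>

lemma path_homotopic_ordered_config_space:
  assumes U: "pathin (ordered_config_space k) U" and V: "pathin (ordered_config_space k) V"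
    and ends: "U 0 = V 0" "U 1 = V 1"
  shows "path_homotopic (ordered_config_space k) U V"
proof (rule path_homotopicI)
  let ?P = "prod_topology unit_int unit_int"
  show "continuous_map ?P (ordered_config_space k) (\<lambda>x. config_segment (U (snd x)) (V (snd x)) (fst x))"
    using U V unfolding pathin_def
    by (intro continuous_map_config_segment continuous_map_fst
        continuous_map_compose[OF continuous_map_snd, unfolded o_def])
  have "length (U s) = k" "length (V s) = k" if "s \<in> {0..1}" for s
    using path_image_subset_topspace[OF U] path_image_subset_topspace[OF V] that
    by (auto simp: topspace_ordered_config_space Pi_iff ordered_configs_length)
  then show "config_segment (U (snd (0, s))) (V (snd (0, s))) (fst (0, s)) = U s"
    "config_segment (U (snd (1, s))) (V (snd (1, s))) (fst (1, s)) = V s" if "s \<in> {0..1}" for s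
    using that by (simp_all add: config_segment_ends)
qed (simp_all add: ends config_segment_same)

lemma continuous_map_ordered_config_little_intervals0:
  "continuous_map (ordered_config_space k) (ospace little_intervals0 k) (\<lambda>c. c)"
proof -
  have "c \<in> path_component_of_set (little_intervals_space k) (std_config k)" if c: "c \<in> ordered_configs k" for c
  proof -
    have "pathin (little_intervals_space k) (config_segment (std_config k) c)"
      using pathin_config_segment[OF std_config_ordered c]
      unfolding ordered_config_space_def pathin_subtopology by blast
    then show ?thesis
      using config_segment_ends[of "std_config k" c] ordered_configs_length[OF c]
      by (auto simp: path_component_of_def)
  qed
  then show ?thesis
    unfolding ordered_config_space_def little_intervals0_def operad_data.simps
    by (intro continuous_map_into_subtopology continuous_map_from_subtopology)
      (auto simp: topspace_little_intervals_space)
qed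

lemma oelem_little_intervals0: "c \<in> ordered_configs k \<Longrightarrow> oelem little_intervals0 k c"
  using continuous_map_funspace[OF continuous_map_ordered_config_little_intervals0]
  by (auto simp: oelem_def topspace_ordered_config_space)

text \<open>
  Which interval of \<open>c\<close> and which interval of the \<open>d\<^sub>j\<close> the \<open>i\<close>-th interval of the composite
  consists of depends on the arities only, so end points of composites vary continuously.
\<close>

lemma little_intervals_comp_nth:
  assumes "i < sum_list ms"
  obtains j r where "j < length ms" "r < ms ! j"
    "\<And>c ds. length c = length ms \<Longrightarrow> map length ds = ms \<Longrightarrow>
       little_intervals_comp c ds ! i = (c ! j) \<circ> (ds ! j ! r)"
proof -
  have "\<exists>j r. j < length ms \<and> r < ms ! j \<and>
    (\<forall>c ds. length c = length ms \<longrightarrow> map length ds = ms \<longrightarrow>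
       little_intervals_comp c ds ! i = (c ! j) \<circ> (ds ! j ! r))"
    using assms
  proof (induction ms arbitrary: i)
    case (Cons m ms)
    show ?case
    proof (cases "i < m")
      case True
      then show ?thesis
        by (intro exI[of _ 0] exI[of _ i]) (auto simp: length_Suc_conv nth_append Cons_eq_map_conv)
    next
      case False
      then have "i - m < sum_list ms"
        using Cons.prems by auto
      then obtain j r where jr: "j < length ms" "r < ms ! j"
        "\<And>c ds. length c = length ms \<Longrightarrow> map length ds = ms \<Longrightarrow>
           little_intervals_comp c ds ! (i - m) = (c ! j) \<circ> (ds ! j ! r)"
        using Cons.IH[of "i - m"] by blast
      show ?thesis
        by (rule exI[of _ "Suc j"], rule exI[of _ r])
          (use jr False in \<open>auto simp: length_Suc_conv nth_append\<close>)
    qed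
  qed simp
  then show thesis
    using that by blast
qed

lemma continuous_map_little_intervals_comp:
  assumes u: "continuous_map Z (ordered_config_space (length ms)) u"
    and vs: "list_all2 (\<lambda>m v. continuous_map Z (ordered_config_space m) v) ms vs"
  shows "continuous_map Z (ordered_config_space (sum_list ms))
           (\<lambda>z. little_intervals_comp (u z) (map (\<lambda>v. v z) vs))"
proof -
  have uz: "u z \<in> ordered_configs (length ms)" if "z \<in> topspace Z" for z
    using continuous_map_funspace[OF u] that by (auto simp: topspace_ordered_config_space)
  have vz: "list_all2 (\<lambda>m d. d \<in> ordered_configs m) ms (map (\<lambda>v. v z) vs)" if "z \<in> topspace Z" for z
    using vs that continuous_map_funspace
    by (fastforce simp: list_all2_conv_all_nth topspace_ordered_config_space)
  have len: "map length (map (\<lambda>v. v z) vs) = ms" if "z \<in> topspace Z" for z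
    using vz[OF that] by (auto simp: list_all2_conv_all_nth ordered_configs_length intro!: nth_equalityI)
  have lvs: "length vs = length ms"
    using vs by (simp add: list_all2_lengthD)
  have cont: "continuous_map Z euclideanreal (\<lambda>z. (little_intervals_comp (u z) (map (\<lambda>v. v z) vs) ! i) x)"
    if i: "i < sum_list ms" and x: "x = 0 \<or> x = 1" for i x
  proof -
    obtain j r where jr: "j < length ms" "r < ms ! j"
      "\<And>c ds. length c = length ms \<Longrightarrow> map length ds = ms \<Longrightarrow>
         little_intervals_comp c ds ! i = (c ! j) \<circ> (ds ! j ! r)"
      using little_intervals_comp_nth[OF i] by blast
    have v: "continuous_map Z (ordered_config_space (ms ! j)) (vs ! j)"
      using vs jr(1) by (simp add: list_all2_conv_all_nth)
    have vx: "continuous_map Z euclideanreal (\<lambda>z. ((vs ! j) z ! r) x)"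
      using config_family_endpoint[OF v jr(2)] x by auto
    have "continuous_map Z euclideanreal
        (\<lambda>z. (u z ! j) 0 + ((u z ! j) 1 - (u z ! j) 0) * ((vs ! j) z ! r) x)"
      by (intro continuous_intros vx config_family_endpoint[OF u jr(1)])
    then show ?thesis
    proof (rule continuous_map_eq)
      fix z assume z: "z \<in> topspace Z"
      have entry: "little_intervals_comp (u z) (map (\<lambda>v. v z) vs) ! i = (u z ! j) \<circ> ((vs ! j) z ! r)"
        using jr(1) jr(3)[OF ordered_configs_length[OF uz[OF z]] len[OF z]] lvs by simp
      have affine: "(u z ! j) y = (u z ! j) 0 + ((u z ! j) 1 - (u z ! j) 0) * y" for y
        using ordered_configs_affine[OF uz[OF z] jr(1)] unfolding affine_embedding_iff by blast
      show "(u z ! j) 0 + ((u z ! j) 1 - (u z ! j) 0) * ((vs ! j) z ! r) x =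
          (little_intervals_comp (u z) (map (\<lambda>v. v z) vs) ! i) x"
        unfolding entry o_apply by (rule affine[symmetric])
    qed
  qed
  show ?thesis
    by (rule continuous_map_into_ordered_config_space)
      (use ordered_configs_comp[OF uz vz] cont in auto)
qed

lemma little_intervals_comp_append:
  "length c = length ds \<Longrightarrow>
     little_intervals_comp (c @ c') (ds @ ds') = little_intervals_comp c ds @ little_intervals_comp c' ds'"
  by (simp add: little_intervals_comp_def)

lemma little_intervals_comp_map_left:
  "little_intervals_comp (map ((\<circ>) f) d) es = map ((\<circ>) f) (little_intervals_comp d es)"
  by (simp add: little_intervals_comp_def map_concat zip_map1 o_def case_prod_beta comp_assoc)

lemma little_intervals_comp_assoc:
  assumes "length ds = length c" "list_all2 (\<lambda>d es. length es = length d) ds ess"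
  shows "little_intervals_comp (little_intervals_comp c ds) (concat ess) =
     little_intervals_comp c (map2 little_intervals_comp ds ess)"
  using assms(2,1)
proof (induction arbitrary: c rule: list_all2_induct)
  case (Cons d ds es ess)
  then obtain f c' where "c = f # c'" "length ds = length c'"
    by (cases c) auto
  then show ?case
    using Cons by (simp add: little_intervals_comp_append little_intervals_comp_map_left)
qed (simp add: little_intervals_comp_def)

lemma little_intervals_comp_unit_left: "little_intervals_comp (std_config 1) [d] = d"
  by (simp add: std_config_1 little_intervals_comp_def map_idI)

lemma little_intervals_comp_unit_right:
  "little_intervals_comp c (replicate (length c) (std_config 1)) = c"
  by (induction c) (simp_all add: std_config_1 del: id_apply)

section \<open>Pointwise composition in a topological operad\<close>

lemma topspace_kification: "topspace (kification X) = topspace X"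
proof -
  have "openin (kification X) (topspace X)"
    by (auto simp: openin_kification openin_subtopology)
  then show ?thesis
    by (meson openin_kification openin_subset openin_topspace subset_antisym)
qed

text \<open>
  Products of spaces carry the finer compactly generated topology.  Maps out of a compact space
  do not notice the difference, because they only see a compact part of the product.
\<close>

lemma continuous_map_into_kification:
  assumes Z: "compact_space Z" and f: "continuous_map Z X f"
  shows "continuous_map Z (kification X) f"
  unfolding continuous_map_def topspace_kification
proof (intro conjI allI impI)
  show "f \<in> topspace Z \<rightarrow> topspace X"
    using f by (rule continuous_map_funspace)
  fix U assume U: "openin (kification X) U"
  let ?K = "f ` topspace Z"
  have "compactin X ?K"
    using Z f by (simp add: compact_space_def image_compactin)
  then have "openin (subtopology X ?K) (?K \<inter> U)"
    using U by (simp add: openin_kification)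
  moreover have "continuous_map Z (subtopology X ?K) f"
    using f by (simp add: continuous_map_in_subtopology)
  ultimately have "openin Z {z \<in> topspace Z. f z \<in> ?K \<inter> U}"
    by (rule openin_continuous_map_preimage[rotated])
  moreover have "{z \<in> topspace Z. f z \<in> ?K \<inter> U} = {z \<in> topspace Z. f z \<in> U}"
    by auto
  ultimately show "openin Z {z \<in> topspace Z. f z \<in> U}"
    by simp
qed

lemma continuous_map_pointwise_comp:
  assumes \<C>: "topological_operad \<C>" and Z: "compact_space Z"
    and f: "continuous_map Z (ospace \<C> (length ms)) f"
    and gs: "list_all2 (\<lambda>m g. continuous_map Z (ospace \<C> m) g) ms gs"
  shows "continuous_map Z (ospace \<C> (sum_list ms)) (pointwise_comp \<C> ms f gs)"
proof -
  let ?P = "prod_topology (ospace \<C> (length ms)) (product_topology (\<lambda>i. ospace \<C> (ms ! i)) {..<length ms})"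
  let ?h = "\<lambda>z. (f z, \<lambda>i\<in>{..<length ms}. (gs ! i) z)"
  have "continuous_map Z ?P ?h"
    using f gs
    by (intro continuous_map_pairedI) (auto simp: continuous_map_componentwise list_all2_conv_all_nth)
  then have "continuous_map Z (kification ?P) ?h"
    by (rule continuous_map_into_kification[OF Z])
  moreover have "continuous_map (kification ?P) (ospace \<C> (sum_list ms))
      (\<lambda>(a, x). ocomp \<C> ms a (map x [0..<length ms]))"
    using \<C> unfolding topological_operad_def by blast
  ultimately have "continuous_map Z (ospace \<C> (sum_list ms))
      ((\<lambda>(a, x). ocomp \<C> ms a (map x [0..<length ms])) \<circ> ?h)"
    by (rule continuous_map_compose)
  moreover have "map (\<lambda>i\<in>{..<length ms}. (gs ! i) z) [0..<length ms] = map (\<lambda>g. g z) gs" for z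
    using gs by (auto simp: list_all2_lengthD[symmetric] intro!: nth_equalityI)
  ultimately show ?thesis
    by (simp add: o_def pointwise_comp_def[abs_def])
qed

lemma path_homotopic_pointwise_comp:
  assumes \<C>: "topological_operad \<C>"
    and p: "path_homotopic (ospace \<C> (length ms)) p q"
    and len: "length ps = length ms" "length qs = length ms"
    and ps: "\<And>i. i < length ms \<Longrightarrow> path_homotopic (ospace \<C> (ms ! i)) (ps ! i) (qs ! i)"
  shows "path_homotopic (ospace \<C> (sum_list ms)) (pointwise_comp \<C> ms p ps) (pointwise_comp \<C> ms q qs)"
proof -
  obtain H where H: "continuous_map (prod_topology unit_int unit_int) (ospace \<C> (length ms)) H"
    "\<And>s. H (0, s) = p s" "\<And>s. H (1, s) = q s"
    "\<And>t. t \<in> {0..1} \<Longrightarrow> H (t, 0) = p 0" "\<And>t. t \<in> {0..1} \<Longrightarrow> H (t, 1) = p 1"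
    using p by (rule path_homotopicE) blast
  have "\<forall>i. \<exists>K. i < length ms \<longrightarrow> continuous_map (prod_topology unit_int unit_int) (ospace \<C> (ms ! i)) K \<and>
    (\<forall>s. K (0, s) = (ps ! i) s) \<and> (\<forall>s. K (1, s) = (qs ! i) s) \<and>
    (\<forall>t\<in>{0..1}. K (t, 0) = (ps ! i) 0) \<and> (\<forall>t\<in>{0..1}. K (t, 1) = (ps ! i) 1)"
    using ps by (metis path_homotopicE)
  then obtain Ks where Ks: "\<And>i. i < length ms \<Longrightarrow>
    continuous_map (prod_topology unit_int unit_int) (ospace \<C> (ms ! i)) (Ks i) \<and>
    (\<forall>s. Ks i (0, s) = (ps ! i) s) \<and> (\<forall>s. Ks i (1, s) = (qs ! i) s) \<and>
    (\<forall>t\<in>{0..1}. Ks i (t, 0) = (ps ! i) 0) \<and> (\<forall>t\<in>{0..1}. Ks i (t, 1) = (ps ! i) 1)"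
    by metis
  let ?F = "pointwise_comp \<C> ms H (map Ks [0..<length ms])"
  have "continuous_map (prod_topology unit_int unit_int) (ospace \<C> (sum_list ms)) ?F"
    by (rule continuous_map_pointwise_comp[OF \<C> _ H(1)])
      (use Ks in \<open>auto simp: list_all2_conv_all_nth compact_space_subtopology compact_Times\<close>)
  then show ?thesis
  proof (rule path_homotopicI)
    fix s :: real assume "s \<in> {0..1}"
    have "map (\<lambda>g. g (0, s)) (map Ks [0..<length ms]) = map (\<lambda>g. g s) ps"
      "map (\<lambda>g. g (1, s)) (map Ks [0..<length ms]) = map (\<lambda>g. g s) qs"
      using Ks len by (auto intro!: nth_equalityI)
    then show "?F (0, s) = pointwise_comp \<C> ms p ps s" "?F (1, s) = pointwise_comp \<C> ms q qs s"
      by (simp_all add: pointwise_comp_def H(2,3) del: map_map)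
  next
    fix t :: real assume t: "t \<in> {0..1}"
    have "map (\<lambda>g. g (t, 0)) (map Ks [0..<length ms]) = map (\<lambda>g. g 0) ps"
      "map (\<lambda>g. g (t, 1)) (map Ks [0..<length ms]) = map (\<lambda>g. g 1) ps"
      using Ks len t by (auto intro!: nth_equalityI)
    then show "?F (t, 0) = pointwise_comp \<C> ms p ps 0" "?F (t, 1) = pointwise_comp \<C> ms p ps 1"
      by (simp_all add: pointwise_comp_def H(4,5)[OF t] del: map_map)
  qed
qed

text \<open>
  Free homotopies are composed pointwise, and their tracks are composed along with them.  Thus
  operad laws for points pass to homotopy classes, up to a comparison of tracks.
\<close>

lemma transport_pointwise_comp:
  assumes \<C>: "topological_operad \<C>"
    and f: "transport l (ospace \<C> (length ms)) p f' f"
    and len: "length ps = length ms" "length gs' = length ms" "length gs = length ms"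
    and gs: "\<And>i. i < length ms \<Longrightarrow> transport l (ospace \<C> (ms ! i)) (ps ! i) (gs' ! i) (gs ! i)"
  shows "transport l (ospace \<C> (sum_list ms)) (pointwise_comp \<C> ms p ps)
           (pointwise_comp \<C> ms f' gs') (pointwise_comp \<C> ms f gs)"
proof -
  obtain H where H: "continuous_map (prod_topology unit_int (nsphere l)) (ospace \<C> (length ms)) H"
    "\<And>z. z \<in> topspace (nsphere l) \<Longrightarrow> H (0, z) = f' z"
    "\<And>z. z \<in> topspace (nsphere l) \<Longrightarrow> H (1, z) = f z"
    "path_homotopic (ospace \<C> (length ms)) p (\<lambda>t. H (t, sphere_pt))"
    using f by (rule transportE) blast
  have "\<forall>i. \<exists>K. i < length ms \<longrightarrow> continuous_map (prod_topology unit_int (nsphere l)) (ospace \<C> (ms ! i)) K \<and>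
    (\<forall>z\<in>topspace (nsphere l). K (0, z) = (gs' ! i) z \<and> K (1, z) = (gs ! i) z) \<and>
    path_homotopic (ospace \<C> (ms ! i)) (ps ! i) (\<lambda>t. K (t, sphere_pt))"
    using gs unfolding transport_def by blast
  then obtain Ks where Ks: "\<And>i. i < length ms \<Longrightarrow>
    continuous_map (prod_topology unit_int (nsphere l)) (ospace \<C> (ms ! i)) (Ks i) \<and>
    (\<forall>z\<in>topspace (nsphere l). Ks i (0, z) = (gs' ! i) z \<and> Ks i (1, z) = (gs ! i) z) \<and>
    path_homotopic (ospace \<C> (ms ! i)) (ps ! i) (\<lambda>t. Ks i (t, sphere_pt))"
    by metis
  let ?F = "pointwise_comp \<C> ms H (map Ks [0..<length ms])"
  have "compact_space (prod_topology unit_int (nsphere l))"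
    by (simp add: compact_space_prod_topology compact_space_nsphere compact_space_subtopology)
  then have "continuous_map (prod_topology unit_int (nsphere l)) (ospace \<C> (sum_list ms)) ?F"
    by (rule continuous_map_pointwise_comp[OF \<C> _ H(1)])
      (use Ks in \<open>auto simp: list_all2_conv_all_nth\<close>)
  then show ?thesis
  proof (rule transportI)
    fix z assume z: "z \<in> topspace (nsphere l)"
    have "map (\<lambda>g. g (0, z)) (map Ks [0..<length ms]) = map (\<lambda>g. g z) gs'"
      "map (\<lambda>g. g (1, z)) (map Ks [0..<length ms]) = map (\<lambda>g. g z) gs"
      using Ks len z by (auto intro!: nth_equalityI)
    then show "?F (0, z) = pointwise_comp \<C> ms f' gs' z" "?F (1, z) = pointwise_comp \<C> ms f gs z"
      by (simp_all add: pointwise_comp_def H(2,3)[OF z] del: map_map)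
  next
    have "path_homotopic (ospace \<C> (sum_list ms)) (pointwise_comp \<C> ms p ps)
        (pointwise_comp \<C> ms (\<lambda>t. H (t, sphere_pt)) (map (\<lambda>i t. Ks i (t, sphere_pt)) [0..<length ms]))"
      by (rule path_homotopic_pointwise_comp[OF \<C> H(4)]) (use Ks len in auto)
    then show "path_homotopic (ospace \<C> (sum_list ms)) (pointwise_comp \<C> ms p ps) (\<lambda>t. ?F (t, sphere_pt))"
      by (simp add: pointwise_comp_def[abs_def] o_def)
  qed
qed

lemma ocomp_assoc:
  assumes "topological_operad \<C>" "oelem \<C> (length nss) a"
    "list_all2 (\<lambda>ns b. oelem \<C> (length ns) b) nss bs" "list_all2 (list_all2 (oelem \<C>)) nss css"
  shows "ocomp \<C> (concat nss) (ocomp \<C> (map length nss) a bs) (concat css) =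
    ocomp \<C> (map sum_list nss) a (map (\<lambda>i. ocomp \<C> (nss ! i) (bs ! i) (css ! i)) [0..<length nss])"
  using assms unfolding topological_operad_def by blast

lemma ocomp_unit_left: "topological_operad \<C> \<Longrightarrow> oelem \<C> n a \<Longrightarrow> ocomp \<C> [n] (ounit \<C>) [a] = a"
  and ocomp_unit_right: "topological_operad \<C> \<Longrightarrow> oelem \<C> n a \<Longrightarrow>
        ocomp \<C> (replicate n 1) a (replicate n (ounit \<C>)) = a"
  unfolding topological_operad_def by blast+

section \<open>Standard paths between configurations\<close>

lemma image_join_path: "(\<lambda>t. f (join_path p q t)) = join_path (\<lambda>t. f (p t)) (\<lambda>t. f (q t))"
  by (auto simp: join_path_def)

lemma join_path_cong:
  assumes "\<And>t. t \<in> {0..1} \<Longrightarrow> p t = p' t" "\<And>t. t \<in> {0..1} \<Longrightarrow> q t = q' t" "t \<in> {0..1}"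
  shows "join_path p q t = join_path p' q' t"
  using assms by (auto simp: join_path_def)

definition delta_config :: "nat list \<Rightarrow> real \<Rightarrow> (real \<Rightarrow> real) list" where
  "delta_config ms = config_segment (std_config (sum_list ms))
     (little_intervals_comp (std_config (length ms)) (map std_config ms))"

lemma std_config_comp_ordered:
  "little_intervals_comp (std_config (length ms)) (map std_config ms) \<in> ordered_configs (sum_list ms)"
  by (rule ordered_configs_comp) (auto simp: std_config_ordered list_all2_conv_all_nth)

lemma pathin_delta_config: "pathin (ordered_config_space (sum_list ms)) (delta_config ms)"
  unfolding delta_config_def by (rule pathin_config_segment[OF std_config_ordered std_config_comp_ordered])

lemma delta_config_ends [simp]:
  "delta_config ms 0 = std_config (sum_list ms)"
  "delta_config ms 1 = little_intervals_comp (std_config (length ms)) (map std_config ms)"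
  unfolding delta_config_def
  using config_segment_ends[of "std_config (sum_list ms)"
      "little_intervals_comp (std_config (length ms)) (map std_config ms)"]
    ordered_configs_length[OF std_config_comp_ordered, of ms] by auto

lemma delta_config_in: "t \<in> {0..1} \<Longrightarrow> delta_config ms t \<in> ordered_configs (sum_list ms)"
  using path_image_subset_topspace[OF pathin_delta_config, of ms]
  by (auto simp: topspace_ordered_config_space)

text \<open>
  The two bracketings of a twofold composition use different standard paths.  By associativity of the
  composition of configurations, both ways end at the same iterated composite of standard
  configurations, and they stay within the ordered configurations; hence they are homotopic.
\<close>

lemma delta_config_coherence:
  "path_homotopic (ordered_config_space (sum_list (concat nss)))
     (join_path (delta_config (concat nss))
       (\<lambda>t. little_intervals_comp (delta_config (map length nss) t) (map std_config (concat nss))))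
     (join_path (delta_config (map sum_list nss))
       (\<lambda>t. little_intervals_comp (std_config (length nss)) (map (\<lambda>ns. delta_config ns t) nss)))"
proof -
  have sum: "sum_list (map sum_list nss) = sum_list (concat nss)"
    by (induction nss) auto
  have len: "length (concat nss) = sum_list (map length nss)"
    by (simp add: length_concat)
  have "continuous_map unit_int (ordered_config_space (sum_list (concat nss)))
      (\<lambda>z. little_intervals_comp (delta_config (map length nss) z)
        (map (\<lambda>v. v z) (map (\<lambda>n _. std_config n) (concat nss))))"
    by (rule continuous_map_little_intervals_comp)
      (use pathin_delta_config[of "map length nss"] in
        \<open>auto simp: len pathin_def list_all2_conv_all_nth topspace_ordered_config_space std_config_ordered\<close>)
  then have 1: "pathin (ordered_config_space (sum_list (concat nss)))
      (\<lambda>t. little_intervals_comp (delta_config (map length nss) t) (map std_config (concat nss)))"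
    by (simp add: pathin_def o_def)
  have "continuous_map unit_int (ordered_config_space (sum_list (map sum_list nss)))
      (\<lambda>z. little_intervals_comp (std_config (length nss)) (map (\<lambda>v. v z) (map delta_config nss)))"
    by (rule continuous_map_little_intervals_comp)
      (use pathin_delta_config in
        \<open>auto simp: pathin_def list_all2_conv_all_nth topspace_ordered_config_space std_config_ordered\<close>)
  then have 2: "pathin (ordered_config_space (sum_list (concat nss)))
      (\<lambda>t. little_intervals_comp (std_config (length nss)) (map (\<lambda>ns. delta_config ns t) nss))"
    by (simp add: pathin_def o_def sum)
  have ends: "little_intervals_comp
        (little_intervals_comp (std_config (length nss)) (map (\<lambda>ns. std_config (length ns)) nss))
        (map std_config (concat nss)) =
      little_intervals_comp (std_config (length nss))
        (map (\<lambda>ns. little_intervals_comp (std_config (length ns)) (map std_config ns)) nss)"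
    using little_intervals_comp_assoc[of "map (\<lambda>ns. std_config (length ns)) nss" "std_config (length nss)"
        "map (map std_config) nss"]
    by (simp add: list_all2_conv_all_nth map_concat map2_map_map)
  show ?thesis
    by (rule path_homotopic_ordered_config_space)
      (use 1 2 pathin_delta_config[of "concat nss"] pathin_delta_config[of "map sum_list nss"] in
        \<open>auto simp: sum len ends o_def intro!: pathin_join_path\<close>)
qed

section \<open>An operad with a good basepoint\<close>

locale good_operad =
  fixes \<C> :: "'a operad_data" and \<eta> :: "nat \<Rightarrow> (real \<Rightarrow> real) list \<Rightarrow> 'a"
  assumes operad: "topological_operad \<C>" and good: "good_basepoint \<C> \<eta>"
begin

abbreviation maps :: "nat \<Rightarrow> nat \<Rightarrow> ((nat \<Rightarrow> real) \<Rightarrow> 'a) set" where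
  "maps l n \<equiv> based_maps l (ospace \<C> n) (basept \<eta> n)"

abbreviation cls :: "nat \<Rightarrow> nat \<Rightarrow> ((nat \<Rightarrow> real) \<Rightarrow> 'a) \<Rightarrow> ((nat \<Rightarrow> real) \<Rightarrow> 'a) set" where
  "cls l n \<equiv> htpy_class l (ospace \<C> n) (basept \<eta> n)"

abbreviation pi_set :: "nat \<Rightarrow> nat \<Rightarrow> ((nat \<Rightarrow> real) \<Rightarrow> 'a) set set" where
  "pi_set l n \<equiv> homotopy_set l (ospace \<C> n) (basept \<eta> n)"

lemma continuous_map_eta: "continuous_map (ordered_config_space n) (ospace \<C> n) (\<eta> n)"
proof -
  have "continuous_map (ospace little_intervals0 n) (ospace \<C> n) (\<eta> n)"
    using good by (simp add: good_basepoint_def operad_morphism_def)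
  from continuous_map_compose[OF continuous_map_ordered_config_little_intervals0 this]
  show ?thesis
    by (simp add: o_def)
qed

lemma eta_comp:
  assumes "c \<in> ordered_configs (length ms)" "list_all2 (\<lambda>m d. d \<in> ordered_configs m) ms ds"
  shows "\<eta> (sum_list ms) (little_intervals_comp c ds) = ocomp \<C> ms (\<eta> (length ms) c) (map2 \<eta> ms ds)"
proof -
  have "list_all2 (oelem little_intervals0) ms ds"
    using assms(2) by (auto elim!: list_all2_mono intro: oelem_little_intervals0)
  moreover have "oelem little_intervals0 (length ms) c"
    using assms(1) by (rule oelem_little_intervals0)
  ultimately show ?thesis
    using good by (auto simp: good_basepoint_def operad_morphism_def little_intervals0_def)
qed

lemma basept_in [simp]: "basept \<eta> n \<in> topspace (ospace \<C> n)"
  using continuous_map_funspace[OF continuous_map_eta, of n] std_config_ordered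
  by (auto simp: basept_def topspace_ordered_config_space)

lemma basept_1: "basept \<eta> 1 = ounit \<C>"
proof -
  have "\<eta> 1 (ounit little_intervals0) = ounit \<C>"
    using good unfolding good_basepoint_def operad_morphism_def by blast
  then show ?thesis
    by (simp add: basept_def std_config_1 little_intervals0_def)
qed

lemma delta_path_eq: "delta_path \<eta> ms = (\<lambda>t. \<eta> (sum_list ms) (delta_config ms t))"
  by (simp add: delta_path_def linear_path_def delta_config_def config_segment_def fun_eq_iff)

lemma pathin_delta_path: "pathin (ospace \<C> (sum_list ms)) (delta_path \<eta> ms)"
  using pathin_compose[OF pathin_delta_config continuous_map_eta]
  by (simp add: delta_path_eq o_def)

lemma map2_eta_std: "map2 \<eta> ms (map std_config ms) = map (basept \<eta>) ms"
  by (induction ms) (auto simp: basept_def)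

lemma delta_path_ends [simp]:
  "delta_path \<eta> ms 0 = basept \<eta> (sum_list ms)"
  "delta_path \<eta> ms 1 = ocomp \<C> ms (basept \<eta> (length ms)) (map (basept \<eta>) ms)"
proof -
  show "delta_path \<eta> ms 0 = basept \<eta> (sum_list ms)"
    by (simp add: delta_path_eq basept_def)
  have "list_all2 (\<lambda>m d. d \<in> ordered_configs m) ms (map std_config ms)"
    by (auto simp: list_all2_conv_all_nth std_config_ordered)
  then show "delta_path \<eta> ms 1 = ocomp \<C> ms (basept \<eta> (length ms)) (map (basept \<eta>) ms)"
    using eta_comp[OF std_config_ordered, of ms "map std_config ms"]
    by (simp add: delta_path_eq map2_eta_std basept_def)
qed

text \<open>
  The coherence of standard paths, carried into the operad by the morphism \<open>\<eta>\<close>.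
\<close>

lemma delta_path_coherence:
  "path_homotopic (ospace \<C> (sum_list (concat nss)))
     (join_path (delta_path \<eta> (concat nss))
       (pointwise_comp \<C> (concat nss) (delta_path \<eta> (map length nss)) (map (\<lambda>n _. basept \<eta> n) (concat nss))))
     (join_path (delta_path \<eta> (map sum_list nss))
       (pointwise_comp \<C> (map sum_list nss) (\<lambda>_. basept \<eta> (length nss)) (map (delta_path \<eta>) nss)))"
proof -
  have sum: "sum_list (map sum_list nss) = sum_list (concat nss)"
    by (induction nss) auto
  have len: "length (concat nss) = sum_list (map length nss)"
    by (simp add: length_concat)
  let ?A = "\<lambda>t. little_intervals_comp (delta_config (map length nss) t) (map std_config (concat nss))"
  let ?B = "\<lambda>t. little_intervals_comp (std_config (length nss)) (map (\<lambda>ns. delta_config ns t) nss)"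
  let ?M = "sum_list (concat nss)"
  have A: "\<eta> ?M (?A t) = pointwise_comp \<C> (concat nss) (delta_path \<eta> (map length nss))
      (map (\<lambda>n _. basept \<eta> n) (concat nss)) t" if "t \<in> {0..1}" for t
  proof -
    have "\<eta> ?M (?A t) = ocomp \<C> (concat nss) (\<eta> (length (concat nss)) (delta_config (map length nss) t))
        (map2 \<eta> (concat nss) (map std_config (concat nss)))"
      by (rule eta_comp)
        (use delta_config_in[OF that, of "map length nss"] in
          \<open>auto simp: len list_all2_conv_all_nth std_config_ordered\<close>)
    then show ?thesis
      by (simp add: map2_eta_std pointwise_comp_def o_def delta_path_eq len)
  qed
  have B: "\<eta> ?M (?B t) = pointwise_comp \<C> (map sum_list nss) (\<lambda>_. basept \<eta> (length nss))
      (map (delta_path \<eta>) nss) t" if "t \<in> {0..1}" for t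
  proof -
    have "\<eta> (sum_list (map sum_list nss)) (?B t) = ocomp \<C> (map sum_list nss)
        (\<eta> (length (map sum_list nss)) (std_config (length nss)))
        (map2 \<eta> (map sum_list nss) (map (\<lambda>ns. delta_config ns t) nss))"
      by (rule eta_comp)
        (use delta_config_in[OF that] in \<open>auto simp: list_all2_conv_all_nth std_config_ordered\<close>)
    then show ?thesis
      by (simp add: sum map2_map_map pointwise_comp_def o_def delta_path_eq basept_def)
  qed
  have "path_homotopic (ospace \<C> ?M)
      (\<lambda>t. \<eta> ?M (join_path (delta_config (concat nss)) ?A t))
      (\<lambda>t. \<eta> ?M (join_path (delta_config (map sum_list nss)) ?B t))"
    by (rule path_homotopic_image[OF delta_config_coherence continuous_map_eta])
  then have ph: "path_homotopic (ospace \<C> ?M)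
      (join_path (delta_path \<eta> (concat nss)) (\<lambda>t. \<eta> ?M (?A t)))
      (join_path (delta_path \<eta> (map sum_list nss)) (\<lambda>t. \<eta> ?M (?B t)))"
    unfolding image_join_path delta_path_eq sum .
  have "path_homotopic (ospace \<C> ?M)
      (join_path (delta_path \<eta> (concat nss)) (pointwise_comp \<C> (concat nss) (delta_path \<eta> (map length nss))
        (map (\<lambda>n _. basept \<eta> n) (concat nss))))
      (join_path (delta_path \<eta> (map sum_list nss)) (\<lambda>t. \<eta> ?M (?B t)))"
    by (rule path_homotopic_cong_left[OF ph]) (rule join_path_cong[OF refl A])
  from path_homotopic_cong_left[OF path_homotopic_sym[OF this] join_path_cong[OF refl B]]
  show ?thesis
    by (rule path_homotopic_sym)
qed

end

section \<open>Discrete operads\<close>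

lemma product_topology_discrete_topology:
  assumes "finite I"
  shows "product_topology (\<lambda>i. discrete_topology (A i)) I = discrete_topology (Pi\<^sub>E I A)"
proof -
  have "openin (product_topology (\<lambda>i. discrete_topology (A i)) I) {x}" if x: "x \<in> Pi\<^sub>E I A" for x
  proof -
    have "{x} = Pi\<^sub>E I (\<lambda>i. {x i})"
      using x PiE_singleton[of x I] by (auto simp: PiE_iff)
    moreover have "openin (product_topology (\<lambda>i. discrete_topology (A i)) I) (Pi\<^sub>E I (\<lambda>i. {x i}))"
      using x by (subst openin_PiE[OF assms]) (auto simp: PiE_iff)
    ultimately show ?thesis
      by simp
  qed
  then have "discrete_topology (Pi\<^sub>E I A) = product_topology (\<lambda>i. discrete_topology (A i)) I"
    by (simp add: discrete_topology_unique o_def)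
  then show ?thesis
    by (rule sym)
qed

lemma kification_discrete_topology: "kification (discrete_topology U) = discrete_topology U"
proof -
  have "openin (kification (discrete_topology U)) {x}" if "x \<in> U" for x
    using that by (auto simp: openin_kification)
  then have "discrete_topology U = kification (discrete_topology U)"
    by (simp add: discrete_topology_unique topspace_kification)
  then show ?thesis
    by (rule sym)
qed

lemma topological_operad_discreteI:
  assumes space: "\<And>n. ospace \<D> n = discrete_topology (A n)" and zero: "A 0 = {x}"
    and closed: "\<And>ms a bs. a \<in> A (length ms) \<Longrightarrow> list_all2 (\<lambda>m b. b \<in> A m) ms bs \<Longrightarrow>
        ocomp \<D> ms a bs \<in> A (sum_list ms)"
    and unit: "ounit \<D> \<in> A 1"
    and assoc: "\<And>nss a bs css. a \<in> A (length nss) \<Longrightarrow>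
        list_all2 (\<lambda>ns b. b \<in> A (length ns)) nss bs \<Longrightarrow>
        list_all2 (list_all2 (\<lambda>m c. c \<in> A m)) nss css \<Longrightarrow>
        ocomp \<D> (concat nss) (ocomp \<D> (map length nss) a bs) (concat css) =
        ocomp \<D> (map sum_list nss) a
          (map (\<lambda>i. ocomp \<D> (nss ! i) (bs ! i) (css ! i)) [0..<length nss])"
    and unit_left: "\<And>n a. a \<in> A n \<Longrightarrow> ocomp \<D> [n] (ounit \<D>) [a] = a"
    and unit_right: "\<And>n a. a \<in> A n \<Longrightarrow> ocomp \<D> (replicate n 1) a (replicate n (ounit \<D>)) = a"
  shows "topological_operad \<D>"
proof -
  have elem: "oelem \<D> n a \<longleftrightarrow> a \<in> A n" for n a
    by (simp add: oelem_def space)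
  have elem': "oelem \<D> = (\<lambda>n a. a \<in> A n)"
    by (simp add: elem fun_eq_iff)
  have cont: "continuous_map
        (kification (prod_topology (ospace \<D> (length ms))
           (product_topology (\<lambda>i. ospace \<D> (ms ! i)) {..<length ms})))
        (ospace \<D> (sum_list ms))
        (\<lambda>(a, x). ocomp \<D> ms a (map x [0..<length ms]))" for ms
  proof -
    have "ocomp \<D> ms a (map x [0..<length ms]) \<in> A (sum_list ms)"
      if "a \<in> A (length ms)" "x \<in> Pi\<^sub>E {..<length ms} (\<lambda>i. A (ms ! i))" for a x
      by (rule closed) (use that in \<open>auto simp: list_all2_conv_all_nth PiE_iff\<close>)
    then have "(\<lambda>(a, x). ocomp \<D> ms a (map x [0..<length ms]))
        \<in> A (length ms) \<times> Pi\<^sub>E {..<length ms} (\<lambda>i. A (ms ! i)) \<rightarrow> A (sum_list ms)"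
      by (intro funcsetI, elim SigmaE) simp
    then show ?thesis
      unfolding space product_topology_discrete_topology[OF finite_lessThan]
        prod_topology_discrete_topology[symmetric] kification_discrete_topology
      by simp
  qed
  show ?thesis
    unfolding topological_operad_def
  proof (intro conjI allI impI; (elim conjE)?)
    show "Hausdorff_space (ospace \<D> n)" "k_space (ospace \<D> n)" for n
      by (simp_all add: space k_space_discrete_topology)
    show "\<exists>x. topspace (ospace \<D> 0) = {x}"
      using zero by (simp add: space)
  qed (use cont unit assoc unit_left unit_right in \<open>simp_all add: elem elem'\<close>)
qed

section \<open>The operad structure on the homotopy groups\<close>

lemma transport_cong:
  assumes "transport l X p g f"
    and "\<And>z. z \<in> topspace (nsphere l) \<Longrightarrow> g z = g' z" "\<And>z. z \<in> topspace (nsphere l) \<Longrightarrow> f z = f' z"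
  shows "transport l X p g' f'"
  using assms unfolding transport_def by (metis (no_types, lifting))

lemma list_all2_concat:
  "list_all2 (list_all2 P) xss yss \<Longrightarrow> list_all2 P (concat xss) (concat yss)"
  by (induction rule: list_all2_induct) (auto intro: list_all2_appendI)

lemma concat_map2_map2:
  "list_all2 (\<lambda>xs ys. length xs = length ys) xss yss \<Longrightarrow>
     concat (map2 (map2 f) xss yss) = map2 f (concat xss) (concat yss)"
  by (induction rule: list_all2_induct) auto

context good_operad
begin

lemma class_list_representatives:
  assumes "list_all2 (\<lambda>m \<beta>. \<beta> \<in> pi_set l m) ms \<beta>s"
  obtains gs where "list_all2 (\<lambda>m g. g \<in> maps l m) ms gs" "\<beta>s = map2 (cls l) ms gs"
proof -
  have "\<exists>gs. list_all2 (\<lambda>m g. g \<in> maps l m) ms gs \<and> \<beta>s = map2 (cls l) ms gs"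
    using assms
  proof (induction rule: list_all2_induct)
    case (Cons m ms \<beta> \<beta>s)
    then obtain gs g where "list_all2 (\<lambda>m g. g \<in> maps l m) ms gs" "\<beta>s = map2 (cls l) ms gs"
      "g \<in> maps l m" "\<beta> = cls l m g"
      by (auto elim: homotopy_setE)
    then show ?case
      by (intro exI[of _ "g # gs"]) simp
  qed simp
  then show thesis
    using that by blast
qed

lemma class_list_list_representatives:
  assumes "list_all2 (list_all2 (\<lambda>m \<beta>. \<beta> \<in> pi_set l m)) nss \<beta>ss"
  obtains gss where "list_all2 (list_all2 (\<lambda>m g. g \<in> maps l m)) nss gss"
    "\<beta>ss = map2 (map2 (cls l)) nss gss"
proof -
  have "\<exists>gss. list_all2 (list_all2 (\<lambda>m g. g \<in> maps l m)) nss gss \<and> \<beta>ss = map2 (map2 (cls l)) nss gss"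
    using assms
  proof (induction rule: list_all2_induct)
    case (Cons ns nss \<beta>s \<beta>ss)
    obtain gs where "list_all2 (\<lambda>m g. g \<in> maps l m) ns gs" "\<beta>s = map2 (cls l) ns gs"
      using class_list_representatives[OF Cons.hyps(1)] by blast
    then show ?case
      using Cons.IH by (elim exE conjE) (rule exI[of _ "gs # _"], simp)
  qed simp
  then show thesis
    using that by blast
qed

lemma pointwise_comp_based:
  assumes f: "f \<in> maps l (length ms)" and gs: "list_all2 (\<lambda>m g. g \<in> maps l m) ms gs"
  shows "continuous_map (nsphere l) (ospace \<C> (sum_list ms)) (pointwise_comp \<C> ms f gs)"
    and "pointwise_comp \<C> ms f gs sphere_pt = delta_path \<eta> ms 1"
proof -
  show "continuous_map (nsphere l) (ospace \<C> (sum_list ms)) (pointwise_comp \<C> ms f gs)"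
    using f gs
    by (intro continuous_map_pointwise_comp[OF operad compact_space_nsphere])
      (auto simp: based_maps_def list_all2_conv_all_nth)
  have "map (\<lambda>g. g sphere_pt) gs = map (basept \<eta>) ms"
    using gs by (auto simp: based_maps_def list_all2_conv_all_nth intro!: nth_equalityI)
  then show "pointwise_comp \<C> ms f gs sphere_pt = delta_path \<eta> ms 1"
    using f by (simp add: pointwise_comp_def based_maps_def)
qed

lemma composite_representative:
  assumes "f \<in> maps l (length ms)" "list_all2 (\<lambda>m g. g \<in> maps l m) ms gs"
  obtains u where "u \<in> maps l (sum_list ms)"
    "transport l (ospace \<C> (sum_list ms)) (delta_path \<eta> ms) u (pointwise_comp \<C> ms f gs)"
proof -
  obtain u where u: "transport l (ospace \<C> (sum_list ms)) (delta_path \<eta> ms) u (pointwise_comp \<C> ms f gs)"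
    using transport_exists[OF pointwise_comp_based(1)[OF assms] pathin_delta_path
        pointwise_comp_based(2)[OF assms]] by blast
  then show thesis
    using that based_maps_transport(1)[OF u] by simp
qed

text \<open>
  Based homotopies of the representatives compose to a homotopy with constant track.
\<close>

lemma composite_independent:
  assumes f: "f \<in> maps l (length ms)" and gs: "list_all2 (\<lambda>m g. g \<in> maps l m) ms gs"
    and f': "f' \<in> cls l (length ms) f" and gs': "list_all2 (\<in>) gs' (map2 (cls l) ms gs)"
    and u: "transport l (ospace \<C> (sum_list ms)) (delta_path \<eta> ms) u (pointwise_comp \<C> ms f gs)"
  shows "transport l (ospace \<C> (sum_list ms)) (delta_path \<eta> ms) u (pointwise_comp \<C> ms f' gs')"
proof -
  have len: "length gs = length ms" "length gs' = length ms"
    using gs gs' by (auto dest!: list_all2_lengthD)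
  have "transport l (ospace \<C> (sum_list ms))
      (pointwise_comp \<C> ms (\<lambda>_. basept \<eta> (length ms)) (map (\<lambda>m _. basept \<eta> m) ms))
      (pointwise_comp \<C> ms f gs) (pointwise_comp \<C> ms f' gs')"
    by (rule transport_pointwise_comp[OF operad])
      (use f' gs' len in \<open>auto simp: mem_htpy_class list_all2_conv_all_nth\<close>)
  moreover have "pointwise_comp \<C> ms (\<lambda>_. basept \<eta> (length ms)) (map (\<lambda>m _. basept \<eta> m) ms) =
      (\<lambda>_::real. delta_path \<eta> ms 1)"
    by (simp add: pointwise_comp_def o_def fun_eq_iff)
  ultimately have "transport l (ospace \<C> (sum_list ms)) (\<lambda>_. delta_path \<eta> ms 1)
      (pointwise_comp \<C> ms f gs) (pointwise_comp \<C> ms f' gs')"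
    by simp
  then show ?thesis
    by (rule transport_const_right[OF u])
qed

text \<open>
  A composition of homotopy classes is determined by the requirement that it is computed by
  transport along \<open>\<delta>\<close>.  The operad of \<open>l\<close>-th homotopy groups satisfies it by definition, and the
  group operad of fundamental groups satisfies it for \<open>l = 1\<close>, so the operad laws are derived for
  both from this requirement.
\<close>

definition computes_pi_comp where
  "computes_pi_comp l cmp \<longleftrightarrow> (\<forall>ms f gs u.
     f \<in> maps l (length ms) \<and> list_all2 (\<lambda>m g. g \<in> maps l m) ms gs \<and>
     transport l (ospace \<C> (sum_list ms)) (delta_path \<eta> ms) u (pointwise_comp \<C> ms f gs) \<longrightarrow>
     cmp ms (cls l (length ms) f) (map2 (cls l) ms gs) = cls l (sum_list ms) u)"

lemma computes_pi_compD:
  assumes "computes_pi_comp l cmp" "f \<in> maps l (length ms)" "list_all2 (\<lambda>m g. g \<in> maps l m) ms gs"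
    "transport l (ospace \<C> (sum_list ms)) (delta_path \<eta> ms) u (pointwise_comp \<C> ms f gs)"
  shows "cmp ms (cls l (length ms) f) (map2 (cls l) ms gs) = cls l (sum_list ms) u"
  using assms unfolding computes_pi_comp_def by blast

lemma list_all2_mem_classes:
  assumes "list_all2 (\<lambda>m g. g \<in> maps l m) ms gs"
  shows "list_all2 (\<in>) gs (map2 (cls l) ms gs)"
  using assms by (auto simp: list_all2_conv_all_nth intro!: mem_htpy_class_self)

lemma union_of_equal_classes:
  assumes f: "f \<in> maps l (length ms)" and gs: "list_all2 (\<lambda>m g. g \<in> maps l m) ms gs"
    and R: "\<And>f' gs'. f' \<in> cls l (length ms) f \<Longrightarrow> list_all2 (\<in>) gs' (map2 (cls l) ms gs) \<Longrightarrow> R f' gs' = S"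
  shows "\<Union>{R f' gs' | f' gs'. f' \<in> cls l (length ms) f \<and> list_all2 (\<in>) gs' (map2 (cls l) ms gs)} = S"
proof -
  have "{R f' gs' | f' gs'. f' \<in> cls l (length ms) f \<and> list_all2 (\<in>) gs' (map2 (cls l) ms gs)} = {S}"
    using R mem_htpy_class_self[OF f] list_all2_mem_classes[OF gs] by blast
  then show ?thesis
    by simp
qed

lemma pi_rep_comp_eq:
  assumes "transport l (ospace \<C> (sum_list ms)) (delta_path \<eta> ms) u (pointwise_comp \<C> ms f gs)"
  shows "pi_rep_comp l \<C> \<eta> ms f gs = cls l (sum_list ms) u"
  using change_basepoint_eq[OF assms refl] by (simp add: pi_rep_comp_def)

lemma computes_pi_comp_pi_operad: "computes_pi_comp l (ocomp (pi_operad l \<C> \<eta>))"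
  unfolding computes_pi_comp_def
proof (intro allI impI, elim conjE)
  fix ms f gs u
  assume f: "f \<in> maps l (length ms)" and gs: "list_all2 (\<lambda>m g. g \<in> maps l m) ms gs"
    and u: "transport l (ospace \<C> (sum_list ms)) (delta_path \<eta> ms) u (pointwise_comp \<C> ms f gs)"
  show "ocomp (pi_operad l \<C> \<eta>) ms (cls l (length ms) f) (map2 (cls l) ms gs) = cls l (sum_list ms) u"
    unfolding pi_operad_def operad_data.simps
    by (rule union_of_equal_classes[OF f gs]) (rule pi_rep_comp_eq[OF composite_independent[OF f gs _ _ u]])
qed

text \<open>
  On the circle, transport along \<open>\<delta>\<close> is conjugation of loops by \<open>\<delta>\<close>.
\<close>

lemma computes_pi_comp_pi1_group_operad: "computes_pi_comp 1 (gcomp (pi1_group_operad \<C> \<eta>))"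
  unfolding computes_pi_comp_def
proof (intro allI impI, elim conjE)
  fix ms f gs u
  assume f: "f \<in> maps 1 (length ms)" and gs: "list_all2 (\<lambda>m g. g \<in> maps 1 m) ms gs"
    and u: "transport 1 (ospace \<C> (sum_list ms)) (delta_path \<eta> ms) u (pointwise_comp \<C> ms f gs)"
  have "u \<in> maps 1 (sum_list ms)"
    using based_maps_transport(1)[OF u] by simp
  then show "gcomp (pi1_group_operad \<C> \<eta>) ms (cls 1 (length ms) f) (map2 (cls 1) ms gs) = cls 1 (sum_list ms) u"
    unfolding pi1_group_operad_def group_operad_data.simps
    by (intro union_of_equal_classes[OF f gs] loop_class_eq
        transport_circ[OF composite_independent[OF f gs _ _ u]])
qed

lemma pi_comp_closed:
  assumes cmp: "computes_pi_comp l cmp" and \<alpha>: "\<alpha> \<in> pi_set l (length ms)"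
    and \<beta>s: "list_all2 (\<lambda>m \<beta>. \<beta> \<in> pi_set l m) ms \<beta>s"
  shows "cmp ms \<alpha> \<beta>s \<in> pi_set l (sum_list ms)"
proof -
  obtain f where f: "f \<in> maps l (length ms)" "\<alpha> = cls l (length ms) f"
    using \<alpha> by (rule homotopy_setE)
  obtain gs where gs: "list_all2 (\<lambda>m g. g \<in> maps l m) ms gs" "\<beta>s = map2 (cls l) ms gs"
    using \<beta>s by (rule class_list_representatives)
  obtain u where "u \<in> maps l (sum_list ms)"
    "transport l (ospace \<C> (sum_list ms)) (delta_path \<eta> ms) u (pointwise_comp \<C> ms f gs)"
    using f(1) gs(1) by (rule composite_representative)
  then show ?thesis
    using computes_pi_compD[OF cmp f(1) gs(1)] f(2) gs(2) by auto
qed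

text \<open>
  Both iterated composites are transports of one and the same map, since the operad law holds at each
  point of the sphere.  The two tracks are homotopic by the coherence of the standard paths, and a map
  transported along homotopic tracks is unique up to based homotopy.
\<close>

lemma pi_comp_assoc:
  assumes cmp: "computes_pi_comp l cmp" and \<alpha>: "\<alpha> \<in> pi_set l (length nss)"
    and \<beta>s: "list_all2 (\<lambda>ns \<beta>. \<beta> \<in> pi_set l (length ns)) nss \<beta>s"
    and \<gamma>ss: "list_all2 (list_all2 (\<lambda>m \<gamma>. \<gamma> \<in> pi_set l m)) nss \<gamma>ss"
  shows "cmp (concat nss) (cmp (map length nss) \<alpha> \<beta>s) (concat \<gamma>ss) =
    cmp (map sum_list nss) \<alpha> (map (\<lambda>i. cmp (nss ! i) (\<beta>s ! i) (\<gamma>ss ! i)) [0..<length nss])"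
proof -
  let ?k = "length nss" and ?M = "sum_list (concat nss)"
  have sum: "sum_list (map sum_list nss) = ?M"
    by (induction nss) auto
  have len: "length (concat nss) = sum_list (map length nss)"
    by (simp add: length_concat)
  obtain a where a: "a \<in> maps l ?k" "\<alpha> = cls l ?k a"
    using \<alpha> by (rule homotopy_setE)
  obtain bs where bs: "list_all2 (\<lambda>m g. g \<in> maps l m) (map length nss) bs"
    "\<beta>s = map2 (cls l) (map length nss) bs"
    using \<beta>s by (auto simp: list_all2_map1 intro: class_list_representatives[of l "map length nss" \<beta>s])
  obtain css where css: "list_all2 (list_all2 (\<lambda>m g. g \<in> maps l m)) nss css"
    "\<gamma>ss = map2 (map2 (cls l)) nss css"
    using \<gamma>ss by (rule class_list_list_representatives)
  have concat_maps: "list_all2 (\<lambda>m g. g \<in> maps l m) (concat nss) (concat css)"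
    using css(1) by (rule list_all2_concat)
  have "list_all2 (\<lambda>xs ys. length xs = length ys) nss css"
    using css(1) by (rule list_all2_mono) (rule list_all2_lengthD)
  then have concat_\<gamma>: "concat \<gamma>ss = map2 (cls l) (concat nss) (concat css)"
    unfolding css(2) by (rule concat_map2_map2)
  have lens: "length bs = ?k" "length css = ?k"
    using bs(1) css(1) by (auto dest!: list_all2_lengthD)
  have b: "bs ! i \<in> maps l (length (nss ! i))" and c: "list_all2 (\<lambda>m g. g \<in> maps l m) (nss ! i) (css ! i)"
    if "i < ?k" for i
    using bs(1) css(1) that by (auto simp: list_all2_conv_all_nth)
  obtain u where u: "u \<in> maps l (sum_list (map length nss))"
    "transport l (ospace \<C> (sum_list (map length nss))) (delta_path \<eta> (map length nss)) u
       (pointwise_comp \<C> (map length nss) a bs)"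
    using composite_representative[of a l "map length nss" bs] a(1) bs(1) by auto
  obtain v where v: "v \<in> maps l ?M"
    "transport l (ospace \<C> ?M) (delta_path \<eta> (concat nss)) v (pointwise_comp \<C> (concat nss) u (concat css))"
    using composite_representative[of u l "concat nss" "concat css"] u(1) concat_maps by (auto simp: len)
  have left: "cmp (concat nss) (cmp (map length nss) \<alpha> \<beta>s) (concat \<gamma>ss) = cls l ?M v"
    using computes_pi_compD[OF cmp _ bs(1) u(2)] a computes_pi_compD[OF cmp _ concat_maps v(2)] u(1)
    by (simp add: bs(2) concat_\<gamma> len)
  have "\<exists>w. w \<in> maps l (sum_list (nss ! i)) \<and>
      transport l (ospace \<C> (sum_list (nss ! i))) (delta_path \<eta> (nss ! i)) w
        (pointwise_comp \<C> (nss ! i) (bs ! i) (css ! i))" if "i < ?k" for i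
    by (rule composite_representative[OF b[OF that] c[OF that]]) blast
  then obtain w where w: "\<And>i. i < ?k \<Longrightarrow> w i \<in> maps l (sum_list (nss ! i))"
    "\<And>i. i < ?k \<Longrightarrow> transport l (ospace \<C> (sum_list (nss ! i))) (delta_path \<eta> (nss ! i)) (w i)
        (pointwise_comp \<C> (nss ! i) (bs ! i) (css ! i))"
    by metis
  let ?ws = "map w [0..<?k]"
  let ?bcs = "map (\<lambda>i. pointwise_comp \<C> (nss ! i) (bs ! i) (css ! i)) [0..<?k]"
  have ws: "list_all2 (\<lambda>m g. g \<in> maps l m) (map sum_list nss) ?ws"
    using w(1) by (auto simp: list_all2_conv_all_nth)
  obtain x where x: "x \<in> maps l (sum_list (map sum_list nss))"
    "transport l (ospace \<C> (sum_list (map sum_list nss))) (delta_path \<eta> (map sum_list nss)) x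
       (pointwise_comp \<C> (map sum_list nss) a ?ws)"
    using composite_representative[of a l "map sum_list nss" ?ws] a(1) ws by auto
  have "map (\<lambda>i. cmp (nss ! i) (\<beta>s ! i) (\<gamma>ss ! i)) [0..<?k] = map2 (cls l) (map sum_list nss) ?ws"
  proof (rule nth_equalityI)
    fix i assume "i < length (map (\<lambda>i. cmp (nss ! i) (\<beta>s ! i) (\<gamma>ss ! i)) [0..<?k])"
    then have i: "i < ?k" by simp
    show "map (\<lambda>i. cmp (nss ! i) (\<beta>s ! i) (\<gamma>ss ! i)) [0..<?k] ! i = map2 (cls l) (map sum_list nss) ?ws ! i"
      using computes_pi_compD[OF cmp b[OF i] c[OF i] w(2)[OF i]] i lens by (simp add: bs(2) css(2))
  qed simp
  then have right: "cmp (map sum_list nss) \<alpha> (map (\<lambda>i. cmp (nss ! i) (\<beta>s ! i) (\<gamma>ss ! i)) [0..<?k]) = cls l ?M x"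
    using computes_pi_compD[OF cmp _ ws x(2)] a by (simp add: sum)
  let ?P = "pointwise_comp \<C> (concat nss) (delta_path \<eta> (map length nss)) (map (\<lambda>n _. basept \<eta> n) (concat nss))"
  let ?Q = "pointwise_comp \<C> (map sum_list nss) (\<lambda>_. basept \<eta> ?k) (map (delta_path \<eta>) nss)"
  have "transport l (ospace \<C> ?M) ?P (pointwise_comp \<C> (concat nss) u (concat css))
      (pointwise_comp \<C> (concat nss) (pointwise_comp \<C> (map length nss) a bs) (concat css))"
    by (rule transport_pointwise_comp[OF operad])
      (use u(2) concat_maps in \<open>auto simp: len list_all2_conv_all_nth intro: transport_refl\<close>)
  from transport_join[OF v(2) this]
  have v': "transport l (ospace \<C> ?M) (join_path (delta_path \<eta> (concat nss)) ?P) v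
      (pointwise_comp \<C> (concat nss) (pointwise_comp \<C> (map length nss) a bs) (concat css))" .
  have "transport l (ospace \<C> (sum_list (map sum_list nss))) ?Q (pointwise_comp \<C> (map sum_list nss) a ?ws)
      (pointwise_comp \<C> (map sum_list nss) a ?bcs)"
    by (rule transport_pointwise_comp[OF operad])
      (use a(1) w(2) in \<open>auto intro: transport_refl\<close>)
  from transport_join[OF x(2) this]
  have x': "transport l (ospace \<C> ?M) (join_path (delta_path \<eta> (map sum_list nss)) ?Q) x
      (pointwise_comp \<C> (map sum_list nss) a ?bcs)"
    by (simp add: sum)
  have maps_elem: "oelem \<C> n (g z)" if "g \<in> maps l n" "z \<in> topspace (nsphere l)" for g n z
    using that continuous_map_funspace by (fastforce simp: based_maps_def oelem_def)
  have assoc: "pointwise_comp \<C> (map sum_list nss) a ?bcs z =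
      pointwise_comp \<C> (concat nss) (pointwise_comp \<C> (map length nss) a bs) (concat css) z"
    if z: "z \<in> topspace (nsphere l)" for z
  proof -
    have "ocomp \<C> (concat nss) (ocomp \<C> (map length nss) (a z) (map (\<lambda>g. g z) bs))
        (concat (map (map (\<lambda>g. g z)) css)) =
      ocomp \<C> (map sum_list nss) (a z)
        (map (\<lambda>i. ocomp \<C> (nss ! i) (map (\<lambda>g. g z) bs ! i) (map (map (\<lambda>g. g z)) css ! i)) [0..<?k])"
      by (rule ocomp_assoc[OF operad])
        (use a(1) b c z lens maps_elem in \<open>auto simp: list_all2_conv_all_nth\<close>)
    moreover have "map (\<lambda>g. g z) ?bcs =
        map (\<lambda>i. ocomp \<C> (nss ! i) (map (\<lambda>g. g z) bs ! i) (map (map (\<lambda>g. g z)) css ! i)) [0..<?k]"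
      using lens by (auto simp: pointwise_comp_def intro!: nth_equalityI)
    ultimately show ?thesis
      by (simp only: pointwise_comp_def map_concat)
  qed
  have "transport l (ospace \<C> ?M) (join_path (delta_path \<eta> (map sum_list nss)) ?Q) x
      (pointwise_comp \<C> (concat nss) (pointwise_comp \<C> (map length nss) a bs) (concat css))"
    by (rule transport_cong[OF x' refl assoc])
  from transport_unique[OF v' this delta_path_coherence]
  have "transport l (ospace \<C> ?M) (\<lambda>_. basept \<eta> ?M) v x"
    by (simp add: transport_const_iff)
  then show ?thesis
    unfolding left right by (rule htpy_class_eq)
qed

lemma pi_set_0:
  obtains \<alpha> where "pi_set l 0 = {\<alpha>}"
proof -
  obtain x where x: "topspace (ospace \<C> 0) = {x}"
    using operad unfolding topological_operad_def by blast
  have x': "basept \<eta> 0 = x"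
    using basept_in[of 0] unfolding x by simp
  have "cls l 0 f = cls l 0 (\<lambda>_. x)" if f: "f \<in> maps l 0" for f
  proof (rule htpy_class_eq)
    have "f z = x" if "z \<in> topspace (nsphere l)" for z
      using f that x continuous_map_funspace[of "nsphere l" "ospace \<C> 0" f] by (auto simp: based_maps_def)
    then have "homotopic_with (\<lambda>h. h sphere_pt = basept \<eta> 0) (nsphere l) (ospace \<C> 0) f (\<lambda>_. x)"
      using f x' by (intro homotopic_with_equal) (auto simp: based_maps_def)
    then show "transport l (ospace \<C> 0) (\<lambda>_. basept \<eta> 0) f (\<lambda>_. x)"
      by (simp add: transport_const_iff)
  qed
  moreover have "(\<lambda>_. x) \<in> maps l 0"
    using x x' by (auto simp: based_maps_def)
  ultimately have "pi_set l 0 = {cls l 0 (\<lambda>_. x)}"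
    unfolding homotopy_set_def by blast
  then show thesis
    by (rule that)
qed

text \<open>
  In the unit laws \<open>\<delta>\<close> joins the standard configuration to itself and is constant.
\<close>

lemma transport_delta_path_const:
  assumes "little_intervals_comp (std_config (length ms)) (map std_config ms) = std_config (sum_list ms)"
    and f: "f \<in> maps l (sum_list ms)"
    and eq: "\<And>z. z \<in> topspace (nsphere l) \<Longrightarrow> f z = h z"
  shows "transport l (ospace \<C> (sum_list ms)) (delta_path \<eta> ms) f h"
proof -
  have "delta_path \<eta> ms = (\<lambda>_. basept \<eta> (sum_list ms))"
    by (simp add: delta_path_eq delta_config_def assms(1) config_segment_same basept_def)
  then show ?thesis
    using transport_cong[OF transport_refl[OF f] refl eq] by simp
qed

lemma maps_elem: "f \<in> maps l n \<Longrightarrow> z \<in> topspace (nsphere l) \<Longrightarrow> oelem \<C> n (f z)"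
  using continuous_map_funspace by (fastforce simp: based_maps_def oelem_def)

lemma pi_comp_unit_left:
  assumes cmp: "computes_pi_comp l cmp" and \<alpha>: "\<alpha> \<in> pi_set l n"
  shows "cmp [n] (cls l 1 (\<lambda>_. basept \<eta> 1)) [\<alpha>] = \<alpha>"
proof -
  obtain f where f: "f \<in> maps l n" "\<alpha> = cls l n f"
    using \<alpha> by (rule homotopy_setE)
  have len: "length [n] = 1"
    by (simp add: One_nat_def)
  have "transport l (ospace \<C> (sum_list [n])) (delta_path \<eta> [n]) f (pointwise_comp \<C> [n] (\<lambda>_. basept \<eta> 1) [f])"
  proof (rule transport_delta_path_const)
    show "little_intervals_comp (std_config (length [n])) (map std_config [n]) = std_config (sum_list [n])"
      unfolding len by (simp add: little_intervals_comp_unit_left)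
  qed (use f ocomp_unit_left[OF operad] maps_elem in \<open>simp_all add: pointwise_comp_def basept_1\<close>)
  moreover have "(\<lambda>_. basept \<eta> 1) \<in> maps l (length [n])"
    unfolding len by (rule const_in_based_maps) simp
  ultimately show ?thesis
    using computes_pi_compD[OF cmp, of "\<lambda>_. basept \<eta> 1" "[n]" "[f]" f] f by (simp add: One_nat_def)
qed

lemma pi_comp_unit_right:
  assumes cmp: "computes_pi_comp l cmp" and \<alpha>: "\<alpha> \<in> pi_set l n"
  shows "cmp (replicate n 1) \<alpha> (replicate n (cls l 1 (\<lambda>_. basept \<eta> 1))) = \<alpha>"
proof -
  obtain f where f: "f \<in> maps l n" "\<alpha> = cls l n f"
    using \<alpha> by (rule homotopy_setE)
  let ?ms = "replicate n 1" and ?us = "replicate n (\<lambda>_::nat \<Rightarrow> real. basept \<eta> 1)"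
  have sum: "sum_list ?ms = n"
    by (simp add: sum_list_replicate)
  have us: "list_all2 (\<lambda>m g. g \<in> maps l m) ?ms ?us"
    by (auto simp: list_all2_conv_all_nth)
  have "transport l (ospace \<C> (sum_list ?ms)) (delta_path \<eta> ?ms) f (pointwise_comp \<C> ?ms f ?us)"
  proof (rule transport_delta_path_const)
    show "little_intervals_comp (std_config (length ?ms)) (map std_config ?ms) = std_config (sum_list ?ms)"
      using little_intervals_comp_unit_right[of "std_config n"] by (simp add: sum map_replicate_const)
  qed (use f ocomp_unit_right[OF operad] maps_elem in \<open>simp_all add: pointwise_comp_def basept_1 sum\<close>)
  moreover have "map2 (cls l) ?ms ?us = replicate n (cls l 1 (\<lambda>_. basept \<eta> 1))"
    by (auto intro!: nth_equalityI)
  ultimately show ?thesis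
    using computes_pi_compD[OF cmp _ us] f by (simp add: sum)
qed

lemma topological_operad_pi:
  assumes cmp: "computes_pi_comp l (ocomp \<D>)"
    and space: "\<And>n. ospace \<D> n = discrete_topology (pi_set l n)"
    and unit: "ounit \<D> = cls l 1 (\<lambda>_. basept \<eta> 1)"
  shows "topological_operad \<D>"
proof -
  have "cls l 1 (\<lambda>_. basept \<eta> 1) \<in> pi_set l 1"
    by (intro htpy_class_in_homotopy_set const_in_based_maps basept_in)
  moreover obtain \<alpha> where "pi_set l 0 = {\<alpha>}"
    by (rule pi_set_0)
  ultimately show ?thesis
    using space
    by (intro topological_operad_discreteI[of \<D> "pi_set l"])
      (use pi_comp_closed[OF cmp] pi_comp_assoc[OF cmp] pi_comp_unit_left[OF cmp] pi_comp_unit_right[OF cmp]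
        in \<open>auto simp: unit\<close>)
qed

section \<open>The group operad of fundamental groups\<close>

lemma group_pi1: "group (pi1_group (ospace \<C> n) (basept \<eta> n))"
  by (rule pi1_group_is_group) simp

text \<open>
  Pointwise composition commutes with the concatenation of loops, as both are computed at each time
  separately; conjugation by \<open>\<delta>\<close> is multiplicative.
\<close>

lemma pi1_comp_interchange:
  assumes \<alpha>: "\<alpha> \<in> pi_set 1 (length ms)" "\<alpha>' \<in> pi_set 1 (length ms)"
    and \<beta>s: "list_all2 (\<lambda>m \<beta>. \<beta> \<in> pi_set 1 m) ms \<beta>s" "list_all2 (\<lambda>m \<beta>. \<beta> \<in> pi_set 1 m) ms \<beta>s'"
  shows "gcomp (pi1_group_operad \<C> \<eta>) ms (\<alpha> \<otimes>\<^bsub>pi1_group (ospace \<C> (length ms)) (basept \<eta> (length ms))\<^esub> \<alpha>')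
      (map (\<lambda>i. \<beta>s ! i \<otimes>\<^bsub>pi1_group (ospace \<C> (ms ! i)) (basept \<eta> (ms ! i))\<^esub> \<beta>s' ! i) [0..<length ms]) =
    gcomp (pi1_group_operad \<C> \<eta>) ms \<alpha> \<beta>s
      \<otimes>\<^bsub>pi1_group (ospace \<C> (sum_list ms)) (basept \<eta> (sum_list ms))\<^esub> gcomp (pi1_group_operad \<C> \<eta>) ms \<alpha>' \<beta>s'"
proof -
  note cmp = computes_pi_compD[OF computes_pi_comp_pi1_group_operad]
  let ?X = "ospace \<C> (sum_list ms)" and ?d = "delta_path \<eta> ms"
  obtain f where f: "f \<in> maps 1 (length ms)" "\<alpha> = cls 1 (length ms) f"
    using \<alpha>(1) by (rule homotopy_setE)
  obtain f' where f': "f' \<in> maps 1 (length ms)" "\<alpha>' = cls 1 (length ms) f'"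
    using \<alpha>(2) by (rule homotopy_setE)
  obtain gs where gs: "list_all2 (\<lambda>m g. g \<in> maps 1 m) ms gs" "\<beta>s = map2 (cls 1) ms gs"
    using \<beta>s(1) by (rule class_list_representatives)
  obtain gs' where gs': "list_all2 (\<lambda>m g. g \<in> maps 1 m) ms gs'" "\<beta>s' = map2 (cls 1) ms gs'"
    using \<beta>s(2) by (rule class_list_representatives)
  have len: "length gs = length ms" "length gs' = length ms"
    using gs(1) gs'(1) by (auto dest!: list_all2_lengthD)
  have g: "gs ! i \<in> maps 1 (ms ! i)" "gs' ! i \<in> maps 1 (ms ! i)" if "i < length ms" for i
    using gs(1) gs'(1) that by (auto simp: list_all2_conv_all_nth)
  obtain h where h: "h \<in> maps 1 (length ms)"
    "path_homotopic (ospace \<C> (length ms)) (h \<circ> circ) (join_path (f \<circ> circ) (f' \<circ> circ))"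
    "\<alpha> \<otimes>\<^bsub>pi1_group (ospace \<C> (length ms)) (basept \<eta> (length ms))\<^esub> \<alpha>' = cls 1 (length ms) h"
    using pi1_mult_representative[OF f(1) f'(1)] f f' by metis
  have "\<exists>k. k \<in> maps 1 (ms ! i) \<and>
      path_homotopic (ospace \<C> (ms ! i)) (k \<circ> circ) (join_path ((gs ! i) \<circ> circ) ((gs' ! i) \<circ> circ)) \<and>
      cls 1 (ms ! i) (gs ! i) \<otimes>\<^bsub>pi1_group (ospace \<C> (ms ! i)) (basept \<eta> (ms ! i))\<^esub> cls 1 (ms ! i) (gs' ! i) =
        cls 1 (ms ! i) k" if "i < length ms" for i
    by (rule pi1_mult_representative[OF g[OF that]]) blast
  then obtain k where k: "\<And>i. i < length ms \<Longrightarrow> k i \<in> maps 1 (ms ! i)"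
    "\<And>i. i < length ms \<Longrightarrow> path_homotopic (ospace \<C> (ms ! i)) (k i \<circ> circ)
       (join_path ((gs ! i) \<circ> circ) ((gs' ! i) \<circ> circ))"
    "\<And>i. i < length ms \<Longrightarrow>
       cls 1 (ms ! i) (gs ! i) \<otimes>\<^bsub>pi1_group (ospace \<C> (ms ! i)) (basept \<eta> (ms ! i))\<^esub> cls 1 (ms ! i) (gs' ! i) =
        cls 1 (ms ! i) (k i)"
    by metis
  let ?ks = "map k [0..<length ms]"
  have ks: "list_all2 (\<lambda>m g. g \<in> maps 1 m) ms ?ks"
    using k(1) by (auto simp: list_all2_conv_all_nth)
  have prods: "map (\<lambda>i. \<beta>s ! i \<otimes>\<^bsub>pi1_group (ospace \<C> (ms ! i)) (basept \<eta> (ms ! i))\<^esub> \<beta>s' ! i) [0..<length ms] =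
      map2 (cls 1) ms ?ks"
    using k(3) len by (auto simp: gs(2) gs'(2) intro!: nth_equalityI)
  obtain u where u: "u \<in> maps 1 (sum_list ms)" "transport 1 ?X ?d u (pointwise_comp \<C> ms f gs)"
    using f(1) gs(1) by (rule composite_representative)
  obtain u' where u': "u' \<in> maps 1 (sum_list ms)" "transport 1 ?X ?d u' (pointwise_comp \<C> ms f' gs')"
    using f'(1) gs'(1) by (rule composite_representative)
  obtain x where x: "x \<in> maps 1 (sum_list ms)" "transport 1 ?X ?d x (pointwise_comp \<C> ms h ?ks)"
    using h(1) ks by (rule composite_representative)
  let ?A = "pointwise_comp \<C> ms f gs \<circ> circ" and ?A' = "pointwise_comp \<C> ms f' gs' \<circ> circ"
  have A: "pathin ?X ?A" "?A 0 = ?d 1" "?A 1 = ?d 1" and A': "pathin ?X ?A'" "?A' 0 = ?d 1" "?A' 1 = ?d 1"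
    using pathin_circ[OF based_maps_transport(2)[OF u(2)]] pathin_circ[OF based_maps_transport(2)[OF u'(2)]]
    by auto
  have r: "path_homotopic ?X (reverse_path ?d) (reverse_path ?d)"
    by (intro path_homotopic_refl pathin_reverse_path pathin_delta_path)
  have "path_homotopic ?X (pointwise_comp \<C> ms h ?ks \<circ> circ)
      (pointwise_comp \<C> ms (join_path (f \<circ> circ) (f' \<circ> circ))
        (map (\<lambda>i. join_path ((gs ! i) \<circ> circ) ((gs' ! i) \<circ> circ)) [0..<length ms]))"
    using path_homotopic_pointwise_comp[OF operad h(2), of "map (\<lambda>i. k i \<circ> circ) [0..<length ms]"
        "map (\<lambda>i. join_path ((gs ! i) \<circ> circ) ((gs' ! i) \<circ> circ)) [0..<length ms]"] k(2)
    by (simp add: pointwise_comp_def[abs_def] o_def)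
  moreover have "pointwise_comp \<C> ms (join_path (f \<circ> circ) (f' \<circ> circ))
        (map (\<lambda>i. join_path ((gs ! i) \<circ> circ) ((gs' ! i) \<circ> circ)) [0..<length ms]) = join_path ?A ?A'"
    using len by (auto simp: pointwise_comp_def join_path_def fun_eq_iff intro!: arg_cong[where f = "ocomp \<C> ms _"] nth_equalityI)
  ultimately have mid: "path_homotopic ?X (pointwise_comp \<C> ms h ?ks \<circ> circ) (join_path ?A ?A')"
    by simp
  have "path_homotopic ?X (x \<circ> circ)
      (join_path ?d (join_path (pointwise_comp \<C> ms h ?ks \<circ> circ) (reverse_path ?d)))"
    by (rule transport_circ[OF x(2)])
  also have "path_homotopic ?X \<dots> (join_path ?d (join_path (join_path ?A ?A') (reverse_path ?d)))"
    by (intro path_homotopic_join path_homotopic_refl pathin_delta_path mid r)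
      (use path_homotopic_imp[OF mid] A A' in auto)
  also have "path_homotopic ?X \<dots>
      (join_path (join_path ?d (join_path ?A (reverse_path ?d))) (join_path ?d (join_path ?A' (reverse_path ?d))))"
    by (rule path_homotopic_sym, rule path_homotopic_conjugate_join[OF pathin_delta_path A A'])
  also have "path_homotopic ?X \<dots> (join_path (u \<circ> circ) (u' \<circ> circ))"
    by (rule path_homotopic_join[OF path_homotopic_sym[OF transport_circ[OF u(2)]]
          path_homotopic_sym[OF transport_circ[OF u'(2)]]]) simp
  finally have "cls 1 (sum_list ms) u \<otimes>\<^bsub>pi1_group ?X (basept \<eta> (sum_list ms))\<^esub> cls 1 (sum_list ms) u' =
      cls 1 (sum_list ms) x"
    by (rule pi1_mult_eq[OF u(1) u'(1) x(1)])
  then show ?thesis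
    unfolding prods h(3)
    using cmp[OF f(1) gs(1) u(2)] cmp[OF f'(1) gs'(1) u'(2)] cmp[OF h(1) ks x(2)]
    by (simp add: f(2) f'(2) gs(2) gs'(2))
qed

end

lemma perm_comp_id: "perm_comp ms id (replicate (length ms) id) = id"
proof
  fix x
  show "perm_comp ms id (replicate (length ms) id) x = id x"
  proof (cases "x < sum_list ms")
    case True
    let ?P = "\<lambda>i. x < sum_list (take (Suc i) ms)"
    define i where "i = (LEAST i. ?P i)"
    have ex: "?P (length ms)"
      using True by simp
    have i: "?P i"
      unfolding i_def using ex by (rule LeastI)
    have below: "sum_list (take i ms) \<le> x"
    proof (cases i)
      case (Suc j)
      then have "\<not> ?P j"
        unfolding i_def by (intro not_less_Least) simp
      then show ?thesis
        using Suc by simp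
    qed simp
    have less: "i < length ms"
    proof (rule ccontr)
      assume "\<not> i < length ms"
      then show False
        using below True by simp
    qed
    have "(\<Sum>i' | i' < length ms \<and> i' < i. ms ! i') = (\<Sum>i' = 0..<i. ms ! i')"
      using less by (intro sum.cong) auto
    also have "\<dots> = sum_list (take i ms)"
      using less by (simp add: sum_list_sum_nth)
    finally show ?thesis
      using True below less by (simp add: perm_comp_def i_def[symmetric] Let_def)
  qed (simp add: perm_comp_def)
qed

context good_operad
begin

lemma group_operad_pi1: "group_operad (pi1_group_operad \<C> \<eta>)"
proof -
  let ?G = "pi1_group_operad \<C> \<eta>"
  have group: "ggroup ?G n = pi1_group (ospace \<C> n) (basept \<eta> n)" and perm: "gperm ?G = (\<lambda>_ _. id)" for n
    by (simp_all add: pi1_group_operad_def)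
  have operad: "topological_operad (group_operad_operad ?G)"
    by (rule topological_operad_pi[of 1])
      (simp_all add: group_operad_operad_def group computes_pi_comp_pi1_group_operad pi1_one)
  have "perm_comp ms id (map2 (gperm ?G) ms bs) = id" if "list_all2 P ms bs" for P ms bs
  proof -
    have "map2 (gperm ?G) ms bs = replicate (length ms) id"
      using list_all2_lengthD[OF that] by (auto simp: perm intro!: nth_equalityI)
    then show ?thesis
      by (simp add: perm_comp_id)
  qed
  then have "operad_morphism (group_operad_operad ?G) symmetric_operad (gperm ?G)"
    unfolding operad_morphism_def
    by (auto simp: perm symmetric_operad_def perm_group_def group_operad_operad_def permutes_id)
  moreover have "gperm ?G n \<in> hom (ggroup ?G n) (perm_group n)" for n
    by (auto simp: hom_def perm perm_group_def permutes_id)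
  moreover have "Hilbert_Choice.inv (id :: nat \<Rightarrow> nat) = id"
    by simp
  ultimately show ?thesis
    unfolding group_operad_def
    using group_pi1 operad pi1_comp_interchange by (auto simp: group perm Let_def)
qed

section \<open>The action of the fundamental groups on the homotopy groups\<close>

text \<open>
  Let \<open>w\<close>, \<open>u\<close>, \<open>y\<close> represent the composite of \<open>\<sigma>\<close> with the \<open>\<tau>\<^sub>i\<close>, the composite of \<open>\<alpha>\<close> with the
  \<open>\<beta>\<^sub>i\<close>, and the composite of the translated classes.  Then \<open>y\<close> is joined to \<open>u\<close> along \<open>\<delta>\<close>,
  followed by the pointwise composite of the loops that represent \<open>\<sigma>\<close> and the \<open>\<tau>\<^sub>i\<close>, followed by
  \<open>\<delta>\<inverse>\<close>; this track is homotopic to the loop \<open>w\<close>.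
\<close>

lemma pi_action_equivariant:
  assumes \<sigma>: "\<sigma> \<in> pi_set 1 (length ms)" and \<tau>s: "list_all2 (\<lambda>m \<tau>. \<tau> \<in> pi_set 1 m) ms \<tau>s"
    and \<alpha>: "\<alpha> \<in> pi_set l (length ms)" and \<beta>s: "list_all2 (\<lambda>m \<beta>. \<beta> \<in> pi_set l m) ms \<beta>s"
  shows "ocomp (pi_operad l \<C> \<eta>) ms (pi_action l \<C> \<eta> (length ms) \<sigma> \<alpha>)
      (map (\<lambda>i. pi_action l \<C> \<eta> (ms ! i) (\<tau>s ! i) (\<beta>s ! i)) [0..<length ms]) =
    pi_action l \<C> \<eta> (sum_list ms) (gcomp (pi1_group_operad \<C> \<eta>) ms \<sigma> \<tau>s)
      (ocomp (pi_operad l \<C> \<eta>) ms \<alpha> \<beta>s)"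
proof -
  note cmp = computes_pi_compD[OF computes_pi_comp_pi_operad]
  note gcmp = computes_pi_compD[OF computes_pi_comp_pi1_group_operad]
  let ?X = "ospace \<C> (sum_list ms)" and ?d = "delta_path \<eta> ms"
  obtain s where s: "s \<in> maps 1 (length ms)" "\<sigma> = cls 1 (length ms) s"
    using \<sigma> by (rule homotopy_setE)
  obtain ts where ts: "list_all2 (\<lambda>m g. g \<in> maps 1 m) ms ts" "\<tau>s = map2 (cls 1) ms ts"
    using \<tau>s by (rule class_list_representatives)
  obtain f where f: "f \<in> maps l (length ms)" "\<alpha> = cls l (length ms) f"
    using \<alpha> by (rule homotopy_setE)
  obtain gs where gs: "list_all2 (\<lambda>m g. g \<in> maps l m) ms gs" "\<beta>s = map2 (cls l) ms gs"
    using \<beta>s by (rule class_list_representatives)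
  have len: "length ts = length ms" "length gs = length ms"
    using ts(1) gs(1) by (auto dest!: list_all2_lengthD)
  have tg: "ts ! i \<in> maps 1 (ms ! i)" "gs ! i \<in> maps l (ms ! i)" if "i < length ms" for i
    using ts(1) gs(1) that by (auto simp: list_all2_conv_all_nth)
  obtain f' where f': "f' \<in> maps l (length ms)" "transport l (ospace \<C> (length ms)) (s \<circ> circ) f' f"
    "pi_action l \<C> \<eta> (length ms) \<sigma> \<alpha> = cls l (length ms) f'"
    using pi1_action_representative[OF s(1) f(1)] s(2) f(2) unfolding pi_action_def by metis
  have "\<exists>k. k \<in> maps l (ms ! i) \<and>
      transport l (ospace \<C> (ms ! i)) ((ts ! i) \<circ> circ) k (gs ! i) \<and>
      pi_action l \<C> \<eta> (ms ! i) (cls 1 (ms ! i) (ts ! i)) (cls l (ms ! i) (gs ! i)) = cls l (ms ! i) k"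
    if "i < length ms" for i
    unfolding pi_action_def by (rule pi1_action_representative[OF tg[OF that]]) blast
  then obtain k where k: "\<And>i. i < length ms \<Longrightarrow> k i \<in> maps l (ms ! i)"
    "\<And>i. i < length ms \<Longrightarrow> transport l (ospace \<C> (ms ! i)) ((ts ! i) \<circ> circ) (k i) (gs ! i)"
    "\<And>i. i < length ms \<Longrightarrow>
      pi_action l \<C> \<eta> (ms ! i) (cls 1 (ms ! i) (ts ! i)) (cls l (ms ! i) (gs ! i)) = cls l (ms ! i) (k i)"
    by metis
  let ?ks = "map k [0..<length ms]"
  have ks: "list_all2 (\<lambda>m g. g \<in> maps l m) ms ?ks"
    using k(1) by (auto simp: list_all2_conv_all_nth)
  have acts: "map (\<lambda>i. pi_action l \<C> \<eta> (ms ! i) (\<tau>s ! i) (\<beta>s ! i)) [0..<length ms] = map2 (cls l) ms ?ks"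
    using k(3) len by (auto simp: ts(2) gs(2) intro!: nth_equalityI)
  obtain y where y: "y \<in> maps l (sum_list ms)" "transport l ?X ?d y (pointwise_comp \<C> ms f' ?ks)"
    using f'(1) ks by (rule composite_representative)
  obtain u where u: "u \<in> maps l (sum_list ms)" "transport l ?X ?d u (pointwise_comp \<C> ms f gs)"
    using f(1) gs(1) by (rule composite_representative)
  obtain w where w: "w \<in> maps 1 (sum_list ms)" "transport 1 ?X ?d w (pointwise_comp \<C> ms s ts)"
    using s(1) ts(1) by (rule composite_representative)
  have "transport l ?X (pointwise_comp \<C> ms (s \<circ> circ) (map (\<lambda>t. t \<circ> circ) ts))
      (pointwise_comp \<C> ms f' ?ks) (pointwise_comp \<C> ms f gs)"
    by (rule transport_pointwise_comp[OF operad f'(2)]) (use k(2) len in auto)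
  then have "transport l ?X (pointwise_comp \<C> ms s ts \<circ> circ)
      (pointwise_comp \<C> ms f' ?ks) (pointwise_comp \<C> ms f gs)"
    by (simp add: pointwise_comp_def[abs_def] o_def)
  from transport_join[OF y(2) transport_join[OF this transport_reverse[OF u(2)]]]
  have "transport l ?X (w \<circ> circ) y u"
    by (rule transport_path_cong[OF path_homotopic_sym[OF transport_circ[OF w(2)]]])
  from pi1_action_eq[OF w(1) this]
  have "pi_action l \<C> \<eta> (sum_list ms) (cls 1 (sum_list ms) w) (cls l (sum_list ms) u) = cls l (sum_list ms) y"
    by (simp add: pi_action_def)
  then show ?thesis
    unfolding acts f'(3)
    using cmp[OF f'(1) ks y(2)] cmp[OF f(1) gs(1) u(2)] gcmp[OF s(1) ts(1) w(2)]
    by (simp add: f(2) gs(2) s(2) ts(2))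
qed

lemma G_operad_pi: "G_operad (pi1_group_operad \<C> \<eta>) (pi_operad l \<C> \<eta>) (pi_action l \<C> \<eta>)"
proof -
  let ?G = "pi1_group_operad \<C> \<eta>" and ?D = "pi_operad l \<C> \<eta>"
  have group: "ggroup ?G n = pi1_group (ospace \<C> n) (basept \<eta> n)" and perm: "gperm ?G = (\<lambda>_ _. id)" for n
    by (simp_all add: pi1_group_operad_def)
  have space: "ospace ?D n = discrete_topology (pi_set l n)" for n
    by (simp add: pi_operad_def)
  have action: "group_action (pi1_group (ospace \<C> n) (basept \<eta> n)) (pi_set l n) (pi_action l \<C> \<eta> n)" for n
    unfolding pi_action_def by (rule pi1_action_group_action) simp
  have "topological_operad ?D"
    by (rule topological_operad_pi[OF computes_pi_comp_pi_operad space])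
      (simp add: pi_operad_def basept_1)
  moreover have "pi_action l \<C> \<eta> n \<sigma> \<in> pi_set l n \<rightarrow> pi_set l n" if "\<sigma> \<in> pi_set 1 n" for n \<sigma>
    using group_action.bij_prop0[OF action, of \<sigma> n] that by (auto dest: Bij_imp_funcset)
  moreover have "oelem ?D = (\<lambda>n \<alpha>. \<alpha> \<in> pi_set l n)"
    by (simp add: oelem_def space fun_eq_iff)
  ultimately show ?thesis
    unfolding G_operad_def
    using group_operad_pi1 action pi_action_equivariant by (auto simp: group perm space Let_def)
qed

lemma pi_operad_comp_eq:
  assumes f: "f \<in> maps l (length ms)" and gs: "list_all2 (\<lambda>m g. g \<in> maps l m) ms gs"
  shows "ocomp (pi_operad l \<C> \<eta>) ms (cls l (length ms) f) (map2 (cls l) ms gs) = pi_rep_comp l \<C> \<eta> ms f gs"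
proof -
  obtain u where "transport l (ospace \<C> (sum_list ms)) (delta_path \<eta> ms) u (pointwise_comp \<C> ms f gs)"
    using f gs by (rule composite_representative)
  then show ?thesis
    using computes_pi_compD[OF computes_pi_comp_pi_operad f gs] pi_rep_comp_eq by simp
qed

end

theorem theorem3p5:
  fixes \<C> :: "'a operad_data"
    and \<eta> :: "nat \<Rightarrow> (real \<Rightarrow> real) list \<Rightarrow> 'a"
    and l :: nat
  assumes "topological_operad \<C>"
    and "path_connected_operad \<C>"
    and "good_basepoint \<C> \<eta>"
    and "l \<ge> 1"
  shows "G_operad (pi1_group_operad \<C> \<eta>) (pi_operad l \<C> \<eta>) (pi_action l \<C> \<eta>)
    \<and> (\<forall>ms f gs.
          f \<in> based_maps l (ospace \<C> (length ms)) (basept \<eta> (length ms)) \<and>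
          list_all2 (\<lambda>m g. g \<in> based_maps l (ospace \<C> m) (basept \<eta> m)) ms gs \<longrightarrow>
          ocomp (pi_operad l \<C> \<eta>) ms
            (htpy_class l (ospace \<C> (length ms)) (basept \<eta> (length ms)) f)
            (map2 (\<lambda>m g. htpy_class l (ospace \<C> m) (basept \<eta> m) g) ms gs) =
          change_basepoint l (ospace \<C> (sum_list ms)) (delta_path \<eta> ms)
            (htpy_class l (ospace \<C> (sum_list ms))
              (ocomp \<C> ms (basept \<eta> (length ms)) (map (basept \<eta>) ms))
              (pointwise_comp \<C> ms f gs)))
    \<and> (l = 1 \<longrightarrow> (\<forall>k. \<forall>\<sigma>\<in>carrier (pi1_group (ospace \<C> k) (basept \<eta> k)).
          \<forall>\<alpha>\<in>homotopy_set 1 (ospace \<C> k) (basept \<eta> k).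
            pi_action 1 \<C> \<eta> k \<sigma> \<alpha> =
              \<sigma> \<otimes>\<^bsub>pi1_group (ospace \<C> k) (basept \<eta> k)\<^esub> \<alpha>
                \<otimes>\<^bsub>pi1_group (ospace \<C> k) (basept \<eta> k)\<^esub>
                inv\<^bsub>pi1_group (ospace \<C> k) (basept \<eta> k)\<^esub> \<sigma>))"
proof -
  interpret good_operad \<C> \<eta>
    by standard (use assms in auto)
  show ?thesis
  proof (intro conjI allI impI ballI)
    show "G_operad (pi1_group_operad \<C> \<eta>) (pi_operad l \<C> \<eta>) (pi_action l \<C> \<eta>)"
      by (rule G_operad_pi)
  next
    fix ms f gs
    assume "f \<in> maps l (length ms) \<and> list_all2 (\<lambda>m g. g \<in> maps l m) ms gs"
    then show "ocomp (pi_operad l \<C> \<eta>) ms (cls l (length ms) f) (map2 (cls l) ms gs) =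
        change_basepoint l (ospace \<C> (sum_list ms)) (delta_path \<eta> ms)
          (htpy_class l (ospace \<C> (sum_list ms))
            (ocomp \<C> ms (basept \<eta> (length ms)) (map (basept \<eta>) ms)) (pointwise_comp \<C> ms f gs))"
      using pi_operad_comp_eq unfolding pi_rep_comp_def by blast
  next
    fix k \<sigma> \<alpha>
    assume "\<sigma> \<in> carrier (pi1_group (ospace \<C> k) (basept \<eta> k))" "\<alpha> \<in> pi_set 1 k"
    then show "pi_action 1 \<C> \<eta> k \<sigma> \<alpha> =
      \<sigma> \<otimes>\<^bsub>pi1_group (ospace \<C> k) (basept \<eta> k)\<^esub> \<alpha>
        \<otimes>\<^bsub>pi1_group (ospace \<C> k) (basept \<eta> k)\<^esub> inv\<^bsub>pi1_group (ospace \<C> k) (basept \<eta> k)\<^esub> \<sigma>"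
      unfolding pi_action_def by (intro pi1_action_conj) auto
  qed
qed

end
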